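(* Let $0<p,q,u,v<\infty$ and $\alpha,\beta>-1$. Then $\mathscr{H}^{p,q}_\alpha\subset\mathscr{H}^{u,v}_\beta$ if and only if one of the following holds: (i) $p\geq u$ and $\frac{\alpha+1}{q}<\frac{\beta+1}{v}$; or (ii) $p\geq u$, $\frac{\alpha+1}{q}=\frac{\beta+1}{v}$ and $q\leq v$.
   Context: $\mathcal{P}$ is the space of Dirichlet polynomials $\sum_{n=1}^Na_nn^{-s}$ ($a_n\in\mathbb{C}$). Let $p_j$ be the $j$th prime and write $n=\prod_j p_j^{\nu_j(n)}$. The Bohr lift of $P(s)=\sum_{n=1}^N a_nn^{-s}$ is $\mathscr{B}P(z)=\sum_{n=1}^N a_nz^{\nu(n)}$, where $z=(z_1,z_2,\dots)$ and $z^{\nu(n)}=\prod_jz_j^{\nu_j(n)}$. For $0<p<\infty$ and $P\in\mathcal{P}$, $\|P\|_{\mathscr{H}^p}=\left(\int_{\mathbb{T}^\infty}|\mathscr{B}P(z)|^p\,dm_\infty(z)\right)^{1/p}$, where $m_\infty$ is the Haar probability measure on the infinite torus $\mathbb{T}^\infty$. For $\sigma\ge0$, $P_\sigma(s)=P(s+\sigma)$. For $0<p,q<\infty$ and $\alpha>-1$, the mixed norm space $\mathscr{H}^{p,q}_\alpha$ is the completion of $\mathcal{P}$ with respect to the (quasi-)norm $\|P\|_{\mathscr{H}^{p,q}_\alpha}=\left(\int_0^{+\infty}\|P_\sigma\|_{\mathscr{H}^p}^q\,d\mu_\alpha(\sigma)\right)^{1/q}$, where $d\mu_\alpha(\sigma)=\frac{2^{\alpha+1}}{\Gamma(\alpha+1)}\sigma^\alpha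 e^{-2\sigma}d\sigma$. Its elements are identified with Dirichlet series converging on $\mathbb{C}_{1/2}=\{s\in\mathbb{C}:\Re s>1/2\}$ (via continuous extension of point evaluations), and inclusion is understood as inclusion of sets of such Dirichlet series. *)

theory Defs
  imports
    "HOL-Probability.Probability"
    "HOL-Computational_Algebra.Primes"
    "HOL-Library.Infinite_Set"
begin

text \<open>
  A Dirichlet series $\sum_{n\ge 1} a_n n^{-s}$ is represented by its coefficient function
  \<open>a :: nat \<Rightarrow> complex\<close>, normalised by \<open>a 0 = 0\<close>.
\<close>

definition dirichlet_poly :: "(nat \<Rightarrow> complex) \<Rightarrow> bool" where
  "dirichlet_poly a \<longleftrightarrow> a 0 = 0 \<and> finite {n. a n \<noteq> 0}"

definition dirichlet_converges :: "(nat \<Rightarrow> complex) \<Rightarrow> complex \<Rightarrow> bool" where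
  "dirichlet_converges a s \<longleftrightarrow> summable (\<lambda>n. a n * of_nat n powr (- s))"

definition dirichlet_eval :: "(nat \<Rightarrow> complex) \<Rightarrow> complex \<Rightarrow> complex" where
  "dirichlet_eval a s = (\<Sum>n. a n * of_nat n powr (- s))"

text \<open>Coefficients of $P_\sigma(s) = P(s+\sigma)$.\<close>

definition dirichlet_shift :: "real \<Rightarrow> (nat \<Rightarrow> complex) \<Rightarrow> nat \<Rightarrow> complex" where
  "dirichlet_shift \<sigma> a n = a n * of_real (real n powr (- \<sigma>))"

text \<open>Primes and variables are numbered from 0, so \<open>nth_prime j\<close> is $p_{j+1}$.\<close>

definition nth_prime :: "nat \<Rightarrow> nat" where
  "nth_prime = enumerate {p. prime p}"

definition prime_exponent :: "nat \<Rightarrow> nat \<Rightarrow> nat" where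
  "prime_exponent n j = multiplicity (nth_prime j) n"

definition prime_monomial :: "nat \<Rightarrow> (nat \<Rightarrow> complex) \<Rightarrow> complex" where
  "prime_monomial n z = (\<Prod>j | prime_exponent n j \<noteq> 0. z j ^ prime_exponent n j)"

definition bohr_lift :: "(nat \<Rightarrow> complex) \<Rightarrow> (nat \<Rightarrow> complex) \<Rightarrow> complex" where
  "bohr_lift a z = (\<Sum>n | a n \<noteq> 0. a n * prime_monomial n z)"

text \<open>
  The Haar probability measure of the infinite torus is the countable product of normalised
  arc length measures; its invariance is \<open>torus_haar_invariant\<close> below.
\<close>

definition circle_haar :: "complex measure" where
  "circle_haar =
     distr (uniform_measure lborel {0..<2 * pi}) (restrict_space borel (sphere 0 1)) cis"

definition torus_haar :: "(nat \<Rightarrow> complex) measure" where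
  "torus_haar = (\<Pi>\<^sub>M j\<in>UNIV. circle_haar)"

lemma cis_measurable_circle:
  "cis \<in> uniform_measure lborel {0..<2 * pi} \<rightarrow>\<^sub>M restrict_space borel (sphere 0 1)"
proof -
  have "cis \<in> borel_measurable borel"
    by (intro borel_measurable_continuous_onI continuous_intros)
  then show ?thesis by (auto intro!: measurable_restrict_space2)
qed

lemma prob_space_circle_haar: "prob_space circle_haar"
  unfolding circle_haar_def
  by (intro prob_space.prob_space_distr prob_space_uniform_measure cis_measurable_circle) auto

lemma space_circle_haar: "space circle_haar = sphere 0 1"
  by (simp add: circle_haar_def space_restrict_space)

lemma sets_circle_haar [measurable_cong]:
  "sets circle_haar = sets (restrict_space borel (sphere 0 1))"
  by (simp add: circle_haar_def)

lemma prob_space_torus_haar: "prob_space torus_haar"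
  unfolding torus_haar_def by (intro prob_space_PiM prob_space_circle_haar)

lemma space_torus_haar: "space torus_haar = {z. \<forall>j. norm (z j) = 1}"
  by (auto simp: torus_haar_def space_PiM space_circle_haar PiE_def Pi_def)

lemma mult_measurable_circle:
  assumes "norm w = 1"
  shows "(\<lambda>z. w * z) \<in> circle_haar \<rightarrow>\<^sub>M circle_haar"
proof -
  have "(\<lambda>z. w * z) \<in> restrict_space borel (sphere 0 1) \<rightarrow>\<^sub>M restrict_space borel (sphere 0 1)"
    using assms
    by (intro measurable_restrict_space2 measurable_restrict_space1)
       (auto simp: space_restrict_space norm_mult)
  then show ?thesis by (simp cong: measurable_cong_sets add: sets_circle_haar)
qed

lemma emeasure_lborel_shift:
  assumes "B \<in> sets borel"
  shows "emeasure lborel {x::real. x + c \<in> B} = emeasure lborel B"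
proof -
  have "emeasure lborel B = emeasure (distr lborel borel ((+) c)) B"
    by (simp add: lborel_distr_plus)
  also have "\<dots> = emeasure lborel {x. x + c \<in> B}"
    using assms by (subst emeasure_distr) (auto simp: vimage_def add.commute)
  finally show ?thesis by simp
qed

lemma emeasure_circle_haar:
  assumes "A \<in> sets circle_haar"
  shows "emeasure circle_haar A = emeasure lborel {x\<in>{0..<2 * pi}. cis x \<in> A} / ennreal (2 * pi)"
proof -
  have A: "A \<in> sets (restrict_space borel (sphere 0 1))" using assms by (simp add: sets_circle_haar)
  have "cis -` A \<in> sets borel"
    using measurable_sets[OF cis_measurable_circle A] by simp
  moreover have "{0..<2 * pi} \<inter> cis -` A = {x\<in>{0..<2 * pi}. cis x \<in> A}" by auto
  ultimately show ?thesis
    using A cis_measurable_circle by (simp add: circle_haar_def emeasure_distr)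
qed

lemma circle_haar_invariant:
  assumes w: "norm w = 1"
  shows "distr circle_haar circle_haar (\<lambda>z. w * z) = circle_haar"
proof (rule measure_eqI)
  fix A assume "A \<in> sets (distr circle_haar circle_haar ((*) w))"
  then have A: "A \<in> sets circle_haar" by simp
  define t where "t = Arg2pi w"
  have t: "0 \<le> t" "t < 2 * pi" by (auto simp: t_def Arg2pi Arg2pi_lt_2pi)
  have wt: "w = cis t" using Arg2pi_eq[of w] w by (simp add: t_def cis_conv_exp)
  have A': "A \<in> sets (restrict_space borel (sphere 0 1))" using A by (simp add: sets_circle_haar)
  define B where "B = cis -` A"
  have B [measurable]: "B \<in> sets borel"
    using measurable_sets[OF cis_measurable_circle A'] by (simp add: B_def)
  have per: "x + 2 * pi \<in> B \<longleftrightarrow> x \<in> B" for x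
    by (simp add: B_def cis.code)
  have *: "(\<lambda>z. w * z) -` A \<inter> space circle_haar \<in> sets circle_haar"
    using measurable_sets[OF mult_measurable_circle[OF w] A] .
  have "emeasure (distr circle_haar circle_haar ((*) w)) A
      = emeasure circle_haar ((\<lambda>z. w * z) -` A \<inter> space circle_haar)"
    by (rule emeasure_distr[OF mult_measurable_circle[OF w] A])
  also have "\<dots> = emeasure lborel {x\<in>{0..<2 * pi}. x + t \<in> B} / ennreal (2 * pi)"
    by (subst emeasure_circle_haar[OF *])
       (simp add: space_circle_haar B_def wt cis_mult add.commute)
  also have "emeasure lborel {x\<in>{0..<2 * pi}. x + t \<in> B}
      = emeasure lborel {x. x + t \<in> B \<inter> {t..<2 * pi}}
        + emeasure lborel {x. x + (t - 2 * pi) \<in> B \<inter> {0..<t}}"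
  proof -
    have eq: "{x\<in>{0..<2 * pi}. x + t \<in> B}
        = {x. x + t \<in> B \<inter> {t..<2 * pi}} \<union> {x. x + (t - 2 * pi) \<in> B \<inter> {0..<t}}"
      using t per[of "_ + t - 2 * pi"] by (auto simp: algebra_simps)
    show ?thesis unfolding eq
      by (rule plus_emeasure[symmetric]) (use t in \<open>auto simp: algebra_simps\<close>)
  qed
  also have "\<dots> = emeasure lborel (B \<inter> {t..<2 * pi}) + emeasure lborel (B \<inter> {0..<t})"
    by (simp only: emeasure_lborel_shift[OF sets.Int[OF B]] atLeastLessThan_borel)
  also have "\<dots> = emeasure lborel {x\<in>{0..<2 * pi}. x \<in> B}"
    using t by (subst plus_emeasure) (auto intro!: arg_cong[where f = "emeasure lborel"])
  also have "\<dots> / ennreal (2 * pi) = emeasure circle_haar A"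
    by (simp add: emeasure_circle_haar[OF A] B_def)
  finally show "emeasure (distr circle_haar circle_haar ((*) w)) A = emeasure circle_haar A" .
qed simp

lemma torus_haar_invariant:
  assumes w: "\<And>j. norm (w j) = 1"
  shows "distr torus_haar torus_haar (\<lambda>z j. w j * z j) = torus_haar"
proof -
  interpret C: prob_space circle_haar by (rule prob_space_circle_haar)
  interpret product_prob_space "\<lambda>_. circle_haar" "UNIV :: nat set" by standard
  have rot [measurable]: "(\<lambda>z. w j * z) \<in> circle_haar \<rightarrow>\<^sub>M circle_haar" for j
    by (rule mult_measurable_circle[OF w])
  have meas: "(\<lambda>z j. w j * z j) \<in> torus_haar \<rightarrow>\<^sub>M torus_haar"
    unfolding torus_haar_def
  proof (rule measurable_PiM_single')
    fix j :: nat
    have "(\<lambda>z. z j) \<in> (\<Pi>\<^sub>M j\<in>UNIV. circle_haar) \<rightarrow>\<^sub>M circle_haar"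
      by (rule measurable_component_singleton) simp
    then show "(\<lambda>z. w j * z j) \<in> (\<Pi>\<^sub>M j\<in>UNIV. circle_haar) \<rightarrow>\<^sub>M circle_haar"
      by (rule measurable_compose) (rule rot)
  qed (auto simp: space_PiM PiE_def Pi_def space_circle_haar norm_mult w)
  have "distr torus_haar torus_haar (\<lambda>z j. w j * z j) = (\<Pi>\<^sub>M j\<in>UNIV. circle_haar)"
  proof (rule PiM_eq)
    fix J :: "nat set" and F
    assume J: "finite J" "J \<subseteq> UNIV" and F: "\<And>j. j \<in> J \<Longrightarrow> F j \<in> sets circle_haar"
    define G where "G j = (\<lambda>z. w j * z) -` F j \<inter> space circle_haar" for j
    have G: "G j \<in> sets circle_haar" if "j \<in> J" for j
      unfolding G_def by (rule measurable_sets[OF rot F[OF that]])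
    have GF: "emeasure circle_haar (G j) = emeasure circle_haar (F j)" if "j \<in> J" for j
      unfolding G_def
      by (subst emeasure_distr[OF rot F[OF that], symmetric]) (simp add: circle_haar_invariant w)
    let ?E = "\<lambda>F. prod_emb UNIV (\<lambda>_. circle_haar) J (Pi\<^sub>E J F)"
    have E: "?E F \<in> sets torus_haar"
      unfolding torus_haar_def using J F by (intro sets_PiM_I) auto
    have "(\<lambda>z j. w j * z j) -` ?E F \<inter> space torus_haar = ?E G"
      by (auto simp: prod_emb_def G_def torus_haar_def space_PiM space_circle_haar norm_mult w
            PiE_def Pi_def extensional_def restrict_def)
    then have "emeasure (distr torus_haar torus_haar (\<lambda>z j. w j * z j)) (?E F)
        = emeasure torus_haar (?E G)"
      by (simp add: emeasure_distr[OF meas E])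
    also have "\<dots> = (\<Prod>j\<in>J. emeasure circle_haar (G j))"
      unfolding torus_haar_def using J G by (intro emeasure_PiM_emb) auto
    also have "\<dots> = (\<Prod>j\<in>J. emeasure circle_haar (F j))"
      by (intro prod.cong refl GF)
    finally show "emeasure (distr torus_haar torus_haar (\<lambda>z j. w j * z j)) (?E F)
        = (\<Prod>j\<in>J. emeasure circle_haar (F j))" .
  qed (simp add: torus_haar_def)
  then show ?thesis by (simp add: torus_haar_def)
qed

definition hardy_norm :: "real \<Rightarrow> (nat \<Rightarrow> complex) \<Rightarrow> real" where
  "hardy_norm p a = (\<integral>z. norm (bohr_lift a z) powr p \<partial>torus_haar) powr (1 / p)"

definition mu_measure :: "real \<Rightarrow> real measure" where
  "mu_measure \<alpha> = density lborel (\<lambda>\<sigma>. ennreal (indicator {0<..} \<sigma> *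
     (2 powr (\<alpha> + 1) / Gamma (\<alpha> + 1) * \<sigma> powr \<alpha> * exp (- 2 * \<sigma>))))"

definition mixed_norm :: "real \<Rightarrow> real \<Rightarrow> real \<Rightarrow> (nat \<Rightarrow> complex) \<Rightarrow> real" where
  "mixed_norm p q \<alpha> a =
     (\<integral>\<sigma>. hardy_norm p (dirichlet_shift \<sigma> a) powr q \<partial>mu_measure \<alpha>) powr (1 / q)"

text \<open>
  An element of the completion is a class of sequences of Dirichlet polynomials that are Cauchy
  for the quasi-norm. It is identified with the Dirichlet series converging on the half-plane
  $\Re s > 1/2$ whose value at each \<open>s\<close> there is the limit of the values of such a sequence,
  that is, the continuous extension of evaluation at \<open>s\<close>.
\<close>

definition mixed_cauchy ::
    "real \<Rightarrow> real \<Rightarrow> real \<Rightarrow> (nat \<Rightarrow> nat \<Rightarrow> complex) \<Rightarrow> bool" where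
  "mixed_cauchy p q \<alpha> P \<longleftrightarrow>
     (\<forall>\<epsilon>>0. \<exists>K. \<forall>k\<ge>K. \<forall>l\<ge>K. mixed_norm p q \<alpha> (\<lambda>n. P k n - P l n) < \<epsilon>)"

definition mixed_norm_space :: "real \<Rightarrow> real \<Rightarrow> real \<Rightarrow> (nat \<Rightarrow> complex) set" where
  "mixed_norm_space p q \<alpha> = {a.
     a 0 = 0 \<and>
     (\<forall>s. Re s > 1 / 2 \<longrightarrow> dirichlet_converges a s) \<and>
     (\<exists>P. (\<forall>k. dirichlet_poly (P k)) \<and> mixed_cauchy p q \<alpha> P \<and>
       (\<forall>s. Re s > 1 / 2 \<longrightarrow>
         (\<lambda>k. dirichlet_eval (P k) s) \<longlonglongrightarrow> dirichlet_eval a s))}"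

end

theory Submission
  imports Defs
    "HOL-Complex_Analysis.Complex_Analysis"
    "HOL-Computational_Algebra.Fundamental_Theorem_Algebra"
    "HOL-Real_Asymp.Real_Asymp"
begin

text \<open>
  Sufficiency: \<open>\<sigma> \<mapsto> \<parallel>P\<^sub>\<sigma>\<parallel>\<close> is decreasing, since \<open>|F|\<^sup>p\<close> is subharmonic in each variable of the Bohr lift.
  Hence, for small \<open>\<sigma>\<close>, \<open>\<parallel>P\<^sub>\<sigma>\<parallel>\<close> is at most a constant times \<open>\<sigma> powr (- (\<alpha> + 1) / q)\<close> times the mixed norm, and the
  norm inequality follows by integration; it carries Cauchy sequences to Cauchy sequences.

  Necessity: if a condition fails, there are Dirichlet polynomials, built from arbitrarily large primes, that are
  small in the source and large in the target. For the weights these are \<open>\<Sum> l\<^sub>k powr ((\<alpha> + 1) / q) \<cdot> p\<^sub>k powr (- s)\<close>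
  with \<open>l\<^sub>k = ln p\<^sub>k\<close> lacunary; for \<open>p < u\<close> they are products of factors \<open>1 + p\<^sub>j powr (- s)\<close>, whose norm in a Hardy space
  is the product of the norms of the factors. A sum of such polynomials over disjoint blocks of primes lies in the
  source. If it were in the target, its blocks would be uniformly bounded there: the coefficients of the approximating
  polynomials converge, and setting the variables outside a block to \<open>0\<close> is a contraction.
\<close>

section \<open>Poisson integrals and subharmonicity on the circle\<close>

text \<open>Two obstacles shape the proof. The exponents may lie below \<open>1\<close>, where the
  norms are only quasi-norms and duality or Minkowski's integral inequality cannot be used. What
  survives for every \<open>p > 0\<close> is the sub-mean-value property of \<open>|F|^p\<close> for
  a polynomial \<open>F\<close> in one variable. Rotating a single coordinate of the torus carries
  it over to Bohr lifts, and the same inequality at interior points also bounds single coefficients.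
  The other obstacle is the completion. An element of it is known only through its values on the
  half-plane, and its approximating sequence in the target may have nothing in common with the one
  built in the source, so the divergence of one particular sequence proves nothing. Coefficients are
  what two such sequences share in the limit. Convergence of coefficients alone does not control
  norms, but over finitely many primes it does, because there the coefficient bounds have a summable
  majorant. The humps must moreover be small in the sum of \<open>|a_n| n^(-1/2)\<close>: their sum
  has to be a Dirichlet series that converges on the half-plane before it can belong to the source
  at all.\<close>

lemma poisson_formula:
  fixes f :: "complex \<Rightarrow> complex"
  assumes f: "f holomorphic_on ball 0 R" and R: "R > 1" and r: "0 \<le> r" "r < (1::real)"
  shows "((\<lambda>t. f (cis t) * of_real ((1 - r\<^sup>2) / (norm (1 - of_real r * cis t))\<^sup>2))
           has_integral (2 * pi * f (of_real r))) {0..2 * pi}"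
proof -
  \<comment> \<open>Cauchy's formula at \<open>r\<close> is applied to \<open>g\<close> instead of
    \<open>f\<close>: on the circle \<open>1 - r w\<close> is \<open>w\<close> times the conjugate
    of \<open>w - r\<close>, so the two denominators combine to the real kernel, and
    \<open>g r = f r / (1 - r^2)\<close> accounts for its numerator.\<close>
  define g where "g w = f w / (1 - of_real r * w)" for w :: complex
  have nz: "1 - of_real r * w \<noteq> 0" if "norm w \<le> 1" for w :: complex
  proof
    assume "1 - of_real r * w = 0"
    then have "norm (of_real r * w) = 1" by (metis eq_iff_diff_eq_0 norm_one)
    moreover have "norm (of_real r * w) \<le> r * 1" using that r mult_left_mono[of "norm w" 1 r] by (simp add: norm_mult)
    ultimately show False using r by simp
  qed
  have fc: "f holomorphic_on cball 0 1"
    using f by (rule holomorphic_on_subset) (use R in auto)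
  have g: "g holomorphic_on cball 0 1"
    unfolding g_def using nz by (intro holomorphic_intros fc) auto
  have "((\<lambda>u. g u / (u - of_real r)) has_contour_integral (2 * of_real pi * \<i> * g (of_real r))) (circlepath 0 1)"
    using r by (intro Cauchy_integral_circlepath holomorphic_on_imp_continuous_on g holomorphic_on_subset[OF g]) auto
  then have "((\<lambda>t. g (cis t) / (cis t - of_real r) * \<i> * cis t) has_integral (2 * of_real pi * \<i> * g (of_real r))) {0..2*pi}"
    unfolding circlepath_def by (subst (asm) has_contour_integral_part_circlepath_iff) auto
  then have "((\<lambda>t. g (cis t) / (cis t - of_real r) * \<i> * cis t * (of_real (1 - r\<^sup>2) / \<i>)) has_integral
      (2 * of_real pi * \<i> * g (of_real r)) * (of_real (1 - r\<^sup>2) / \<i>)) {0..2*pi}"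
    by (rule has_integral_mult_left)
  moreover have "(2 * of_real pi * \<i> * g (of_real r)) * (of_real (1 - r\<^sup>2) / \<i>) = 2 * pi * f (of_real r)"
  proof -
    have "1 - of_real r * of_real r \<noteq> (0::complex)" using nz[of "of_real r"] r by auto
    then show ?thesis by (simp add: g_def power2_eq_square)
  qed
  moreover have "g (cis t) / (cis t - of_real r) * \<i> * cis t * (of_real (1 - r\<^sup>2) / \<i>)
       = f (cis t) * of_real ((1 - r\<^sup>2) / (norm (1 - of_real r * cis t))\<^sup>2)" for t
  proof -
    have n: "of_real ((norm (1 - of_real r * cis t))\<^sup>2) = (1 - of_real r * cis t) * (1 - of_real r * cis (- t))"
      by (simp only: complex_norm_square complex_cnj_diff complex_cnj_mult complex_cnj_one complex_cnj_complex_of_real cis_cnj)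
    have n2: "cis t - of_real r = cis t * (1 - of_real r * cis (-t))"
      by (simp add: algebra_simps cis_mult)
    have "1 - of_real r * cis t \<noteq> 0" "1 - of_real r * cis (-t) \<noteq> 0" using nz by auto
    then show ?thesis unfolding of_real_divide n n2 g_def by (simp add: divide_simps mult.assoc)
      (simp add: right_diff_distrib flip: mult.assoc)
  qed
  ultimately show ?thesis by (simp only:)
qed

text \<open>Each factor \<open>1 - b z\<close> has positive real part on the closed disc, so its principal power is
  holomorphic there: no logarithm on a simply connected domain is needed.\<close>

lemma zero_free_prod_poisson:
  fixes b :: "nat \<Rightarrow> complex"
  assumes b: "\<And>i. i < n \<Longrightarrow> norm (b i) < 1" and r: "0 \<le> r" "r < 1"
  shows "2 * pi * norm (\<Prod>i<n. 1 - b i * of_real r) powr p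
    \<le> integral {0..2 * pi} (\<lambda>t. (1 - r\<^sup>2) / (norm (1 - of_real r * cis t))\<^sup>2
          * norm (\<Prod>i<n. 1 - b i * cis t) powr p)"
proof -
  \<comment> \<open>The inserted \<open>1/2\<close> keeps the maximum positive, so that
    \<open>R = 1 / m\<close> makes sense also when all \<open>b i\<close> vanish or
    \<open>n = 0\<close>.\<close>
  define m where "m = Max (insert (1/2) ((\<lambda>i. norm (b i)) ` {..<n}))"
  have m: "m < 1" "1/2 \<le> m" "\<And>i. i < n \<Longrightarrow> norm (b i) \<le> m"
  proof -
    show "m < 1" unfolding m_def using b by (subst Max_less_iff) auto
    show "1/2 \<le> m" unfolding m_def by (intro Max_ge) auto
    show "norm (b i) \<le> m" if "i < n" for i unfolding m_def using that by (intro Max_ge) auto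
  qed
  define R where "R = 1 / m"
  have R: "R > 1" using m by (simp add: R_def)
  define H where "H z = (\<Prod>i<n. (1 - b i * z) powr of_real p)" for z
  have pos: "Re (1 - b i * z) > 0" if "i < n" "norm z < R" for i z
  proof -
    have "norm (b i * z) \<le> m * norm z" using m(3)[OF that(1)] by (simp add: norm_mult mult_right_mono)
    also have "\<dots> < m * R" using that m by (intro mult_strict_left_mono) auto
    also have "\<dots> = 1" using m by (simp add: R_def)
    finally show ?thesis using complex_Re_le_cmod[of "b i * z"] by simp
  qed
  have hol: "H holomorphic_on ball 0 R"
    unfolding H_def using pos by (intro holomorphic_intros) (fastforce simp: complex_nonpos_Reals_iff)
  have nH: "norm (H z) = norm (\<Prod>i<n. 1 - b i * z) powr p" for z
    by (simp add: H_def flip: prod_norm) (simp add: norm_powr_real_powr' prod_powr_distrib)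
  let ?K = "\<lambda>t. (1 - r\<^sup>2) / (norm (1 - of_real r * cis t))\<^sup>2"
  have K0: "?K t \<ge> 0" for t using r by (simp add: power2_eq_square mult_le_one)
  have int: "((\<lambda>t. H (cis t) * of_real (?K t)) has_integral (2 * pi * H (of_real r))) {0..2 * pi}"
    by (rule poisson_formula[OF hol R r])
  have nz: "norm (1 - of_real r * cis t) \<noteq> 0" for t
  proof -
    have "norm (of_real r * cis t) < 1" using r by (simp add: norm_mult)
    then show ?thesis by auto
  qed
  have cont: "continuous_on {0..2*pi} (\<lambda>t. ?K t * norm (\<Prod>i<n. 1 - b i * cis t) powr p)"
    unfolding nH[symmetric] using nz
    by (intro continuous_intros continuous_on_compose2[OF holomorphic_on_imp_continuous_on[OF hol]])
       (use R in auto)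
  have nHK: "norm (H (cis t) * of_real (?K t)) = ?K t * norm (\<Prod>i<n. 1 - b i * cis t) powr p" for t
    unfolding norm_mult norm_of_real nH using K0[of t] by (simp only: abs_of_nonneg mult.commute)
  have "norm (integral {0..2*pi} (\<lambda>t. H (cis t) * of_real (?K t)))
     \<le> integral {0..2*pi} (\<lambda>t. ?K t * norm (\<Prod>i<n. 1 - b i * cis t) powr p)"
    by (rule integral_norm_bound_integral[OF has_integral_integrable[OF int] integrable_continuous_interval[OF cont]])
       (simp only: nHK order_refl)
  also have "integral {0..2*pi} (\<lambda>t. H (cis t) * of_real (?K t)) = 2 * pi * H (of_real r)"
    by (rule integral_unique[OF int])
  finally show ?thesis by (simp add: norm_mult nH)
qed

text \<open>Zeros on the circle destroy the holomorphic powers, so each \<open>b i\<close> is first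
  shrunk to \<open>s * b i\<close> with \<open>s < 1\<close>. Both sides are continuous in
  \<open>s\<close> up to \<open>1\<close>; at zeros of the product this rests on
  \<open>p > 0\<close>.\<close>

lemma zero_free_prod_poisson_closed:
  fixes b :: "nat \<Rightarrow> complex"
  assumes b: "\<And>i. i < n \<Longrightarrow> norm (b i) \<le> 1" and r: "0 \<le> r" "r < 1" and p: "p > 0"
  shows "2 * pi * norm (\<Prod>i<n. 1 - b i * of_real r) powr p
    \<le> integral {0..2 * pi} (\<lambda>t. (1 - r\<^sup>2) / (norm (1 - of_real r * cis t))\<^sup>2
          * norm (\<Prod>i<n. 1 - b i * cis t) powr p)"
proof -
  let ?K = "\<lambda>t. (1 - r\<^sup>2) / (norm (1 - of_real r * cis t))\<^sup>2"
  define L where "L s = 2 * pi * norm (\<Prod>i<n. 1 - (of_real s * b i) * of_real r) powr p" for s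
  define I where "I s = integral (cbox 0 (2*pi)) (\<lambda>t. ?K t * norm (\<Prod>i<n. 1 - (of_real s * b i) * cis t) powr p)" for s
  have nz: "norm (1 - of_real r * cis t) \<noteq> 0" for t
  proof -
    have "norm (of_real r * cis t) < 1" using r by (simp add: norm_mult)
    then show ?thesis by auto
  qed
  have cI: "continuous_on {0..1} I" unfolding I_def
    by (rule integral_continuous_on_param)
       (unfold split_beta, intro continuous_intros continuous_on_powr', use p nz in auto)
  have cL: "continuous_on {0..1} L" unfolding L_def
    by (intro continuous_intros continuous_on_powr') (use p in auto)
  have le: "L s \<le> I s" if "s \<in> {0<..<1}" for s
  proof -
    have "norm (of_real s * b i) < 1" if "i < n" for i
    proof -
      have "s * norm (b i) \<le> s * 1" using b[OF that] \<open>s \<in> _\<close> by (intro mult_left_mono) auto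
      also have "\<dots> < 1" using \<open>s \<in> _\<close> by simp
      finally show ?thesis using \<open>s \<in> _\<close> by (simp add: norm_mult)
    qed
    from zero_free_prod_poisson[where b = "\<lambda>i. of_real s * b i", OF this r, where p = p]
    show ?thesis by (simp add: L_def I_def)
  qed
  have "L 1 \<le> I 1"
  proof (rule tendsto_le)
    show "at_left (1::real) \<noteq> bot" by simp
    show "(I \<longlongrightarrow> I 1) (at_left 1)"
      using cI by (simp add: continuous_on_Icc_at_leftD)
    show "(L \<longlongrightarrow> L 1) (at_left 1)"
      using cL by (simp add: continuous_on_Icc_at_leftD)
    show "\<forall>\<^sub>F x in at_left 1. L x \<le> I x"
      using eventually_at_left_field[of _ "1::real"] le by (auto intro!: exI[of _ 0])
  qed
  then show ?thesis by (simp add: L_def I_def)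
qed

text \<open>The squares of the two sides differ by \<open>(1 - |w|^2) (1 - |z|^2)\<close>, which is
  nonnegative on the disc. This is the bound \<open>1\<close> for a Blaschke factor, written without
  a quotient.\<close>

lemma reflect_root_norm:
  assumes "norm (w::complex) \<le> 1" "norm z \<le> 1"
  shows "norm (z - w) \<le> norm (1 - cnj w * z)"
proof -
  \<comment> \<open>\<open>v\<close> and \<open>y\<close> stand for the conjugates of
    \<open>w\<close> and \<open>z\<close>; with independent letters the identity is purely
    algebraic.\<close>
  have *: "(1 - v * z) * (1 - w * y) - (z - w) * (y - v) = (1 - w * v) * (1 - z * y)" for v y :: complex
    by (simp add: algebra_simps)
  have "complex_of_real ((norm (1 - cnj w * z))\<^sup>2 - (norm (z - w))\<^sup>2)
      = complex_of_real ((1 - (norm w)\<^sup>2) * (1 - (norm z)\<^sup>2))"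
    using *[of "cnj w" "cnj z"] unfolding of_real_diff of_real_mult of_real_1 complex_norm_square by simp
  then have "(norm (1 - cnj w * z))\<^sup>2 - (norm (z - w))\<^sup>2 = (1 - (norm w)\<^sup>2) * (1 - (norm z)\<^sup>2)"
    by (simp only: of_real_eq_iff)
  moreover have "(1 - (norm w)\<^sup>2) * (1 - (norm z)\<^sup>2) \<ge> 0" 
    using power_le_one[OF norm_ge_zero assms(1), of 2] power_le_one[OF norm_ge_zero assms(2), of 2]
    by (intro mult_nonneg_nonneg) linarith+
  ultimately have "(norm (z - w))\<^sup>2 \<le> (norm (1 - cnj w * z))\<^sup>2" by linarith
  then show ?thesis by (rule power2_le_imp_le) simp
qed

lemma reflect_root_norm_circle:
  assumes "norm (z::complex) = 1"
  shows "norm (z - w) = norm (1 - cnj w * z)"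
proof -
  have "norm (1 - cnj w * z) = norm (z * cnj (z - w))"
  proof -
    have "z * cnj z = 1" using assms by (simp add: complex_norm_square[symmetric])
    then have "1 - cnj w * z = z * cnj (z - w)" by (simp add: algebra_simps)
    then show ?thesis by simp
  qed
  also have "\<dots> = norm (z - w)" using assms by (simp add: norm_mult del: complex_cnj_diff)
  finally show ?thesis by simp
qed

text \<open>The Blaschke factors are divided out: reflecting a root of the open disc across the
  circle changes no modulus on the circle and lowers none inside. What remains is a constant times a
  product without zeros in the open disc, to which the holomorphic argument applies for every
  \<open>p > 0\<close>.\<close>

lemma poly_poisson_integral:
  fixes F :: "complex poly"
  assumes r: "0 \<le> r" "r < 1" and p: "p > 0"
  shows "2 * pi * norm (poly F (of_real r)) powr p
    \<le> integral {0..2 * pi} (\<lambda>t. (1 - r\<^sup>2) / (norm (1 - of_real r * cis t))\<^sup>2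
          * norm (poly F (cis t)) powr p)"
proof (cases "F = 0")
  case False
  obtain A where A: "F = smult (lead_coeff F) (\<Prod>x\<in>#A. [:-x, 1:])"
    using alg_closed_imp_factorization[OF False] by blast
  obtain xs where xs: "mset xs = A" by (metis ex_mset)
  define n where "n = length xs"
  define w where "w i = xs ! i" for i
  have F': "F = smult (lead_coeff F) (\<Prod>i<n. [:- w i, 1:])"
    unfolding n_def w_def
    by (subst A) (simp add: xs[symmetric] prod_mset_prod_list prod.list_conv_set_nth atLeast0LessThan
        flip: mset_map)
  then have F: "poly F z = lead_coeff F * (\<Prod>i<n. z - w i)" for z
  proof -
    have "poly F z = poly (smult (lead_coeff F) (\<Prod>i<n. [:- w i, 1:])) z"
      using F' by (rule arg_cong)
    then show ?thesis by (simp add: poly_prod)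
  qed
  \<comment> \<open>A factor whose root has modulus at least \<open>1\<close> is only normalised to
    constant term \<open>1\<close>, its size going into \<open>c i\<close>. In both cases
    \<open>norm (b i) \<le> 1\<close>.\<close>
  define b where "b i = (if norm (w i) < 1 then cnj (w i) else 1 / w i)" for i
  define c where "c i = (if norm (w i) < 1 then 1 else norm (w i))" for i
  have b: "norm (b i) \<le> 1" for i by (auto simp: b_def norm_divide divide_simps)
  have c0: "c i \<ge> 0" for i by (simp add: c_def)
  have big: "norm (z - w i) = c i * norm (1 - b i * z)" if "\<not> norm (w i) < 1" for z i
  proof -
    have "z - w i = - w i * (1 - b i * z)" using that by (auto simp: b_def algebra_simps)
    then have "norm (z - w i) = norm (- w i * (1 - b i * z))" by simp
    then show ?thesis using that by (simp add: norm_mult c_def)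
  qed
  have le: "norm (z - w i) \<le> c i * norm (1 - b i * z)" if "norm z \<le> 1" for z i
  proof (cases "norm (w i) < 1")
    case True
    then show ?thesis using reflect_root_norm[of "w i" z] that by (simp add: b_def c_def)
  qed (use big in simp)
  have eq: "norm (z - w i) = c i * norm (1 - b i * z)" if "norm z = 1" for z i
  proof (cases "norm (w i) < 1")
    case True
    then show ?thesis using reflect_root_norm_circle[OF that, of "w i"] by (simp add: b_def c_def)
  qed (use big in simp)
  define C where "C = norm (lead_coeff F) * (\<Prod>i<n. c i)"
  have C0: "C \<ge> 0" by (auto simp: C_def intro!: mult_nonneg_nonneg prod_nonneg c0)
  have "norm (poly F (of_real r)) \<le> C * norm (\<Prod>i<n. 1 - b i * of_real r)"
    unfolding F norm_mult C_def mult.assoc prod_norm[symmetric] prod.distrib[symmetric]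
    using r by (intro mult_left_mono prod_mono) (auto intro!: le)
  then have "norm (poly F (of_real r)) powr p \<le> C powr p * norm (\<Prod>i<n. 1 - b i * of_real r) powr p"
    using p C0 powr_mono2[of p "norm (poly F (of_real r))" "C * norm (\<Prod>i<n. 1 - b i * of_real r)"]
    by (simp only: powr_mult norm_ge_zero less_imp_le)
  then have "2 * pi * norm (poly F (of_real r)) powr p
      \<le> C powr p * (2 * pi * norm (\<Prod>i<n. 1 - b i * of_real r) powr p)"
    using mult_left_mono[of "norm (poly F (of_real r)) powr p" _ "2 * pi"] by (simp only: ac_simps) simp
  also have "\<dots> \<le> C powr p * integral {0..2 * pi} (\<lambda>t. (1 - r\<^sup>2) / (norm (1 - of_real r * cis t))\<^sup>2
          * norm (\<Prod>i<n. 1 - b i * cis t) powr p)"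
    by (intro mult_left_mono zero_free_prod_poisson_closed b r p) auto
  also have "\<dots> = integral {0..2 * pi} (\<lambda>t. (1 - r\<^sup>2) / (norm (1 - of_real r * cis t))\<^sup>2
          * norm (poly F (cis t)) powr p)"
  proof -
    have "norm (poly F (cis t)) = C * norm (\<Prod>i<n. 1 - b i * cis t)" for t
      unfolding F norm_mult C_def mult.assoc prod_norm[symmetric] prod.distrib[symmetric]
      by (simp add: eq)
    then have "norm (poly F (cis t)) powr p = C powr p * norm (\<Prod>i<n. 1 - b i * cis t) powr p" for t
      using C0 by (simp add: powr_mult)
    then have "(\<lambda>t. (1 - r\<^sup>2) / (norm (1 - of_real r * cis t))\<^sup>2 * norm (poly F (cis t)) powr p)
      = (\<lambda>t. C powr p * ((1 - r\<^sup>2) / (norm (1 - of_real r * cis t))\<^sup>2 * norm (\<Prod>i<n. 1 - b i * cis t) powr p))"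
      by (simp only: mult.left_commute)
    then show ?thesis by (simp only: integral_mult_right)
  qed
  finally show ?thesis .
qed simp

section \<open>The Poisson inequality as an integral over the circle\<close>

lemma circle_borel_measurable:
  fixes f :: "complex \<Rightarrow> 'a::topological_space"
  assumes "continuous_on (sphere 0 1) f"
  shows "f \<in> borel_measurable circle_haar"
  using borel_measurable_continuous_on_restrict[OF assms]
  by (simp cong: measurable_cong_sets add: sets_circle_haar)

lemma nn_integral_circle_haar:
  assumes g: "continuous_on (sphere 0 1) g" and g0: "\<And>z. norm z = 1 \<Longrightarrow> 0 \<le> g z"
  shows "(\<integral>\<^sup>+z. ennreal (g z) \<partial>circle_haar) = ennreal (integral {0..2*pi} (\<lambda>t. g (cis t)) / (2 * pi))"
proof -
  have c: "continuous_on A (\<lambda>t. g (cis t))" for A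
    by (rule continuous_on_compose2[OF g]) (auto intro!: continuous_intros)
  have [measurable]: "(\<lambda>t. g (cis t)) \<in> borel_measurable borel"
    by (rule borel_measurable_continuous_onI[OF c])
  have gm: "(\<lambda>z. ennreal (g z)) \<in> borel_measurable (restrict_space borel (sphere 0 1))"
    using borel_measurable_continuous_on_restrict[OF g] by measurable
  have "(\<integral>\<^sup>+z. ennreal (g z) \<partial>circle_haar)
      = (\<integral>\<^sup>+t. ennreal (g (cis t)) \<partial>uniform_measure lborel {0..<2 * pi})"
    unfolding circle_haar_def by (rule nn_integral_distr[OF cis_measurable_circle]) (use gm in simp)
  also have "\<dots> = (\<integral>\<^sup>+t. ennreal (g (cis t)) * indicator {0..<2 * pi} t \<partial>lborel) / ennreal (2 * pi)"
    by (subst nn_integral_uniform_measure) auto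
  also have "(\<integral>\<^sup>+t. ennreal (g (cis t)) * indicator {0..<2 * pi} t \<partial>lborel)
      = (\<integral>\<^sup>+t. ennreal (g (cis t) * indicator {0..2 * pi} t) \<partial>lborel)"
  proof (rule nn_integral_cong_AE)
    show "AE t in lborel. ennreal (g (cis t)) * indicator {0..<2 * pi} t = ennreal (g (cis t) * indicator {0..2 * pi} t)"
      using AE_lborel_singleton[of "2 * pi"] by eventually_elim (auto simp: indicator_def)
  qed
  also have "\<dots> = ennreal (integral {0..2*pi} (\<lambda>t. g (cis t)))"
  proof (rule nn_integral_has_integral_lborel)
    have "((\<lambda>t. g (cis t)) has_integral (integral {0..2*pi} (\<lambda>t. g (cis t)))) {0..2*pi}"
      by (rule integrable_integral[OF integrable_continuous_interval[OF c]])
    then have "((\<lambda>t. if t \<in> {0..2*pi} then g (cis t) else 0) has_integral (integral {0..2*pi} (\<lambda>t. g (cis t)))) UNIV"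
      by (simp only: has_integral_restrict_UNIV)
    moreover have "(\<lambda>t. if t \<in> {0..2*pi} then g (cis t) else 0) = (\<lambda>t. g (cis t) * indicator {0..2 * pi} t)"
      by (auto simp: indicator_def)
    ultimately show "((\<lambda>t. g (cis t) * indicator {0..2 * pi} t) has_integral (integral {0..2*pi} (\<lambda>t. g (cis t)))) UNIV"
      by simp
  qed (auto simp: g0)
  also have "\<dots> / ennreal (2 * pi) = ennreal (integral {0..2*pi} (\<lambda>t. g (cis t)) / (2 * pi))"
    by (rule divide_ennreal) (auto intro!: integral_nonneg integrable_continuous_interval c g0)
  finally show ?thesis .
qed

text \<open>The Poisson kernel at the real point \<open>r\<close>, since
  \<open>|1 - r z| = |z - r|\<close> on the circle. Other points of the disc are reached by
  rotation.\<close>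

definition circle_kernel :: "real \<Rightarrow> complex \<Rightarrow> real" where
  "circle_kernel r z = (1 - r\<^sup>2) / (norm (1 - of_real r * z))\<^sup>2"

lemma circle_kernel_bounds:
  assumes r: "0 \<le> r" "r < 1" and z: "norm z = 1"
  shows "norm (1 - of_real r * z) \<noteq> 0" "0 \<le> circle_kernel r z" "circle_kernel r z \<le> (1 + r) / (1 - r)"
proof -
  have "norm (of_real r * z) = r" using r z by (simp add: norm_mult)
  then have n: "1 - r \<le> norm (1 - of_real r * z)" using norm_triangle_ineq2[of 1 "of_real r * z"] by simp
  then show "norm (1 - of_real r * z) \<noteq> 0" using r by linarith
  have r2: "1 - r\<^sup>2 = (1 + r) * (1 - r)" by (simp add: power2_eq_square algebra_simps)
  show "0 \<le> circle_kernel r z" using r unfolding circle_kernel_def r2 by simp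
  have "circle_kernel r z \<le> (1 - r\<^sup>2) / (1 - r)\<^sup>2"
    unfolding circle_kernel_def using r n by (intro divide_left_mono power_mono mult_pos_pos) (auto simp: r2)
  also have "\<dots> = (1 + r) / (1 - r)" using r unfolding r2 by (simp add: power2_eq_square)
  finally show "circle_kernel r z \<le> (1 + r) / (1 - r)" .
qed

lemma continuous_on_circle_kernel:
  assumes "0 \<le> r" "r < 1"
  shows "continuous_on (sphere 0 1) (circle_kernel r)"
proof -
  have "norm (1 - of_real r * z) \<noteq> 0" if "norm z = 1" for z :: complex
    by (rule circle_kernel_bounds(1)[OF assms that])
  then show ?thesis
    unfolding circle_kernel_def by (intro continuous_intros) (auto simp del: norm_eq_zero)
qed

lemma nn_integral_circle_kernel:
  assumes r: "0 \<le> r" "r < 1"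
  shows "(\<integral>\<^sup>+z. ennreal (circle_kernel r z) \<partial>circle_haar) = 1"
proof -
  have "((\<lambda>t. 1 * complex_of_real ((1 - r\<^sup>2) / (norm (1 - of_real r * cis t))\<^sup>2))
           has_integral (2 * pi * 1)) {0..2 * pi}"
    using poisson_formula[where f = "\<lambda>_. 1" and R = 2, OF _ _ r] by simp
  then have "((\<lambda>t. Re (1 * complex_of_real (circle_kernel r (cis t)))) has_integral Re (2 * pi * 1)) {0..2 * pi}"
    unfolding circle_kernel_def by (rule has_integral_Re)
  then have "integral {0..2*pi} (\<lambda>t. circle_kernel r (cis t)) = 2 * pi"
    by (intro integral_unique) simp
  then show ?thesis
    by (subst nn_integral_circle_haar) (auto simp: continuous_on_circle_kernel circle_kernel_bounds r)
qed

lemma poly_norm_powr_continuous: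
  fixes F :: "complex poly"
  assumes "p > 0"
  shows "continuous_on A (\<lambda>z. norm (poly F z) powr p)"
  by (intro continuous_on_powr' continuous_intros) (use assms in auto)

lemma poly_poisson_circle:
  fixes F :: "complex poly"
  assumes r: "0 \<le> r" "r < 1" and p: "p > 0"
  shows "ennreal (norm (poly F (of_real r)) powr p)
    \<le> (\<integral>\<^sup>+z. ennreal (circle_kernel r z) * ennreal (norm (poly F z) powr p) \<partial>circle_haar)"
proof -
  have "(\<integral>\<^sup>+z. ennreal (circle_kernel r z) * ennreal (norm (poly F z) powr p) \<partial>circle_haar)
    = (\<integral>\<^sup>+z. ennreal (circle_kernel r z * norm (poly F z) powr p) \<partial>circle_haar)"
    using circle_kernel_bounds(2)[OF r] by (intro nn_integral_cong) (simp add: ennreal_mult space_circle_haar)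
  also have "\<dots> = ennreal (integral {0..2*pi} (\<lambda>t. circle_kernel r (cis t) * norm (poly F (cis t)) powr p) / (2 * pi))"
    using circle_kernel_bounds(2)[OF r]
    by (intro nn_integral_circle_haar continuous_intros continuous_on_circle_kernel r poly_norm_powr_continuous p) auto
  also have "\<dots> \<ge> ennreal (norm (poly F (of_real r)) powr p)"
    using poly_poisson_integral[OF r p, of F] unfolding circle_kernel_def
    by (intro ennreal_leI) (simp add: pos_le_divide_eq mult.commute)
  finally show ?thesis .
qed

lemma nn_integral_circle_haar_rotate:
  assumes w: "norm w = 1" and g: "g \<in> borel_measurable circle_haar"
  shows "(\<integral>\<^sup>+z. g (w * z) \<partial>circle_haar) = (\<integral>\<^sup>+z. g z \<partial>circle_haar)"
proof -
  have "(\<integral>\<^sup>+z. g z \<partial>circle_haar) = (\<integral>\<^sup>+z. g z \<partial>distr circle_haar circle_haar (\<lambda>z. w * z))"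
    by (simp add: circle_haar_invariant[OF w])
  also have "\<dots> = (\<integral>\<^sup>+z. g (w * z) \<partial>circle_haar)"
    by (rule nn_integral_distr[OF mult_measurable_circle[OF w]]) (use g in simp)
  finally show ?thesis by simp
qed

text \<open>A rotation moves \<open>w\<close> to the real point \<open>norm w\<close>, where the
  Poisson kernel is replaced by its maximum \<open>(1 + r) / (1 - r)\<close>.\<close>

lemma poly_eval_le_circle_mean:
  fixes F :: "complex poly"
  assumes w: "norm w < 1" and p: "p > 0"
  shows "ennreal (norm (poly F w) powr p)
    \<le> ennreal ((1 + norm w) / (1 - norm w)) * (\<integral>\<^sup>+z. ennreal (norm (poly F z) powr p) \<partial>circle_haar)"
proof -
  define r where "r = norm w"
  obtain c where c: "norm c = 1" "w = c * of_real r"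
  proof (cases "w = 0")
    case False
    then show ?thesis by (intro that[of "w / of_real r"]) (auto simp: r_def norm_divide)
  qed (use that[of 1] in \<open>auto simp: r_def\<close>)
  have r: "0 \<le> r" "r < 1" using w by (auto simp: r_def)
  define G where "G = pcompose F [:0, c:]"
  have G: "poly G z = poly F (c * z)" for z by (simp add: G_def poly_pcompose mult.commute)
  have [measurable]: "(\<lambda>z. norm (poly H z) powr p) \<in> borel_measurable circle_haar" for H
    by (intro circle_borel_measurable poly_norm_powr_continuous p)
  have "ennreal (norm (poly F w) powr p) = ennreal (norm (poly G (of_real r)) powr p)"
    by (simp add: G c(2))
  also have "\<dots> \<le> (\<integral>\<^sup>+z. ennreal (circle_kernel r z) * ennreal (norm (poly G z) powr p) \<partial>circle_haar)"
    by (rule poly_poisson_circle[OF r p])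
  also have "\<dots> \<le> (\<integral>\<^sup>+z. ennreal ((1 + r) / (1 - r)) * ennreal (norm (poly G z) powr p) \<partial>circle_haar)"
    using circle_kernel_bounds(3)[OF r]
    by (intro nn_integral_mono mult_right_mono ennreal_leI) (auto simp: space_circle_haar)
  also have "\<dots> = ennreal ((1 + r) / (1 - r)) * (\<integral>\<^sup>+z. ennreal (norm (poly G z) powr p) \<partial>circle_haar)"
    by (rule nn_integral_cmult) measurable
  also have "(\<integral>\<^sup>+z. ennreal (norm (poly G z) powr p) \<partial>circle_haar) = (\<integral>\<^sup>+z. ennreal (norm (poly F z) powr p) \<partial>circle_haar)"
    unfolding G by (rule nn_integral_circle_haar_rotate[OF c(1)]) measurable
  finally show ?thesis by (simp add: r_def)
qed

lemma higher_deriv_poly: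
  "(deriv ^^ k) (poly (F :: complex poly)) = poly ((pderiv ^^ k) F)"
proof (induction k)
  case (Suc k)
  then show ?case by (auto intro!: ext DERIV_imp_deriv poly_DERIV)
qed simp

text \<open>Cauchy's estimate on the circle of radius \<open>r\<close>, on which \<open>F\<close> is
  controlled by its mean over the unit circle. For \<open>p < 1\<close> the integral formula for a
  coefficient on the unit circle itself gives no bound by the \<open>p\<close>-th mean; hence the
  detour through an interior radius.\<close>

lemma poly_coeff_le_circle_mean:
  fixes F :: "complex poly"
  assumes r: "0 < r" "r < 1" and p: "p > 0"
  shows "ennreal ((norm (coeff F k) * r ^ k) powr p)
    \<le> ennreal ((1 + r) / (1 - r)) * (\<integral>\<^sup>+z. ennreal (norm (poly F z) powr p) \<partial>circle_haar)"
proof -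
  define m where "m = integral {0..2*pi} (\<lambda>t. norm (poly F (cis t)) powr p) / (2 * pi)"
  have m: "(\<integral>\<^sup>+z. ennreal (norm (poly F z) powr p) \<partial>circle_haar) = ennreal m"
    unfolding m_def by (intro nn_integral_circle_haar poly_norm_powr_continuous p) auto
  have m0: "m \<ge> 0" unfolding m_def
    by (intro divide_nonneg_pos integral_nonneg integrable_continuous_interval continuous_on_powr' continuous_intros)
       (use p in auto)
  define C where "C = (1 + r) / (1 - r) * m"
  have C0: "C \<ge> 0" using r m0 by (simp add: C_def)
  have B: "norm (poly F z) \<le> C powr (1 / p)" if "norm (0 - z) = r" for z
  proof -
    have "ennreal (norm (poly F z) powr p) \<le> ennreal C"
      using poly_eval_le_circle_mean[of z p F] that r p m m0
      by (simp add: C_def ennreal_mult'[symmetric])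
    then have "norm (poly F z) powr p \<le> C" using C0 by simp
    then have "(norm (poly F z) powr p) powr (1 / p) \<le> C powr (1 / p)" using p by (intro powr_mono2) auto
    then show ?thesis using p by (simp add: powr_powr)
  qed
  have "norm ((deriv ^^ k) (poly F) 0) \<le> fact k * C powr (1 / p) / r ^ k"
    by (rule Cauchy_inequality[OF _ _ r(1) B]) (auto intro!: holomorphic_intros continuous_intros)
  moreover have "(deriv ^^ k) (poly F) 0 = fact k * coeff F k"
    unfolding higher_deriv_poly poly_0_coeff_0 coeff_higher_pderiv by (simp add: pochhammer_fact)
  ultimately have "norm (coeff F k) * r ^ k \<le> C powr (1 / p)"
    using r by (simp add: norm_mult field_simps)
  then have "(norm (coeff F k) * r ^ k) powr p \<le> (C powr (1 / p)) powr p"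
    using r p by (intro powr_mono2) auto
  also have "\<dots> = C" using p C0 by (simp add: powr_powr)
  finally show ?thesis unfolding m C_def using r m0 by (simp add: ennreal_mult'[symmetric])
qed

section \<open>Bohr lifts on the infinite torus\<close>

lemma prime_nth_prime: "prime (nth_prime j)"
  using enumerate_in_set[OF primes_infinite, of j] by (simp add: nth_prime_def)

lemma strict_mono_nth_prime: "strict_mono nth_prime"
  unfolding nth_prime_def by (rule strict_mono_enumerate[OF primes_infinite])

lemma inj_nth_prime: "inj nth_prime"
  by (rule strict_mono_imp_inj_on[OF strict_mono_nth_prime])

lemma ex_nth_prime: "prime p \<Longrightarrow> \<exists>j. nth_prime j = p"
  using enumerate_Ex[OF primes_infinite, of p] by (auto simp: nth_prime_def)

lemma nth_prime_ge_2: "2 \<le> nth_prime j"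
  by (rule prime_ge_2_nat[OF prime_nth_prime])

lemma nth_prime_dvd: "prime_exponent n j \<noteq> 0 \<Longrightarrow> nth_prime j dvd n"
  unfolding prime_exponent_def by (metis not_dvd_imp_multiplicity_0)

lemma finite_prime_exponent: "finite {j. prime_exponent n j \<noteq> 0}"
proof (cases "n = 0")
  case False
  have "nth_prime ` {j. prime_exponent n j \<noteq> 0} \<subseteq> {d. d dvd n}"
    using nth_prime_dvd by auto
  then have "finite (nth_prime ` {j. prime_exponent n j \<noteq> 0})"
    using False finite_subset finite_divisors_nat by blast
  then show ?thesis
    by (rule finite_imageD) (rule inj_on_subset[OF inj_nth_prime], simp)
qed (simp add: prime_exponent_def)

lemma prime_exponent_1 [simp]: "prime_exponent (Suc 0) j = 0"
  by (simp add: prime_exponent_def)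

lemma prime_monomial_eq:
  assumes "finite J" "\<And>j. prime_exponent n j \<noteq> 0 \<Longrightarrow> j \<in> J"
  shows "prime_monomial n z = (\<Prod>j\<in>J. z j ^ prime_exponent n j)"
  unfolding prime_monomial_def using assms by (intro prod.mono_neutral_left) auto

lemma prod_nth_prime_exponent:
  assumes n: "n > 0" and J: "finite J" "\<And>j. prime_exponent n j \<noteq> 0 \<Longrightarrow> j \<in> J"
  shows "(\<Prod>j\<in>J. nth_prime j ^ prime_exponent n j) = n"
proof -
  have "(\<Prod>j\<in>J. nth_prime j ^ prime_exponent n j) = (\<Prod>j | prime_exponent n j \<noteq> 0. nth_prime j ^ prime_exponent n j)"
    using J by (intro prod.mono_neutral_right) auto
  also have "\<dots> = (\<Prod>p\<in>nth_prime ` {j. prime_exponent n j \<noteq> 0}. p ^ multiplicity p n)"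
    by (subst prod.reindex[OF inj_on_subset[OF inj_nth_prime]]) (auto simp: prime_exponent_def)
  also have "nth_prime ` {j. prime_exponent n j \<noteq> 0} = prime_factors n"
  proof (intro equalityI subsetI)
    fix p assume "p \<in> prime_factors n"
    then have p: "prime p" "p dvd n" by auto
    obtain j where "nth_prime j = p" using ex_nth_prime[OF p(1)] by blast
    then show "p \<in> nth_prime ` {j. prime_exponent n j \<noteq> 0}"
      using p n by (auto simp: prime_exponent_def prime_multiplicity_gt_zero_iff intro!: image_eqI[of _ _ j])
  qed (use n nth_prime_dvd in \<open>auto simp: prime_factors_dvd prime_nth_prime\<close>)
  also have "(\<Prod>p\<in>prime_factors n. p ^ multiplicity p n) = n"
    using prime_factorization_nat[OF n] by simp
  finally show ?thesis .
qed

lemma prime_exponent_eqI: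
  assumes "m > 0" "n > 0" "\<And>j. prime_exponent m j = prime_exponent n j"
  shows "m = n"
  using prod_nth_prime_exponent[OF assms(1) finite_prime_exponent[of m]]
    prod_nth_prime_exponent[OF assms(2) finite_prime_exponent[of m]] assms(3) by simp

section \<open>Bohr lifts as functions on the torus\<close>

lemma torus_component_measurable: "(\<lambda>z. z j) \<in> torus_haar \<rightarrow>\<^sub>M circle_haar"
  unfolding torus_haar_def by (rule measurable_component_singleton) simp

lemma torus_component_borel [measurable]: "(\<lambda>z. z j) \<in> borel_measurable torus_haar"
  by (rule measurable_compose[OF torus_component_measurable circle_borel_measurable[OF continuous_on_id]])

lemma prime_monomial_measurable [measurable]: "prime_monomial n \<in> borel_measurable torus_haar"
  unfolding prime_monomial_def by measurable

lemma norm_prime_monomial: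
  assumes "z \<in> space torus_haar"
  shows "norm (prime_monomial n z) = 1"
  using assms unfolding prime_monomial_def
  by (simp flip: prod_norm) (simp add: norm_power space_torus_haar)

lemma prime_monomial_upd:
  "prime_monomial n (z(j := w * z j)) = w ^ prime_exponent n j * prime_monomial n z"
proof -
  define J where "J = insert j {i. prime_exponent n i \<noteq> 0}"
  have J: "finite J" "\<And>i. prime_exponent n i \<noteq> 0 \<Longrightarrow> i \<in> J" "j \<in> J"
    using finite_prime_exponent[of n] by (auto simp: J_def)
  have e: "prime_monomial n y = y j ^ prime_exponent n j * (\<Prod>i\<in>J - {j}. y i ^ prime_exponent n i)" for y
    using prime_monomial_eq[OF J(1,2), of n y] prod.remove[OF J(1,3), of "\<lambda>i. y i ^ prime_exponent n i"] by simp
  have "(\<Prod>i\<in>J - {j}. (if i = j then w * z j else z i) ^ prime_exponent n i) = (\<Prod>i\<in>J - {j}. z i ^ prime_exponent n i)"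
    by (intro prod.cong) auto
  then show ?thesis
    unfolding e by (simp add: power_mult_distrib)
qed

lemma bohr_lift_eq:
  assumes "finite A" "\<And>n. a n \<noteq> 0 \<Longrightarrow> n \<in> A"
  shows "bohr_lift a z = (\<Sum>n\<in>A. a n * prime_monomial n z)"
  unfolding bohr_lift_def using assms by (intro sum.mono_neutral_left) auto

lemma bohr_lift_measurable [measurable]: "bohr_lift a \<in> borel_measurable torus_haar"
  unfolding bohr_lift_def by measurable

lemma bohr_lift_add:
  assumes "dirichlet_poly a" "dirichlet_poly b"
  shows "bohr_lift (\<lambda>n. a n + b n) z = bohr_lift a z + bohr_lift b z"
proof -
  have f: "finite ({n. a n \<noteq> 0} \<union> {n. b n \<noteq> 0})" using assms by (simp add: dirichlet_poly_def)
  have "bohr_lift (\<lambda>n. a n + b n) z = (\<Sum>n\<in>{n. a n \<noteq> 0} \<union> {n. b n \<noteq> 0}. (a n + b n) * prime_monomial n z)"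
    by (rule bohr_lift_eq[OF f]) auto
  also have "\<dots> = bohr_lift a z + bohr_lift b z"
    by (subst (1 2) bohr_lift_eq[OF f]) (auto simp: ring_distribs sum.distrib)
  finally show ?thesis .
qed

lemma norm_bohr_lift_le:
  assumes "z \<in> space torus_haar"
  shows "norm (bohr_lift a z) \<le> (\<Sum>n | a n \<noteq> 0. norm (a n))"
  unfolding bohr_lift_def
  by (rule order_trans[OF norm_sum]) (simp add: norm_mult norm_prime_monomial[OF assms])

text \<open>The variable \<open>w\<close> multiplies the coordinate \<open>z j\<close> and does not
  replace it. For \<open>norm w = 1\<close> the point then stays on the torus and averaging over
  \<open>w\<close> is absorbed by rotation invariance, while inside the disc \<open>w\<close> acts
  by scaling coefficients.\<close>

definition slice_poly :: "(nat \<Rightarrow> complex) \<Rightarrow> nat \<Rightarrow> (nat \<Rightarrow> complex) \<Rightarrow> complex poly" where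
  "slice_poly a j z = (\<Sum>n | a n \<noteq> 0. monom (a n * prime_monomial n z) (prime_exponent n j))"

lemma poly_slice_poly: "poly (slice_poly a j z) w = bohr_lift a (z(j := w * z j))"
  unfolding slice_poly_def bohr_lift_def prime_monomial_upd
  by (simp add: poly_sum poly_monom mult_ac)

lemma dirichlet_poly_mult [simp, intro]:
  "dirichlet_poly a \<Longrightarrow> dirichlet_poly (\<lambda>n. a n * c n)"
  by (auto simp: dirichlet_poly_def elim!: rev_finite_subset)

lemma dirichlet_poly_if [simp, intro]:
  "dirichlet_poly a \<Longrightarrow> dirichlet_poly (\<lambda>n. if P n then a n else 0)"
  by (auto simp: dirichlet_poly_def elim!: rev_finite_subset)

lemma poly_slice_poly_scale:
  assumes "dirichlet_poly a"
  shows "poly (slice_poly a j z) w = bohr_lift (\<lambda>n. a n * w ^ prime_exponent n j) z"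
  using assms unfolding poly_slice_poly
  by (subst bohr_lift_eq[where A = "{n. a n \<noteq> 0}"])
     (auto simp: dirichlet_poly_def bohr_lift_def prime_monomial_upd mult_ac)

lemma coeff_slice_poly:
  assumes "dirichlet_poly a"
  shows "coeff (slice_poly a j z) k = bohr_lift (\<lambda>n. if prime_exponent n j = k then a n else 0) z"
  using assms
  by (subst bohr_lift_eq[where A = "{n. a n \<noteq> 0}"])
     (auto simp: dirichlet_poly_def slice_poly_def coeff_sum coeff_monom intro!: sum.cong split: if_splits)

section \<open>Averaging over one coordinate\<close>

lemma torus_upd_measurable:
  "(\<lambda>(z, w). z(j := w * z j)) \<in> torus_haar \<Otimes>\<^sub>M circle_haar \<rightarrow>\<^sub>M torus_haar"
proof -
  have "(\<lambda>x. (fst x)(j := snd x * fst x j)) \<in> torus_haar \<Otimes>\<^sub>M circle_haar \<rightarrow>\<^sub>M torus_haar"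
    unfolding torus_haar_def
  proof (rule measurable_PiM_single')
    fix i :: nat
    have f: "(\<lambda>x. fst x i) \<in> torus_haar \<Otimes>\<^sub>M circle_haar \<rightarrow>\<^sub>M circle_haar" for i
      by (rule measurable_compose[OF measurable_fst torus_component_measurable])
    have [measurable]: "(\<lambda>x. fst x j) \<in> borel_measurable (torus_haar \<Otimes>\<^sub>M circle_haar)"
      by (rule measurable_compose[OF measurable_fst torus_component_borel])
    have [measurable]: "snd \<in> borel_measurable (torus_haar \<Otimes>\<^sub>M circle_haar)"
      by (rule measurable_compose[OF measurable_snd circle_borel_measurable[OF continuous_on_id]])
    have "(\<lambda>x. snd x * fst x j) \<in> torus_haar \<Otimes>\<^sub>M circle_haar \<rightarrow>\<^sub>M restrict_space borel (sphere 0 1)"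
      by (rule measurable_restrict_space2)
         (auto simp: space_pair_measure space_torus_haar space_circle_haar norm_mult)
    then have "(\<lambda>x. snd x * fst x j) \<in> torus_haar \<Otimes>\<^sub>M circle_haar \<rightarrow>\<^sub>M circle_haar"
      by (simp cong: measurable_cong_sets add: sets_circle_haar)
    with f[of i] show "(\<lambda>x. ((fst x)(j := snd x * fst x j)) i) \<in> (\<Pi>\<^sub>M j\<in>UNIV. circle_haar) \<Otimes>\<^sub>M circle_haar \<rightarrow>\<^sub>M circle_haar"
      by (cases "i = j") (auto simp: torus_haar_def)
  qed (auto simp: space_pair_measure space_PiM PiE_def Pi_def space_circle_haar norm_mult)
  then show ?thesis by (simp add: split_beta')
qed

lemma nn_integral_torus_rotate:
  assumes w: "norm w = 1" and g: "g \<in> borel_measurable torus_haar"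
  shows "(\<integral>\<^sup>+z. g (z(j := w * z j)) \<partial>torus_haar) = (\<integral>\<^sup>+z. g z \<partial>torus_haar)"
proof -
  let ?w = "\<lambda>i. if i = j then w else 1"
  have "(\<lambda>z. z(j := w * z j)) \<in> torus_haar \<rightarrow>\<^sub>M torus_haar"
    using measurable_compose[OF measurable_Pair2'[of w circle_haar torus_haar] torus_upd_measurable[of j]] w
    by (auto simp: space_circle_haar)
  moreover have eq: "(\<lambda>z i. ?w i * z i) = (\<lambda>z. z(j := w * z j))" by (intro ext) auto
  ultimately have m: "(\<lambda>z i. ?w i * z i) \<in> torus_haar \<rightarrow>\<^sub>M torus_haar" by (simp only:)
  have "(\<integral>\<^sup>+z. g z \<partial>torus_haar) = (\<integral>\<^sup>+z. g z \<partial>distr torus_haar torus_haar (\<lambda>z i. ?w i * z i))"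
    using torus_haar_invariant[of ?w] w by simp
  also have "\<dots> = (\<integral>\<^sup>+z. g (\<lambda>i. ?w i * z i) \<partial>torus_haar)"
    by (rule nn_integral_distr[OF m]) (use g in simp)
  also have "(\<lambda>z. g (\<lambda>i. ?w i * z i)) = (\<lambda>z. g (z(j := w * z j)))"
    using eq by (metis (no_types))
  finally show ?thesis by simp
qed

text \<open>Rotation invariance for each fixed \<open>w\<close>, then Tonelli. This transfers
  one-variable inequalities to the torus without splitting the infinite product into one circle and
  the rest.\<close>

lemma nn_integral_torus_average:
  assumes g [measurable]: "g \<in> borel_measurable torus_haar"
    and k [measurable]: "k \<in> borel_measurable circle_haar"
  shows "(\<integral>\<^sup>+z. (\<integral>\<^sup>+w. k w * g (z(j := w * z j)) \<partial>circle_haar) \<partial>torus_haar)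
    = (\<integral>\<^sup>+w. k w \<partial>circle_haar) * (\<integral>\<^sup>+z. g z \<partial>torus_haar)"
proof -
  interpret C: prob_space circle_haar by (rule prob_space_circle_haar)
  interpret T: prob_space torus_haar by (rule prob_space_torus_haar)
  interpret P: pair_sigma_finite torus_haar circle_haar ..
  have gm [measurable]: "(\<lambda>(z, w). g (z(j := w * z j))) \<in> borel_measurable (torus_haar \<Otimes>\<^sub>M circle_haar)"
    using measurable_compose[OF torus_upd_measurable g] by (simp add: split_beta')
  have "(\<integral>\<^sup>+z. (\<integral>\<^sup>+w. k w * g (z(j := w * z j)) \<partial>circle_haar) \<partial>torus_haar)
      = (\<integral>\<^sup>+w. (\<integral>\<^sup>+z. k w * g (z(j := w * z j)) \<partial>torus_haar) \<partial>circle_haar)"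
  proof (rule P.Fubini'[symmetric])
    show "(\<lambda>(z, w). k w * g (z(j := w * z j))) \<in> borel_measurable (torus_haar \<Otimes>\<^sub>M circle_haar)"
      using gm unfolding split_beta' by measurable
  qed
  also have "\<dots> = (\<integral>\<^sup>+w. k w * (\<integral>\<^sup>+z. g z \<partial>torus_haar) \<partial>circle_haar)"
  proof (rule nn_integral_cong)
    fix w assume w: "w \<in> space circle_haar"
    have "(\<lambda>z. g (z(j := w * z j))) \<in> borel_measurable torus_haar"
      using measurable_compose[OF measurable_Pair2'[OF w] gm] by simp
    then have "(\<integral>\<^sup>+z. k w * g (z(j := w * z j)) \<partial>torus_haar) = k w * (\<integral>\<^sup>+z. g (z(j := w * z j)) \<partial>torus_haar)"
      by (rule nn_integral_cmult)
    then show "(\<integral>\<^sup>+z. k w * g (z(j := w * z j)) \<partial>torus_haar) = k w * (\<integral>\<^sup>+z. g z \<partial>torus_haar)"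
      using w by (simp add: nn_integral_torus_rotate g space_circle_haar)
  qed
  also have "\<dots> = (\<integral>\<^sup>+w. k w \<partial>circle_haar) * (\<integral>\<^sup>+z. g z \<partial>torus_haar)"
    by (rule nn_integral_multc[OF k])
  finally show ?thesis .
qed

section \<open>One-variable inequalities on the torus\<close>

definition lift_moment :: "real \<Rightarrow> (nat \<Rightarrow> complex) \<Rightarrow> ennreal" where
  "lift_moment p a = (\<integral>\<^sup>+z. ennreal (norm (bohr_lift a z) powr p) \<partial>torus_haar)"

text \<open>The lift of the scaled polynomial is the slice polynomial at \<open>r\<close>. The
  Poisson inequality bounds it by a weighted mean over rotations of \<open>z j\<close>, and
  integration over the torus leaves only the total mass \<open>1\<close> of the kernel. At
  \<open>r = 1\<close>, where the kernel degenerates, nothing is scaled.\<close>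

lemma lift_moment_scale:
  assumes a: "dirichlet_poly a" and r: "0 \<le> r" "r \<le> 1" and p: "p > 0"
  shows "lift_moment p (\<lambda>n. a n * of_real r ^ prime_exponent n j) \<le> lift_moment p a"
proof (cases "r = 1")
  case False
  have [measurable]: "circle_kernel r \<in> borel_measurable circle_haar"
    using False r by (intro circle_borel_measurable continuous_on_circle_kernel) auto
  have "lift_moment p (\<lambda>n. a n * of_real r ^ prime_exponent n j)
      \<le> (\<integral>\<^sup>+z. (\<integral>\<^sup>+w. ennreal (circle_kernel r w) *
            ennreal (norm (bohr_lift a (z(j := w * z j))) powr p) \<partial>circle_haar) \<partial>torus_haar)"
    unfolding lift_moment_def
    using poly_poisson_circle[of r p "slice_poly a j _"] False r p
    by (intro nn_integral_mono) (simp flip: poly_slice_poly add: poly_slice_poly_scale[OF a, symmetric])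
  also have "\<dots> = lift_moment p a"
    unfolding lift_moment_def using False r
    by (subst nn_integral_torus_average) (auto simp: nn_integral_circle_kernel)
  finally show ?thesis .
qed simp

text \<open>The terms with exponent \<open>k\<close> at the \<open>j\<close>-th prime form the
  \<open>k\<close>-th coefficient of the slice, so the one-variable coefficient bound applies at
  each \<open>z\<close>. The constant does not depend on \<open>a\<close>.\<close>

lemma lift_moment_exponent_part:
  assumes a: "dirichlet_poly a" and r: "0 < r" "r < 1" and p: "p > 0"
  shows "lift_moment p (\<lambda>n. if prime_exponent n j = k then a n else 0)
    \<le> ennreal ((1 + r) / (1 - r) * (1 / r ^ k) powr p) * lift_moment p a"
proof -
  let ?b = "\<lambda>n. if prime_exponent n j = k then a n else 0"
  have "ennreal (norm (bohr_lift ?b z) powr p)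
      \<le> ennreal ((1 + r) / (1 - r) * (1 / r ^ k) powr p) *
         (\<integral>\<^sup>+w. 1 * ennreal (norm (bohr_lift a (z(j := w * z j))) powr p) \<partial>circle_haar)" for z
  proof -
    have "ennreal (norm (bohr_lift ?b z) powr p)
        = ennreal ((1 / r ^ k) powr p) * ennreal ((norm (bohr_lift ?b z) * r ^ k) powr p)"
      using r by (simp add: ennreal_mult'[symmetric] powr_mult[symmetric])
    also have "\<dots> \<le> ennreal ((1 / r ^ k) powr p) * (ennreal ((1 + r) / (1 - r)) *
         (\<integral>\<^sup>+w. ennreal (norm (bohr_lift a (z(j := w * z j))) powr p) \<partial>circle_haar))"
      using poly_coeff_le_circle_mean[OF r p, of "slice_poly a j z" k]
      by (intro mult_left_mono) (simp_all add: coeff_slice_poly[OF a] poly_slice_poly)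
    also have "\<dots> = ennreal ((1 + r) / (1 - r) * (1 / r ^ k) powr p) *
         (\<integral>\<^sup>+w. ennreal (norm (bohr_lift a (z(j := w * z j))) powr p) \<partial>circle_haar)"
      using r by (subst ennreal_mult) (simp_all add: mult_ac)
    finally show ?thesis by simp
  qed
  then have "lift_moment p ?b \<le> (\<integral>\<^sup>+z. ennreal ((1 + r) / (1 - r) * (1 / r ^ k) powr p) *
         (\<integral>\<^sup>+w. 1 * ennreal (norm (bohr_lift a (z(j := w * z j))) powr p) \<partial>circle_haar) \<partial>torus_haar)"
    unfolding lift_moment_def by (intro nn_integral_mono)
  also have "\<dots> = ennreal ((1 + r) / (1 - r) * (1 / r ^ k) powr p) *
     (\<integral>\<^sup>+z. (\<integral>\<^sup>+w. 1 * ennreal (norm (bohr_lift a (z(j := w * z j))) powr p) \<partial>circle_haar) \<partial>torus_haar)"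
  proof (rule nn_integral_cmult)
    interpret C: prob_space circle_haar by (rule prob_space_circle_haar)
    have "(\<lambda>x. ennreal (norm (bohr_lift a ((fst x)(j := snd x * (fst x) j))) powr p))
        \<in> borel_measurable (torus_haar \<Otimes>\<^sub>M circle_haar)"
      using measurable_compose[OF torus_upd_measurable, of "\<lambda>z. ennreal (norm (bohr_lift a z) powr p)" borel j]
      by (simp add: split_beta')
    then show "(\<lambda>z. \<integral>\<^sup>+w. 1 * ennreal (norm (bohr_lift a (z(j := w * z j))) powr p) \<partial>circle_haar)
        \<in> borel_measurable torus_haar"
      by (intro C.borel_measurable_nn_integral) (simp add: split_beta')
  qed
  also have "\<dots> = ennreal ((1 + r) / (1 - r) * (1 / r ^ k) powr p) * lift_moment p a"
    unfolding lift_moment_def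
    by (subst nn_integral_torus_average)
       (auto simp: prob_space.emeasure_space_1[OF prob_space_circle_haar])
  finally show ?thesis .
qed

lemma lift_moment_finite: "p > 0 \<Longrightarrow> lift_moment p a < \<infinity>"
proof -
  assume p: "p > 0"
  interpret T: prob_space torus_haar by (rule prob_space_torus_haar)
  have "lift_moment p a \<le> (\<integral>\<^sup>+z. ennreal ((\<Sum>n | a n \<noteq> 0. norm (a n)) powr p) \<partial>torus_haar)"
    unfolding lift_moment_def using p
    by (intro nn_integral_mono ennreal_leI powr_mono2 norm_bohr_lift_le) auto
  also have "\<dots> < \<infinity>" by (simp add: T.emeasure_space_1)
  finally show ?thesis .
qed

lemma hardy_norm_nonneg [simp]: "0 \<le> hardy_norm p a"
  by (simp add: hardy_norm_def)

lemma lift_moment_eq_hardy_norm: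
  assumes p: "p > 0"
  shows "lift_moment p a = ennreal (hardy_norm p a powr p)"
proof -
  have i: "integrable torus_haar (\<lambda>z. norm (bohr_lift a z) powr p)"
    using lift_moment_finite[OF p, of a] unfolding lift_moment_def
    by (intro integrableI_nonneg) auto
  have "lift_moment p a = ennreal (\<integral>z. norm (bohr_lift a z) powr p \<partial>torus_haar)"
    unfolding lift_moment_def by (rule nn_integral_eq_integral[OF i]) simp
  also have "(\<integral>z. norm (bohr_lift a z) powr p \<partial>torus_haar) = hardy_norm p a powr p"
    using p by (simp add: hardy_norm_def powr_powr integral_nonneg_AE)
  finally show ?thesis .
qed

lemma hardy_norm_leI:
  assumes p: "p > 0" and C: "C \<ge> 0" and le: "lift_moment p a \<le> ennreal (C powr p) * lift_moment p b"
  shows "hardy_norm p a \<le> C * hardy_norm p b"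
proof -
  have "hardy_norm p a powr p \<le> (C * hardy_norm p b) powr p"
    using le C by (simp add: lift_moment_eq_hardy_norm[OF p] ennreal_mult[symmetric] powr_mult)
  then show ?thesis
    using powr_less_mono2[OF p, of "C * hardy_norm p b" "hardy_norm p a"] C by (meson hardy_norm_nonneg mult_nonneg_nonneg not_le)
qed

lemma hardy_norm_scale_prod:
  assumes a: "dirichlet_poly a" and J: "finite J" and r: "\<And>j. j \<in> J \<Longrightarrow> 0 \<le> r j \<and> r j \<le> 1" and p: "p > 0"
  shows "hardy_norm p (\<lambda>n. a n * (\<Prod>j\<in>J. of_real (r j) ^ prime_exponent n j)) \<le> hardy_norm p a"
  using J r
proof (induction J rule: finite_induct)
  case (insert j J)
  let ?b = "\<lambda>n. a n * (\<Prod>j\<in>J. of_real (r j) ^ prime_exponent n j)"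
  have "lift_moment p (\<lambda>n. ?b n * of_real (r j) ^ prime_exponent n j) \<le> lift_moment p ?b"
    using a insert.prems p by (intro lift_moment_scale) auto
  then have "hardy_norm p (\<lambda>n. ?b n * of_real (r j) ^ prime_exponent n j) \<le> 1 * hardy_norm p ?b"
    using p by (intro hardy_norm_leI) auto
  then show ?case using insert by (simp add: mult_ac)
qed simp

definition prime_support :: "(nat \<Rightarrow> complex) \<Rightarrow> nat set" where
  "prime_support a = (\<Union>n\<in>{n. a n \<noteq> 0}. {j. prime_exponent n j \<noteq> 0})"

lemma finite_prime_support: "dirichlet_poly a \<Longrightarrow> finite (prime_support a)"
  unfolding prime_support_def dirichlet_poly_def using finite_prime_exponent by blast

lemma prime_supportI: "a n \<noteq> 0 \<Longrightarrow> prime_exponent n j \<noteq> 0 \<Longrightarrow> j \<in> prime_support a"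
  by (auto simp: prime_support_def)

lemma dirichlet_poly_pos: "dirichlet_poly a \<Longrightarrow> a n \<noteq> 0 \<Longrightarrow> n > 0"
  by (auto simp: dirichlet_poly_def intro!: gr0I)

lemma dirichlet_poly_shift [simp, intro]: "dirichlet_poly a \<Longrightarrow> dirichlet_poly (dirichlet_shift \<sigma> a)"
  unfolding dirichlet_shift_def by (rule dirichlet_poly_mult)

lemma powr_prod_nth_prime:
  assumes "n > 0" "finite J" "\<And>j. prime_exponent n j \<noteq> 0 \<Longrightarrow> j \<in> J"
  shows "(\<Prod>j\<in>J. (real (nth_prime j) powr s) ^ prime_exponent n j) = real n powr s"
proof -
  have "(\<Prod>j\<in>J. (real (nth_prime j) powr s) ^ prime_exponent n j)
      = (\<Prod>j\<in>J. real (nth_prime j ^ prime_exponent n j) powr s)"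
    by (intro prod.cong refl) (simp add: powr_realpow'[symmetric] powr_powr nth_prime_ge_2 prime_gt_0_nat prime_nth_prime
        mult.commute powr_power power_0_left flip: powr_realpow)
  also have "\<dots> = real n powr s"
    proof -
    have "(\<Prod>j\<in>J. nth_prime j ^ prime_exponent n j) = n" by (rule prod_nth_prime_exponent) (use assms in auto)
    then show ?thesis by (simp only: prod_powr_distrib[symmetric] of_nat_prod[symmetric])
  qed
  finally show ?thesis .
qed

text \<open>By multiplicativity \<open>n powr (- \<sigma>)\<close> splits into one scaling of
  modulus at most \<open>1\<close> for each prime, and only finitely many primes occur in
  \<open>a\<close>.\<close>

lemma hardy_norm_shift_le:
  assumes a: "dirichlet_poly a" and s: "\<sigma> \<ge> 0" and p: "p > 0"
  shows "hardy_norm p (dirichlet_shift \<sigma> a) \<le> hardy_norm p a"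
proof -
  have "dirichlet_shift \<sigma> a =
      (\<lambda>n. a n * (\<Prod>j\<in>prime_support a. of_real (real (nth_prime j) powr (- \<sigma>)) ^ prime_exponent n j))"
  proof
    fix n
    show "dirichlet_shift \<sigma> a n = a n * (\<Prod>j\<in>prime_support a. of_real (real (nth_prime j) powr (- \<sigma>)) ^ prime_exponent n j)"
    proof (cases "a n = 0")
      case False
      then have "(\<Prod>j\<in>prime_support a. (real (nth_prime j) powr (-\<sigma>)) ^ prime_exponent n j) = real n powr (-\<sigma>)"
        using a by (intro powr_prod_nth_prime) (auto simp: dirichlet_poly_pos finite_prime_support prime_supportI)
      from arg_cong[OF this, of complex_of_real] show ?thesis
        by (simp add: dirichlet_shift_def)
    qed (simp add: dirichlet_shift_def)
  qed
  moreover have "real (nth_prime j) powr (- \<sigma>) \<le> 1" for j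
    using s nth_prime_ge_2[of j] powr_mono[of "-\<sigma>" 0 "real (nth_prime j)"] by simp
  ultimately show ?thesis
    using hardy_norm_scale_prod[OF a finite_prime_support[OF a], of "\<lambda>j. real (nth_prime j) powr (- \<sigma>)" p] p by simp
qed

lemma dirichlet_shift_add: "dirichlet_shift \<sigma> (dirichlet_shift \<tau> a) = dirichlet_shift (\<tau> + \<sigma>) a"
  by (auto simp: dirichlet_shift_def fun_eq_iff powr_add[symmetric] simp flip: of_real_mult)

lemma hardy_norm_shift_antimono:
  assumes a: "dirichlet_poly a" and s: "\<sigma> \<le> \<tau>" and p: "p > 0"
  shows "hardy_norm p (dirichlet_shift \<tau> a) \<le> hardy_norm p (dirichlet_shift \<sigma> a)"
  using hardy_norm_shift_le[of "dirichlet_shift \<sigma> a" "\<tau> - \<sigma>" p] a s p by (simp add: dirichlet_shift_add)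

definition smooth_part :: "nat set \<Rightarrow> (nat \<Rightarrow> complex) \<Rightarrow> nat \<Rightarrow> complex" where
  "smooth_part J a n = (if \<forall>j. prime_exponent n j \<noteq> 0 \<longrightarrow> j \<in> J then a n else 0)"

lemma dirichlet_poly_smooth_part [simp, intro]: "dirichlet_poly a \<Longrightarrow> dirichlet_poly (smooth_part J a)"
  unfolding smooth_part_def by (rule dirichlet_poly_if)

lemma smooth_part_shift: "smooth_part J (dirichlet_shift \<sigma> a) = dirichlet_shift \<sigma> (smooth_part J a)"
  by (auto simp: smooth_part_def dirichlet_shift_def fun_eq_iff)

text \<open>Setting the variables outside \<open>J\<close> to \<open>0\<close>.\<close>

lemma hardy_norm_smooth_part:
  assumes a: "dirichlet_poly a" and p: "p > 0"
  shows "hardy_norm p (smooth_part J a) \<le> hardy_norm p a"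
proof -
  let ?S = "prime_support a - J"
  have "smooth_part J a = (\<lambda>n. a n * (\<Prod>j\<in>?S. of_real 0 ^ prime_exponent n j))"
  proof
    fix n
    show "smooth_part J a n = a n * (\<Prod>j\<in>?S. of_real 0 ^ prime_exponent n j)"
    proof (cases "a n = 0")
      case False
      have "(\<Prod>j\<in>?S. complex_of_real 0 ^ prime_exponent n j) = (if \<forall>j. prime_exponent n j \<noteq> 0 \<longrightarrow> j \<in> J then 1 else 0)"
      proof (cases "\<forall>j. prime_exponent n j \<noteq> 0 \<longrightarrow> j \<in> J")
        case True
        then show ?thesis by (auto simp: power_0_left intro!: prod.neutral)
      next
        case j: False
        then obtain j where "prime_exponent n j \<noteq> 0" "j \<notin> J" by blast
        then have "\<exists>j\<in>?S. complex_of_real 0 ^ prime_exponent n j = 0"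
          using prime_supportI[where a = a and n = n and j = j] False by (intro bexI[of _ j]) auto
        then have "(\<Prod>j\<in>?S. complex_of_real 0 ^ prime_exponent n j) = 0"
          using finite_prime_support[OF a] by (intro prod_zero) auto
        then show ?thesis using j by (simp only: if_False)
      qed
      then show ?thesis
        unfolding smooth_part_def by (simp only: split: if_split) auto
    qed (simp add: smooth_part_def)
  qed
  then show ?thesis
    using hardy_norm_scale_prod[OF a finite_Diff[OF finite_prime_support[OF a]], of _ "\<lambda>_. 0" p] p by simp
qed

text \<open>A prescribed exponent \<open>0\<close> costs nothing, because it is obtained by setting
  the variable to \<open>0\<close>, a contraction. So the constant sees only the primes with
  \<open>k j \<noteq> 0\<close>, however large \<open>J\<close> is.\<close>

lemma hardy_norm_exponents_part:
  assumes a: "dirichlet_poly a" and J: "finite J" and r: "0 < r" "r < 1" and p: "p > 0"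
  shows "hardy_norm p (\<lambda>n. if \<forall>j\<in>J. prime_exponent n j = k j then a n else 0)
    \<le> (\<Prod>j\<in>{j\<in>J. k j \<noteq> 0}. ((1 + r) / (1 - r)) powr (1 / p) * (1 / r) ^ k j) * hardy_norm p a"
  using J
proof (induction J rule: finite_induct)
  case (insert j J)
  let ?C = "((1 + r) / (1 - r)) powr (1 / p)"
  let ?D = "\<lambda>J. \<Prod>j\<in>{j\<in>J. k j \<noteq> 0}. ?C * (1 / r) ^ k j"
  let ?b = "\<lambda>n. if \<forall>j\<in>J. prime_exponent n j = k j then a n else 0"
  have b: "dirichlet_poly ?b" using a by (rule dirichlet_poly_if)
  have D: "?D A \<ge> 0" for A using r by (intro prod_nonneg) auto
  have eq: "(\<lambda>n. if \<forall>i\<in>insert j J. prime_exponent n i = k i then a n else 0)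
      = (\<lambda>n. if prime_exponent n j = k j then ?b n else 0)"
    by auto
  show ?case
  proof (cases "k j = 0")
    case True
    have "(\<lambda>n. if prime_exponent n j = k j then ?b n else 0)
        = (\<lambda>n. ?b n * (\<Prod>j\<in>{j}. of_real 0 ^ prime_exponent n j))"
      using True by (auto simp: fun_eq_iff power_0_left)
    then have "hardy_norm p (\<lambda>n. if prime_exponent n j = k j then ?b n else 0) \<le> hardy_norm p ?b"
      using hardy_norm_scale_prod[OF b, of "{j}" "\<lambda>_. 0" p] p by simp
    moreover have "{i \<in> insert j J. k i \<noteq> 0} = {i \<in> J. k i \<noteq> 0}" using True by auto
    ultimately show ?thesis unfolding eq using insert.IH by simp
  next
    case False
    have "(?C * (1 / r) ^ k j) powr p = (1 + r) / (1 - r) * (1 / r ^ k j) powr p"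
      using r p by (simp add: powr_mult powr_powr power_one_over powr_divide)
    then have "hardy_norm p (\<lambda>n. if prime_exponent n j = k j then ?b n else 0) \<le> (?C * (1 / r) ^ k j) * hardy_norm p ?b"
      using lift_moment_exponent_part[OF b r p, of j "k j"] r p by (intro hardy_norm_leI) auto
    also have "\<dots> \<le> (?C * (1 / r) ^ k j) * (?D J * hardy_norm p a)"
      using r by (intro mult_left_mono insert.IH) auto
    also have "\<dots> = ?D (insert j J) * hardy_norm p a"
    proof -
      have "{i \<in> insert j J. k i \<noteq> 0} = insert j {i \<in> J. k i \<noteq> 0}" using False by auto
      then show ?thesis using insert.hyps by simp
    qed
    finally show ?thesis unfolding eq .
  qed
qed simp

section \<open>Bounds for single coefficients\<close>

lemma bohr_lift_monomial: "bohr_lift (\<lambda>n. if n = m then c else 0) z = c * prime_monomial m z"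
  by (subst bohr_lift_eq[of "{m}"]) (auto split: if_splits)

lemma hardy_norm_monomial:
  assumes p: "p > 0"
  shows "hardy_norm p (\<lambda>n. if n = m then c else 0) = norm c"
proof -
  interpret T: prob_space torus_haar by (rule prob_space_torus_haar)
  have "(\<integral>z. norm (bohr_lift (\<lambda>n. if n = m then c else 0) z) powr p \<partial>torus_haar) = (\<integral>z. norm c powr p \<partial>torus_haar)"
    by (intro Bochner_Integration.integral_cong refl) (simp only: bohr_lift_monomial norm_mult norm_prime_monomial mult_1_right)
  then show ?thesis using p by (simp add: hardy_norm_def powr_powr T.prob_space)
qed

lemma hardy_coeff_bound_radius:
  assumes a: "dirichlet_poly a" and r: "0 < r" "r < 1" and p: "p > 0" and m: "m > 0"
  shows "norm (a m) \<le> (\<Prod>j | prime_exponent m j \<noteq> 0. ((1 + r) / (1 - r)) powr (1 / p) * (1 / r) ^ prime_exponent m j)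
    * hardy_norm p a"
proof -
  \<comment> \<open>Fixing the exponents at all primes of \<open>a\<close> and of \<open>m\<close>
    isolates the single term \<open>m\<close>; the primes that do not divide \<open>m\<close> drop
    out of the constant again.\<close>
  define J where "J = prime_support a \<union> {j. prime_exponent m j \<noteq> 0}"
  have J: "finite J" unfolding J_def using finite_prime_support[OF a] finite_prime_exponent by blast
  have "(\<lambda>n. if \<forall>j\<in>J. prime_exponent n j = prime_exponent m j then a n else 0) = (\<lambda>n. if n = m then a m else 0)"
  proof
    fix n
    have "n = m" if "\<forall>j\<in>J. prime_exponent n j = prime_exponent m j" "a n \<noteq> 0"
    proof (rule prime_exponent_eqI)
      fix j
      show "prime_exponent n j = prime_exponent m j"
        using that prime_supportI[where a = a and n = n and j = j] by (cases "j \<in> J") (auto simp: J_def)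
    qed (use that a m in \<open>auto simp: dirichlet_poly_pos\<close>)
    then show "(if \<forall>j\<in>J. prime_exponent n j = prime_exponent m j then a n else 0) = (if n = m then a m else 0)"
      by auto
  qed
  moreover have "{j \<in> J. prime_exponent m j \<noteq> 0} = {j. prime_exponent m j \<noteq> 0}" by (auto simp: J_def)
  ultimately show ?thesis
    using hardy_norm_exponents_part[OF a J r p, of "prime_exponent m"] by (simp only: hardy_norm_monomial[OF p])
qed

text \<open>The price per prime at the radius \<open>r = 2 powr (- \<delta>)\<close>, chosen because
  then \<open>1 / r = 2 powr \<delta>\<close> is at most the power \<open>\<delta>\<close> of every
  prime.\<close>

definition coeff_const :: "real \<Rightarrow> real \<Rightarrow> real" where
  "coeff_const p \<delta> = ((1 + 2 powr (- \<delta>)) / (1 - 2 powr (- \<delta>))) powr (1 / p)"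

lemma coeff_const_ge_1: "p > 0 \<Longrightarrow> \<delta> > 0 \<Longrightarrow> coeff_const p \<delta> \<ge> 1"
  unfolding coeff_const_def
  by (rule ge_one_powr_ge_zero) (auto simp: divide_simps powr_less_one)

text \<open>The factors \<open>1 / r\<close> are replaced by powers of the primes, which multiply up
  to \<open>m powr \<delta>\<close>. Here \<open>\<delta>\<close> may be as small as desired, at the
  price of one constant for each prime divisor of \<open>m\<close>; this is harmless when only
  finitely many primes are in play.\<close>

lemma hardy_coeff_bound:
  assumes a: "dirichlet_poly a" and d: "\<delta> > 0" and p: "p > 0" and m: "m > 0"
  shows "norm (a m) \<le> coeff_const p \<delta> ^ card {j. prime_exponent m j \<noteq> 0} * real m powr \<delta> * hardy_norm p a"
proof -
  let ?S = "{j. prime_exponent m j \<noteq> 0}" and ?r = "2 powr (- \<delta>) :: real"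
  have r: "0 < ?r" "?r < 1" using d by (auto simp: powr_less_one)
  have C: "coeff_const p \<delta> \<ge> 0" by (simp add: coeff_const_def)
  have "(\<Prod>j\<in>?S. ((1 + ?r) / (1 - ?r)) powr (1 / p) * (1 / ?r) ^ prime_exponent m j)
      \<le> (\<Prod>j\<in>?S. coeff_const p \<delta> * (real (nth_prime j) powr \<delta>) ^ prime_exponent m j)"
  proof (rule prod_mono)
    fix j
    have "1 / ?r = 2 powr \<delta>" by (simp add: powr_minus divide_inverse)
    also have "\<dots> \<le> real (nth_prime j) powr \<delta>" using nth_prime_ge_2[of j] d by (intro powr_mono2) auto
    finally show "0 \<le> ((1 + ?r) / (1 - ?r)) powr (1 / p) * (1 / ?r) ^ prime_exponent m j \<and>
        ((1 + ?r) / (1 - ?r)) powr (1 / p) * (1 / ?r) ^ prime_exponent m j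
        \<le> coeff_const p \<delta> * (real (nth_prime j) powr \<delta>) ^ prime_exponent m j"
      unfolding coeff_const_def by (intro conjI mult_left_mono power_mono mult_nonneg_nonneg) auto
  qed
  also have "\<dots> = coeff_const p \<delta> ^ card ?S * real m powr \<delta>"
    using powr_prod_nth_prime[OF m finite_prime_exponent[of m]] by (simp add: prod.distrib)
  finally show ?thesis
    using hardy_coeff_bound_radius[OF a r p m] by (meson hardy_norm_nonneg mult_right_mono order_trans)
qed

text \<open>A bound valid over all primes at once: for \<open>\<delta> = 1\<close> the price per
  prime is \<open>3 powr (1 / p)\<close>, less than \<open>4 powr (1 / p)\<close>, and hence
  absorbed by the power \<open>2 / p\<close> of that prime.\<close>

lemma hardy_coeff_bound_poly:
  assumes a: "dirichlet_poly a" and p: "p > 0" and m: "m > 0"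
  shows "norm (a m) \<le> real m powr (1 + 2 / p) * hardy_norm p a"
proof -
  let ?S = "{j. prime_exponent m j \<noteq> 0}"
  have C: "coeff_const p 1 = 3 powr (1 / p)" by (simp add: coeff_const_def powr_minus)
  have "coeff_const p 1 ^ card ?S = (\<Prod>j\<in>?S. coeff_const p 1)" by simp
  also have "\<dots> \<le> (\<Prod>j\<in>?S. (real (nth_prime j) powr (2 / p)) ^ prime_exponent m j)"
  proof (rule prod_mono)
    fix j assume j: "j \<in> ?S"
    have g: "real (nth_prime j) \<ge> 2" using nth_prime_ge_2[of j] by simp
    have "3 powr (1 / p) \<le> (real (nth_prime j) powr 2) powr (1 / p)"
    proof (rule powr_mono2)
      have "3 \<le> (2::real)\<^sup>2" by simp
      also have "\<dots> \<le> (real (nth_prime j))\<^sup>2" using g by (intro power_mono) auto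
      finally show "3 \<le> real (nth_prime j) powr 2" using g by (simp add: powr_numeral)
    qed (use p in auto)
    also have "\<dots> = real (nth_prime j) powr (2 / p)" unfolding powr_powr by simp
    also have "\<dots> \<le> (real (nth_prime j) powr (2 / p)) ^ prime_exponent m j"
      using g p j by (intro self_le_power) (auto intro!: ge_one_powr_ge_zero)
    finally show "0 \<le> coeff_const p 1 \<and> coeff_const p 1 \<le> (real (nth_prime j) powr (2 / p)) ^ prime_exponent m j"
      unfolding C by simp
  qed
  also have "\<dots> = real m powr (2 / p)"
    using powr_prod_nth_prime[OF m finite_prime_exponent[of m]] by simp
  finally have "coeff_const p 1 ^ card ?S * real m powr 1 * hardy_norm p a \<le> real m powr (2 / p) * real m powr 1 * hardy_norm p a"
    by (intro mult_right_mono) auto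
  also have "\<dots> = real m powr (1 + 2 / p) * hardy_norm p a" by (simp only: powr_add[symmetric] add.commute)
  finally show ?thesis using hardy_coeff_bound[OF a _ p m, of 1] by simp
qed

section \<open>Tangent lines to powers and Jensen's inequality\<close>

lemma powr_tangent_strict:
  assumes y: "0 \<le> y" "y \<noteq> 1" and t: "t > (1::real)"
  shows "1 + t * (y - 1) < y powr t"
proof -
  consider "y = 0" | "0 < y" "y < 1" | "1 < y" using y by linarith
  then show ?thesis
  proof cases
    case 2
    have "\<exists>z. y < z \<and> z < 1 \<and> 1 powr t - y powr t = (1 - y) * (t * z powr (t - 1))"
      using 2 by (intro MVT2) (auto intro!: has_real_derivative_powr)
    then obtain z where z: "y < z" "z < 1" "1 - y powr t = (1 - y) * (t * z powr (t - 1))" by auto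
    have "z powr (t - 1) < 1" using z 2 t powr_less_mono2[of "t - 1" z 1] by simp
    then have "(1 - y) * (t * z powr (t - 1)) < (1 - y) * (t * 1)" using 2 t by (intro mult_strict_left_mono) auto
    then show ?thesis using z by (simp add: algebra_simps)
  next
    case 3
    have "\<exists>z. 1 < z \<and> z < y \<and> y powr t - 1 powr t = (y - 1) * (t * z powr (t - 1))"
      using 3 by (intro MVT2) (auto intro!: has_real_derivative_powr)
    then obtain z where z: "1 < z" "z < y" "y powr t - 1 = (y - 1) * (t * z powr (t - 1))" by auto
    have "z powr (t - 1) > 1" using z t by simp
    then have "(y - 1) * (t * z powr (t - 1)) > (y - 1) * (t * 1)" using 3 t by (intro mult_strict_left_mono) auto
    then show ?thesis using z by (simp add: algebra_simps)
  qed (use t in simp)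
qed

text \<open>By homogeneity from the tangent at \<open>1\<close>. Integrated, it gives Jensen's
  inequality; its strict form later separates two Hardy norms of \<open>1 + z\<close>.\<close>

lemma powr_tangent:
  assumes x: "0 \<le> x" "0 < M" and t: "t \<ge> (1::real)"
  shows "M powr t + t * M powr (t - 1) * (x - M) \<le> x powr t"
    and "t > 1 \<Longrightarrow> x \<noteq> M \<Longrightarrow> M powr t + t * M powr (t - 1) * (x - M) < x powr t"
proof -
  have e: "M powr t + t * M powr (t - 1) * (x - M) = M powr t * (1 + t * (x / M - 1))"
    using x by (simp add: powr_diff field_simps)
  have e2: "x powr t = M powr t * (x / M) powr t"
    using x by (simp add: powr_divide)
  show *: "M powr t + t * M powr (t - 1) * (x - M) < x powr t" if "t > 1" "x \<noteq> M"
    unfolding e e2 using x that by (intro mult_strict_left_mono powr_tangent_strict) auto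
  show "M powr t + t * M powr (t - 1) * (x - M) \<le> x powr t"
    using * t x by (cases "x = M"; cases "t = 1") auto
qed

text \<open>The tangent is taken at the mean of \<open>f\<close>, where its linear part integrates
  to \<open>0\<close>. It requires a positive base point, so a vanishing mean is treated
  apart.\<close>

lemma (in prob_space) powr_expectation_le:
  fixes f :: "'a \<Rightarrow> real"
  assumes f: "integrable M f" "integrable M (\<lambda>x. f x powr t)" "\<And>x. 0 \<le> f x" and t: "t \<ge> 1"
  shows "(expectation f) powr t \<le> expectation (\<lambda>x. f x powr t)"
proof (cases "expectation f > 0")
  case True
  let ?E = "expectation f"
  have "?E powr t = expectation (\<lambda>x. ?E powr t + t * ?E powr (t - 1) * (f x - ?E))"
    using f by (simp add: prob_space)
  also have "\<dots> \<le> expectation (\<lambda>x. f x powr t)"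
  proof (rule Bochner_Integration.integral_mono)
    show "integrable M (\<lambda>x. ?E powr t + t * ?E powr (t - 1) * (f x - ?E))" using f by simp
    show "?E powr t + t * ?E powr (t - 1) * (f x - ?E) \<le> f x powr t" for x
      using f(3) True t by (rule powr_tangent(1))
  qed (rule f(2))
  finally show ?thesis .
next
  case False
  then have "expectation f = 0" using Bochner_Integration.integral_nonneg[of M f, OF f(3)] by linarith
  then show ?thesis by (simp add: integral_nonneg_AE)
qed

lemma hardy_integrable: "p > 0 \<Longrightarrow> integrable torus_haar (\<lambda>z. norm (bohr_lift a z) powr p)"
  using lift_moment_finite[of p a] unfolding lift_moment_def by (intro integrableI_nonneg) auto

lemma hardy_norm_exponent_mono:
  assumes "0 < u" "u \<le> p"
  shows "hardy_norm u a \<le> hardy_norm p a"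
proof -
  interpret T: prob_space torus_haar by (rule prob_space_torus_haar)
  let ?I = "\<lambda>p. \<integral>z. norm (bohr_lift a z) powr p \<partial>torus_haar"
  have "?I u powr (p / u) \<le> (\<integral>z. (norm (bohr_lift a z) powr u) powr (p / u) \<partial>torus_haar)"
    using assms by (intro T.powr_expectation_le) (auto simp: powr_powr hardy_integrable)
  then have "?I u powr (p / u) \<le> ?I p" using assms by (simp add: powr_powr)
  then have "(?I u powr (p / u)) powr (1 / p) \<le> ?I p powr (1 / p)" using assms by (intro powr_mono2) auto
  then show ?thesis using assms by (simp add: hardy_norm_def powr_powr)
qed

section \<open>The measures \<open>\<mu>\<^sub>\<alpha>\<close> and the embedding\<close>

lemma nn_integral_powr_exp:
  assumes a: "a > -1" and l: "l > (0::real)"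
  shows "(\<integral>\<^sup>+x. ennreal (indicator {0<..} x * (x powr a * exp (- l * x))) \<partial>lborel) = ennreal (Gamma (a + 1) * l powr (- (a + 1)))"
    (is "?I = _")
proof -
  have "ennreal (Gamma (a + 1)) = (\<integral>\<^sup>+t. ennreal (indicator {0..} t * t powr a / exp t) \<partial>lborel)"
    using a by (subst Gamma_conv_nn_integral_real) auto
  also have "\<dots> = ennreal \<bar>l\<bar> * (\<integral>\<^sup>+x. ennreal (indicator {0..} (0 + l * x) * (0 + l * x) powr a / exp (0 + l * x)) \<partial>lborel)"
    by (rule nn_integral_real_affine) (use l in auto)
  also have "(\<integral>\<^sup>+x. ennreal (indicator {0..} (0 + l * x) * (0 + l * x) powr a / exp (0 + l * x)) \<partial>lborel)
      = (\<integral>\<^sup>+x. ennreal (l powr a) * ennreal (indicator {0<..} x * (x powr a * exp (- l * x))) \<partial>lborel)"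
  proof (rule nn_integral_cong)
    fix x :: real
    have "indicator {0..} (0 + l * x) * (0 + l * x) powr a / exp (0 + l * x)
      = l powr a * (indicator {0<..} x * (x powr a * exp (- l * x)))"
    proof (cases "x > 0")
      case True
      then show ?thesis using l by (simp add: powr_mult exp_minus divide_inverse)
    next
      case False
      then show ?thesis using l by (cases "x = 0") (auto simp: indicator_def zero_le_mult_iff)
    qed
    then show "ennreal (indicator {0..} (0 + l * x) * (0 + l * x) powr a / exp (0 + l * x))
      = ennreal (l powr a) * ennreal (indicator {0<..} x * (x powr a * exp (- l * x)))"
      by (simp only:) (simp add: ennreal_mult)
  qed
  also have "\<dots> = ennreal (l powr a) * ?I"
    by (rule nn_integral_cmult) measurable
  also have "ennreal \<bar>l\<bar> * (ennreal (l powr a) * ?I) = ennreal (\<bar>l\<bar> * l powr a) * ?I"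
    by (simp only: mult.assoc[symmetric] ennreal_mult abs_ge_zero powr_ge_zero)
  also have "\<bar>l\<bar> * l powr a = l powr (a + 1)" using l by (simp add: powr_add)
  finally have *: "ennreal (Gamma (a + 1)) = ennreal (l powr (a + 1)) * ?I" .
  have "1 = l powr (- (a + 1)) * l powr (a + 1)" unfolding powr_add[symmetric] using l by simp
  then have "?I = ennreal (l powr (- (a + 1)) * l powr (a + 1)) * ?I" by simp
  also have "\<dots> = ennreal (l powr (- (a + 1))) * (ennreal (l powr (a + 1)) * ?I)"
    by (simp only: mult.assoc[symmetric] ennreal_mult powr_ge_zero)
  also have "\<dots> = ennreal (l powr (- (a + 1)) * Gamma (a + 1))"
    unfolding *[symmetric] using a Gamma_real_pos[of "a + 1"] by (simp add: ennreal_mult)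
  also have "\<dots> = ennreal (Gamma (a + 1) * l powr (- (a + 1)))" by (simp only: mult.commute)
  finally show ?thesis .
qed

definition mu_density :: "real \<Rightarrow> real \<Rightarrow> real" where
  "mu_density \<alpha> \<sigma> = indicator {0<..} \<sigma> * (2 powr (\<alpha> + 1) / Gamma (\<alpha> + 1) * \<sigma> powr \<alpha> * exp (- 2 * \<sigma>))"

definition mu_const :: "real \<Rightarrow> real" where
  "mu_const \<alpha> = 2 powr (\<alpha> + 1) / Gamma (\<alpha> + 1)"

lemma mu_const_pos: "\<alpha> > -1 \<Longrightarrow> mu_const \<alpha> > 0"
  by (simp add: mu_const_def Gamma_real_pos)

lemma mu_density_eq: "mu_density \<alpha> \<sigma> = mu_const \<alpha> * (indicator {0<..} \<sigma> * (\<sigma> powr \<alpha> * exp (- 2 * \<sigma>)))"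
  by (simp add: mu_density_def mu_const_def)

lemma mu_density_nonneg: "\<alpha> > -1 \<Longrightarrow> 0 \<le> mu_density \<alpha> \<sigma>"
  unfolding mu_density_eq using mu_const_pos[of \<alpha>] by simp

lemma mu_density_measurable [measurable]: "mu_density \<alpha> \<in> borel_measurable borel"
  unfolding mu_density_def by measurable

lemma mu_measure_eq: "mu_measure \<alpha> = density lborel (\<lambda>\<sigma>. ennreal (mu_density \<alpha> \<sigma>))"
  by (simp add: mu_measure_def mu_density_def)

lemma sets_mu_measure [measurable_cong, simp]: "sets (mu_measure \<alpha>) = sets borel"
  by (simp add: mu_measure_eq)

lemma space_mu_measure [simp]: "space (mu_measure \<alpha>) = UNIV"
  by (simp add: mu_measure_eq)

lemma nn_integral_mu_measure:
  assumes [measurable]: "g \<in> borel_measurable borel"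
  shows "(\<integral>\<^sup>+\<sigma>. g \<sigma> \<partial>mu_measure \<alpha>) = (\<integral>\<^sup>+\<sigma>. ennreal (mu_density \<alpha> \<sigma>) * g \<sigma> \<partial>lborel)"
  unfolding mu_measure_eq by (subst nn_integral_density) auto

lemma AE_mu_measure_pos: "AE \<sigma> in mu_measure \<alpha>. \<sigma> > 0"
  unfolding mu_measure_eq by (subst AE_density) (auto intro!: AE_I2 simp: mu_density_def indicator_def)

lemma nn_integral_mu_powr_exp:
  assumes a: "\<alpha> > -1" and c: "\<alpha> + c > -1" and l: "l \<ge> 0"
  shows "(\<integral>\<^sup>+\<sigma>. ennreal (\<sigma> powr c * exp (- l * \<sigma>)) \<partial>mu_measure \<alpha>)
    = ennreal (mu_const \<alpha> * (Gamma (\<alpha> + c + 1) * (2 + l) powr (- (\<alpha> + c + 1))))"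
proof -
  have "(\<integral>\<^sup>+\<sigma>. ennreal (\<sigma> powr c * exp (- l * \<sigma>)) \<partial>mu_measure \<alpha>)
      = (\<integral>\<^sup>+\<sigma>. ennreal (mu_density \<alpha> \<sigma>) * ennreal (\<sigma> powr c * exp (- l * \<sigma>)) \<partial>lborel)"
    by (rule nn_integral_mu_measure) measurable
  also have "\<dots> = (\<integral>\<^sup>+\<sigma>. ennreal (mu_const \<alpha>) * ennreal (indicator {0<..} \<sigma> * (\<sigma> powr (\<alpha> + c) * exp (- (2 + l) * \<sigma>))) \<partial>lborel)"
  proof (rule nn_integral_cong)
    fix s :: real
    have "exp (- (2 + l) * s) = exp (- 2 * s) * exp (- l * s)"
      unfolding exp_add[symmetric] by (simp add: algebra_simps)
    then have "mu_density \<alpha> s * (s powr c * exp (- l * s)) = mu_const \<alpha> * (indicator {0<..} s * (s powr (\<alpha> + c) * exp (- (2 + l) * s)))"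
      unfolding mu_density_eq by (simp only: powr_add mult_ac)
    then show "ennreal (mu_density \<alpha> s) * ennreal (s powr c * exp (- l * s))
        = ennreal (mu_const \<alpha>) * ennreal (indicator {0<..} s * (s powr (\<alpha> + c) * exp (- (2 + l) * s)))"
      using mu_const_pos[OF a] mu_density_nonneg[OF a, of s] by (simp add: ennreal_mult[symmetric])
  qed
  also have "\<dots> = ennreal (mu_const \<alpha>) * ennreal (Gamma (\<alpha> + c + 1) * (2 + l) powr (- (\<alpha> + c + 1)))"
    using nn_integral_powr_exp[of "\<alpha> + c" "2 + l"] c l by (subst nn_integral_cmult) auto
  finally show ?thesis using mu_const_pos[OF a] by (simp add: ennreal_mult')
qed

lemma nn_integral_mu_exp:
  assumes a: "\<alpha> > -1" and l: "l \<ge> 0"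
  shows "(\<integral>\<^sup>+\<sigma>. ennreal (exp (- l * \<sigma>)) \<partial>mu_measure \<alpha>) = ennreal ((2 / (2 + l)) powr (\<alpha> + 1))"
proof -
  have "(\<integral>\<^sup>+\<sigma>. ennreal (exp (- l * \<sigma>)) \<partial>mu_measure \<alpha>) = (\<integral>\<^sup>+\<sigma>. ennreal (\<sigma> powr 0 * exp (- l * \<sigma>)) \<partial>mu_measure \<alpha>)"
    by (rule nn_integral_cong_AE) (use AE_mu_measure_pos in \<open>eventually_elim, auto\<close>)
  also have "\<dots> = ennreal (mu_const \<alpha> * (Gamma (\<alpha> + 1) * (2 + l) powr (- (\<alpha> + 1))))"
    using nn_integral_mu_powr_exp[OF a _ l, of 0] a by simp
  also have "mu_const \<alpha> * (Gamma (\<alpha> + 1) * (2 + l) powr (- (\<alpha> + 1))) = (2 / (2 + l)) powr (\<alpha> + 1)"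
  proof -
    have "mu_const \<alpha> * Gamma (\<alpha> + 1) = 2 powr (\<alpha> + 1)"
      using a Gamma_real_pos[of "\<alpha> + 1"] by (simp add: mu_const_def less_imp_neq[symmetric])
    then have "mu_const \<alpha> * (Gamma (\<alpha> + 1) * (2 + l) powr (- (\<alpha> + 1))) = 2 powr (\<alpha> + 1) * (2 + l) powr (- (\<alpha> + 1))"
      by (simp only: mult.assoc[symmetric])
    also have "\<dots> = (2 / (2 + l)) powr (\<alpha> + 1)"
    proof -
      have "0 \<le> 2 + l" using l by simp
      then show ?thesis unfolding powr_minus divide_inverse[symmetric] by (simp add: powr_divide)
    qed
    finally show ?thesis .
  qed
  finally show ?thesis .
qed

lemma emeasure_mu_measure_UNIV: "\<alpha> > -1 \<Longrightarrow> emeasure (mu_measure \<alpha>) UNIV = 1"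
  using nn_integral_mu_exp[of \<alpha> 0] by simp

text \<open>On a dyadic interval below \<open>1\<close> the density is at least a constant times
  \<open>s powr \<alpha>\<close>, and the length contributes one more power. The dyadic shape
  matters twice: monotone functions can be frozen on such an interval, and the intervals of lacunary
  points are disjoint.\<close>

lemma mu_measure_interval:
  assumes a: "\<alpha> > -1"
  obtains c where "c > 0" "\<And>s. 0 < s \<Longrightarrow> s \<le> 1 \<Longrightarrow> ennreal (c * s powr (\<alpha> + 1)) \<le> emeasure (mu_measure \<alpha>) {s/2<..s}"
proof
  \<comment> \<open>The minimum covers both signs of \<open>\<alpha>\<close>: on the interval the
    power is smallest near \<open>s / 2\<close> if \<open>\<alpha> \<ge> 0\<close>, and at
    \<open>s\<close> if \<open>\<alpha> < 0\<close>.\<close>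
  define m where "m = min (2 powr (- \<alpha>)) 1"
  have m: "0 < m" "m \<le> 1" "m \<le> 2 powr (- \<alpha>)" by (auto simp: m_def)
  let ?c = "mu_const \<alpha> * exp (- 2) * m / 2"
  show "?c > 0" using mu_const_pos[OF a] m by simp
  fix s :: real assume s: "0 < s" "s \<le> 1"
  have lower: "mu_const \<alpha> * exp (- 2) * (m * s powr \<alpha>) \<le> mu_density \<alpha> t" if t: "s / 2 < t" "t \<le> s" for t
  proof -
    have "m * s powr \<alpha> \<le> t powr \<alpha>"
    proof (cases "\<alpha> \<ge> 0")
      case True
      have "m * s powr \<alpha> \<le> 2 powr (- \<alpha>) * s powr \<alpha>" using m by (intro mult_right_mono) auto
      also have "\<dots> = (s / 2) powr \<alpha>" using s by (simp add: powr_divide powr_minus_divide)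
      also have "\<dots> \<le> t powr \<alpha>" using t s True by (intro powr_mono2) auto
      finally show ?thesis .
    next
      case False
      have "m * s powr \<alpha> \<le> 1 * s powr \<alpha>" using m by (intro mult_right_mono) auto
      also have "\<dots> \<le> t powr \<alpha>" using t s False by (auto intro: powr_mono2')
      finally show ?thesis .
    qed
    moreover have "exp (- 2) \<le> exp (- 2 * t)" using t s by simp
    ultimately have "exp (- 2) * (m * s powr \<alpha>) \<le> exp (- 2 * t) * t powr \<alpha>"
      using m by (intro mult_mono) auto
    then have "mu_const \<alpha> * (exp (- 2) * (m * s powr \<alpha>)) \<le> mu_const \<alpha> * (exp (- 2 * t) * t powr \<alpha>)"
      using mu_const_pos[OF a] by (intro mult_left_mono) auto
    moreover have "mu_density \<alpha> t = mu_const \<alpha> * (exp (- 2 * t) * t powr \<alpha>)"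
      using t s by (simp add: mu_density_eq)
    ultimately show ?thesis by (simp only: mult.assoc)
  qed
  have "ennreal (?c * s powr (\<alpha> + 1)) = ennreal (mu_const \<alpha> * exp (- 2) * (m * s powr \<alpha>)) * ennreal (s / 2)"
  proof -
    have "s powr (\<alpha> + 1) = s powr \<alpha> * s" using s by (simp add: powr_add)
    then show ?thesis using s m mu_const_pos[OF a] by (subst ennreal_mult[symmetric]) simp_all
  qed
  also have "\<dots> = (\<integral>\<^sup>+t. ennreal (mu_const \<alpha> * exp (- 2) * (m * s powr \<alpha>)) * indicator {s/2<..s} t \<partial>lborel)"
    using s by (subst nn_integral_cmult_indicator) auto
  also have "\<dots> \<le> (\<integral>\<^sup>+t. ennreal (mu_density \<alpha> t) * indicator {s/2<..s} t \<partial>lborel)"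
    by (intro nn_integral_mono) (auto simp: indicator_def intro!: ennreal_leI lower)
  also have "\<dots> = emeasure (mu_measure \<alpha>) {s/2<..s}"
    unfolding mu_measure_eq by (subst emeasure_density) auto
  finally show "ennreal (?c * s powr (\<alpha> + 1)) \<le> emeasure (mu_measure \<alpha>) {s/2<..s}" .
qed

section \<open>Growth near \<open>\<sigma> = 0\<close> and the norm inequality\<close>

lemma hardy_norm_shift_measurable:
  assumes a: "dirichlet_poly a"
  shows "(\<lambda>\<sigma>. hardy_norm p (dirichlet_shift \<sigma> a)) \<in> borel_measurable borel"
proof -
  interpret T: prob_space torus_haar by (rule prob_space_torus_haar)
  have fin: "finite {n. a n \<noteq> 0}" using a by (simp add: dirichlet_poly_def)
  have "bohr_lift (dirichlet_shift \<sigma> a) z = (\<Sum>n | a n \<noteq> 0. a n * of_real (real n powr (- \<sigma>)) * prime_monomial n z)" for \<sigma> z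
    by (subst bohr_lift_eq[OF fin]) (auto simp: dirichlet_shift_def)
  then have "(\<lambda>x. norm (bohr_lift (dirichlet_shift (fst x) a) (snd x)) powr p)
      = (\<lambda>x. norm (\<Sum>n | a n \<noteq> 0. a n * of_real (real n powr (- fst x)) * prime_monomial n (snd x)) powr p)"
    by simp
  also have "\<dots> \<in> borel_measurable (borel \<Otimes>\<^sub>M torus_haar)" by measurable
  finally have "(\<lambda>\<sigma>. \<integral>z. norm (bohr_lift (dirichlet_shift \<sigma> a) z) powr p \<partial>torus_haar) \<in> borel_measurable borel"
    by (intro T.borel_measurable_lebesgue_integral) (simp add: split_beta')
  then show ?thesis unfolding hardy_norm_def by measurable
qed

definition mixed_moment :: "real \<Rightarrow> real \<Rightarrow> real \<Rightarrow> (nat \<Rightarrow> complex) \<Rightarrow> ennreal" where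
  "mixed_moment p q \<alpha> a = (\<integral>\<^sup>+\<sigma>. ennreal (hardy_norm p (dirichlet_shift \<sigma> a) powr q) \<partial>mu_measure \<alpha>)"

lemma mixed_norm_nonneg [simp]: "0 \<le> mixed_norm p q \<alpha> a"
  by (simp add: mixed_norm_def)

lemma mixed_moment_eq:
  assumes a: "dirichlet_poly a" and p: "p > 0" and q: "q > 0" and al: "\<alpha> > -1"
  shows "mixed_moment p q \<alpha> a = ennreal (mixed_norm p q \<alpha> a powr q)"
proof -
  have m: "(\<lambda>\<sigma>. hardy_norm p (dirichlet_shift \<sigma> a) powr q) \<in> borel_measurable (mu_measure \<alpha>)"
    using hardy_norm_shift_measurable[OF a, of p] by (simp cong: measurable_cong_sets)
  have "mixed_moment p q \<alpha> a \<le> (\<integral>\<^sup>+\<sigma>. ennreal (hardy_norm p a powr q) \<partial>mu_measure \<alpha>)"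
    unfolding mixed_moment_def
  proof (rule nn_integral_mono_AE)
    show "AE \<sigma> in mu_measure \<alpha>. ennreal (hardy_norm p (dirichlet_shift \<sigma> a) powr q) \<le> ennreal (hardy_norm p a powr q)"
      using AE_mu_measure_pos
      by eventually_elim (use q in \<open>auto intro!: ennreal_leI powr_mono2 hardy_norm_shift_le a p\<close>)
  qed
  also have "\<dots> < \<infinity>" using al by (simp add: emeasure_mu_measure_UNIV)
  finally have i: "integrable (mu_measure \<alpha>) (\<lambda>\<sigma>. hardy_norm p (dirichlet_shift \<sigma> a) powr q)"
    unfolding mixed_moment_def by (intro integrableI_nonneg m) auto
  have "mixed_moment p q \<alpha> a = ennreal (\<integral>\<sigma>. hardy_norm p (dirichlet_shift \<sigma> a) powr q \<partial>mu_measure \<alpha>)"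
    unfolding mixed_moment_def by (rule nn_integral_eq_integral[OF i]) simp
  also have "(\<integral>\<sigma>. hardy_norm p (dirichlet_shift \<sigma> a) powr q \<partial>mu_measure \<alpha>) = mixed_norm p q \<alpha> a powr q"
    using q by (simp add: mixed_norm_def powr_powr integral_nonneg_AE)
  finally show ?thesis .
qed

lemma powr_le_iff_nonneg:
  assumes "q > 0" "0 \<le> x" "0 \<le> (y::real)"
  shows "x powr q \<le> y powr q \<longleftrightarrow> x \<le> y"
proof
  show "x powr q \<le> y powr q" if "x \<le> y" using that assms by (intro powr_mono2) auto
  show "x \<le> y" if "x powr q \<le> y powr q" 
    using that powr_less_mono2[of q y x] assms by (cases "y < x") auto
qed

lemma mixed_norm_leI:
  assumes a: "dirichlet_poly a" and p: "p > 0" and q: "q > 0" and al: "\<alpha> > -1"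
    and C: "C \<ge> 0" and le: "mixed_moment p q \<alpha> a \<le> ennreal (C powr q)"
  shows "mixed_norm p q \<alpha> a \<le> C"
  using le C q by (simp add: mixed_moment_eq[OF a p q al] powr_le_iff_nonneg)

text \<open>On \<open>{s/2<..s}\<close> the decreasing function is at least its value at
  \<open>s\<close>, so the mass of that interval times the \<open>q\<close>-th power of this value
  is below the mixed moment. The mass bound is available up to \<open>1\<close> only; beyond, the
  value at \<open>1\<close> takes over, whence \<open>min s 1\<close>.\<close>

lemma hardy_norm_shift_le_mixed_norm:
  assumes p: "p > 0" and q: "q > 0" and al: "\<alpha> > -1"
  shows "\<exists>C>0. \<forall>a s. dirichlet_poly a \<longrightarrow> s > 0 \<longrightarrow>
    hardy_norm p (dirichlet_shift s a) \<le> C * min s 1 powr (- ((\<alpha> + 1) / q)) * mixed_norm p q \<alpha> a"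
proof -
  obtain c where c: "c > 0" "\<And>s. 0 < s \<Longrightarrow> s \<le> 1 \<Longrightarrow> ennreal (c * s powr (\<alpha> + 1)) \<le> emeasure (mu_measure \<alpha>) {s/2<..s}"
    using mu_measure_interval[OF al] by blast
  let ?C = "(1 / c) powr (1 / q)"
  show ?thesis
  proof (intro exI[of _ ?C] conjI allI impI)
    show "?C > 0" using c by simp
    fix a :: "nat \<Rightarrow> complex" and s :: real assume a: "dirichlet_poly a" and s: "s > 0"
    let ?F = "\<lambda>s. hardy_norm p (dirichlet_shift s a)" and ?N = "mixed_norm p q \<alpha> a"
    let ?m = "min s 1"
    have m: "0 < ?m" "?m \<le> 1" using s by auto
    have "ennreal (?F ?m powr q * (c * ?m powr (\<alpha> + 1))) = ennreal (?F ?m powr q) * ennreal (c * ?m powr (\<alpha> + 1))"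
      using c by (intro ennreal_mult) auto
    also have "\<dots> \<le> ennreal (?F ?m powr q) * emeasure (mu_measure \<alpha>) {?m/2<..?m}"
      by (intro mult_left_mono c m) auto
    also have "\<dots> = (\<integral>\<^sup>+t. ennreal (?F ?m powr q) * indicator {?m/2<..?m} t \<partial>mu_measure \<alpha>)"
      by (subst nn_integral_cmult_indicator) auto
    also have "\<dots> \<le> mixed_moment p q \<alpha> a"
      unfolding mixed_moment_def
      by (intro nn_integral_mono)
         (use q in \<open>auto simp: indicator_def intro!: ennreal_leI powr_mono2 hardy_norm_shift_antimono a p\<close>)
    also have "\<dots> = ennreal (?N powr q)" by (rule mixed_moment_eq[OF a p q al])
    finally have "?F ?m powr q * (c * ?m powr (\<alpha> + 1)) \<le> ?N powr q" by simp
    then have "?F ?m powr q \<le> (1 / c) * ?m powr (- (\<alpha> + 1)) * ?N powr q"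
    proof -
      have "?m powr (- (\<alpha> + 1)) * ?m powr (\<alpha> + 1) = 1" using m by (simp only: powr_add[symmetric]) simp
      then have "?F ?m powr q = (1 / c) * ?m powr (- (\<alpha> + 1)) * (?F ?m powr q * (c * ?m powr (\<alpha> + 1)))"
        using c(1) by (simp add: mult_ac)
      also have "\<dots> \<le> (1 / c) * ?m powr (- (\<alpha> + 1)) * ?N powr q"
        using c(1) \<open>_ \<le> ?N powr q\<close> by (intro mult_left_mono) auto
      finally show ?thesis .
    qed
    also have "\<dots> = (?C * ?m powr (- ((\<alpha> + 1) / q)) * ?N) powr q"
      using c(1) m q by (simp add: powr_mult powr_powr)
    finally have "?F ?m \<le> ?C * ?m powr (- ((\<alpha> + 1) / q)) * ?N"
      using q by (subst (asm) powr_le_iff_nonneg) auto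
    moreover have "?F s \<le> ?F ?m" by (rule hardy_norm_shift_antimono[OF a _ p]) simp
    ultimately show "?F s \<le> ?C * ?m powr (- ((\<alpha> + 1) / q)) * ?N" by linarith
  qed
qed

text \<open>In the strict case the growth bound is itself integrable to the power \<open>v\<close>.
  In the case of equality it just fails to be; there it is applied only to the surplus power
  \<open>v - q\<close>, and the remaining power \<open>q\<close> is integrated by the source
  norm.\<close>

lemma mixed_norm_embedding:
  assumes pos: "0 < p" "0 < q" "0 < u" "0 < v" and al: "\<alpha> > -1" and be: "\<beta> > -1"
    and up: "u \<le> p"
    and cond: "(\<alpha> + 1) / q < (\<beta> + 1) / v \<or> (\<alpha> + 1) / q = (\<beta> + 1) / v \<and> q \<le> v"
  shows "\<exists>C>0. \<forall>a. dirichlet_poly a \<longrightarrow> mixed_norm u v \<beta> a \<le> C * mixed_norm p q \<alpha> a"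
proof -
  let ?x = "(\<alpha> + 1) / q"
  obtain C where C: "C > 0" "\<And>a s. dirichlet_poly a \<Longrightarrow> s > 0 \<Longrightarrow>
    hardy_norm p (dirichlet_shift s a) \<le> C * min s 1 powr (- ?x) * mixed_norm p q \<alpha> a"
    using hardy_norm_shift_le_mixed_norm[OF pos(1,2) al] by blast
  have "\<exists>D>0. \<forall>a. dirichlet_poly a \<longrightarrow>
      mixed_moment u v \<beta> a \<le> ennreal (D * mixed_norm p q \<alpha> a powr v)"
    using cond
  proof
    assume less: "?x < (\<beta> + 1) / v"
    then have e: "\<beta> + (- ?x * v) > -1" using pos by (simp add: field_simps)
    define D where "D = mu_const \<beta> * (Gamma (\<beta> + (- ?x * v) + 1) * (2 + 0) powr (- (\<beta> + (- ?x * v) + 1)))"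
    have D: "(\<integral>\<^sup>+\<sigma>. ennreal (\<sigma> powr (- ?x * v)) \<partial>mu_measure \<beta>) = ennreal D"
      using nn_integral_mu_powr_exp[OF be e, of 0] unfolding D_def by simp
    have D0: "D > 0" unfolding D_def using mu_const_pos[OF be] e by (intro mult_pos_pos Gamma_real_pos) auto
    show ?thesis
    proof (intro exI[of _ "C powr v * (D + 1)"] conjI allI impI)
      show "C powr v * (D + 1) > 0" using C D0 by simp
      fix a :: "nat \<Rightarrow> complex" assume a: "dirichlet_poly a"
      let ?N = "mixed_norm p q \<alpha> a"
      have "mixed_moment u v \<beta> a \<le> (\<integral>\<^sup>+\<sigma>. ennreal (C powr v * ?N powr v) * (ennreal (\<sigma> powr (- ?x * v)) + 1) \<partial>mu_measure \<beta>)"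
        unfolding mixed_moment_def
      proof (rule nn_integral_mono_AE)
        show "AE \<sigma> in mu_measure \<beta>. ennreal (hardy_norm u (dirichlet_shift \<sigma> a) powr v)
            \<le> ennreal (C powr v * ?N powr v) * (ennreal (\<sigma> powr (- ?x * v)) + 1)"
          using AE_mu_measure_pos
        proof eventually_elim
          fix s :: real assume s: "s > 0"
          have "hardy_norm u (dirichlet_shift s a) \<le> hardy_norm p (dirichlet_shift s a)"
            using pos up by (intro hardy_norm_exponent_mono) auto
          also have "\<dots> \<le> C * min s 1 powr (- ?x) * ?N" by (rule C(2)[OF a s])
          finally have "hardy_norm u (dirichlet_shift s a) powr v \<le> (C * min s 1 powr (- ?x) * ?N) powr v"
            using pos by (intro powr_mono2) auto
          also have "\<dots> = C powr v * ?N powr v * min s 1 powr (- ?x * v)"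
            using C s by (simp add: powr_mult powr_powr)
          \<comment> \<open>Adding \<open>1\<close> merges the two regimes of \<open>min s 1\<close>
            into one integrand; it costs only the total mass \<open>1\<close> of the
            measure.\<close>
          also have "\<dots> \<le> C powr v * ?N powr v * (s powr (- ?x * v) + 1)"
            by (intro mult_left_mono) (auto simp: min_def)
          finally show "ennreal (hardy_norm u (dirichlet_shift s a) powr v)
              \<le> ennreal (C powr v * ?N powr v) * (ennreal (s powr (- ?x * v)) + 1)"
            by (simp add: ennreal_mult[symmetric] ennreal_plus[symmetric] del: ennreal_plus flip: ennreal_1)
        qed
      qed
      also have "\<dots> = ennreal (C powr v * ?N powr v) * (ennreal D + 1)"
        unfolding D[symmetric] by (subst nn_integral_cmult) (auto simp: nn_integral_add emeasure_mu_measure_UNIV be)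
      also have "\<dots> = ennreal (C powr v * (D + 1) * ?N powr v)"
        using D0 by (simp add: ennreal_mult[symmetric] ennreal_plus[symmetric] mult_ac del: ennreal_plus flip: ennreal_1)
      finally show "mixed_moment u v \<beta> a \<le> ennreal (C powr v * (D + 1) * ?N powr v)" .
    qed
  next
    assume eq: "?x = (\<beta> + 1) / v \<and> q \<le> v"
    let ?k = "mu_const \<beta> / mu_const \<alpha>"
    have k: "?k > 0" using mu_const_pos[OF al] mu_const_pos[OF be] by simp
    \<comment> \<open>The balance of exponents in the case of equality: multiplied by the growth
      bound to the power \<open>v - q\<close>, the weight with exponent \<open>\<beta>\<close>
      becomes the one with exponent \<open>\<alpha>\<close>.\<close>
    have e: "\<beta> + (- ?x * (v - q)) = \<alpha>"
    proof -
      have "?x * v = \<beta> + 1" using eq pos by simp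
      moreover have "?x * q = \<alpha> + 1" using pos by simp
      ultimately show ?thesis by (simp add: right_diff_distrib)
    qed
    show ?thesis
    proof (intro exI[of _ "C powr (v - q) * (?k + C powr q)"] conjI allI impI)
      show "C powr (v - q) * (?k + C powr q) > 0" using C k by (simp add: add_pos_pos)
      fix a :: "nat \<Rightarrow> complex" assume a: "dirichlet_poly a"
      let ?N = "mixed_norm p q \<alpha> a" and ?F = "\<lambda>s. hardy_norm p (dirichlet_shift s a)"
      note hm [measurable] = hardy_norm_shift_measurable[OF a]
      let ?B = "C powr (v - q) * ?N powr (v - q)"
      have "mixed_moment u v \<beta> a = (\<integral>\<^sup>+\<sigma>. ennreal (mu_density \<beta> \<sigma>) * ennreal (hardy_norm u (dirichlet_shift \<sigma> a) powr v) \<partial>lborel)"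
        unfolding mixed_moment_def by (rule nn_integral_mu_measure) measurable
      also have "\<dots> \<le> (\<integral>\<^sup>+\<sigma>. ennreal ?B * (ennreal ?k * (ennreal (mu_density \<alpha> \<sigma>) * ennreal (?F \<sigma> powr q))
          + ennreal (C powr q * ?N powr q) * ennreal (mu_density \<beta> \<sigma>)) \<partial>lborel)"
      proof (rule nn_integral_mono)
        fix s :: real
        have d: "0 \<le> mu_density \<alpha> s" "0 \<le> mu_density \<beta> s" using al be by (auto simp: mu_density_nonneg)
        have "mu_density \<beta> s * hardy_norm u (dirichlet_shift s a) powr v
           \<le> ?B * (?k * (mu_density \<alpha> s * ?F s powr q) + C powr q * ?N powr q * mu_density \<beta> s)"
        proof (cases "s > 0")
          case True
          have F: "?F s \<le> C * min s 1 powr (- ?x) * ?N" by (rule C(2)[OF a True])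
          have "hardy_norm u (dirichlet_shift s a) powr v \<le> ?F s powr v"
            using pos up by (intro powr_mono2 hardy_norm_exponent_mono) auto
          also have "\<dots> = ?F s powr q * ?F s powr (v - q)" by (simp add: powr_add[symmetric])
          also have "\<dots> \<le> ?F s powr q * (C * min s 1 powr (- ?x) * ?N) powr (v - q)"
            using F eq by (intro mult_left_mono powr_mono2) auto
          also have "\<dots> = ?B * (min s 1 powr (- ?x * (v - q)) * ?F s powr q)"
            using C True by (simp add: powr_mult powr_powr)
          finally have "mu_density \<beta> s * hardy_norm u (dirichlet_shift s a) powr v
              \<le> mu_density \<beta> s * (?B * (min s 1 powr (- ?x * (v - q)) * ?F s powr q))"
            using d by (intro mult_left_mono) auto
          also have "\<dots> = ?B * (mu_density \<beta> s * min s 1 powr (- ?x * (v - q)) * ?F s powr q)" by (simp only: mult_ac)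
          also have "\<dots> \<le> ?B * (?k * (mu_density \<alpha> s * ?F s powr q) + C powr q * ?N powr q * mu_density \<beta> s)"
          proof (rule mult_left_mono)
            show "mu_density \<beta> s * min s 1 powr (- ?x * (v - q)) * ?F s powr q
              \<le> ?k * (mu_density \<alpha> s * ?F s powr q) + C powr q * ?N powr q * mu_density \<beta> s"
            \<comment> \<open>Each summand of the majorant serves one range: near \<open>0\<close>
              the weights are exchanged, and beyond \<open>1\<close> the growth bound is a constant
              that is integrated against the target weight.\<close>
            proof (cases "s \<le> 1")
              case s1: True
              have "s powr \<beta> * s powr (- ?x * (v - q)) = s powr \<alpha>" unfolding powr_add[symmetric] e ..
              then have "mu_density \<beta> s * s powr (- ?x * (v - q)) = mu_const \<beta> * (s powr \<alpha> * exp (- 2 * s))"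
                unfolding mu_density_eq using True by simp
              also have "\<dots> = ?k * mu_density \<alpha> s"
                unfolding mu_density_eq using True mu_const_pos[OF al] by simp
              finally show ?thesis using s1 d by (simp add: min_def mult.assoc)
            next
              case s1: False
              have "?F s powr q \<le> (C * min s 1 powr (- ?x) * ?N) powr q" using F pos by (intro powr_mono2) auto
              also have "\<dots> = C powr q * ?N powr q" using s1 C by (simp add: powr_mult)
              finally have "mu_density \<beta> s * ?F s powr q \<le> mu_density \<beta> s * (C powr q * ?N powr q)"
                using d by (intro mult_left_mono) auto
              moreover have "0 \<le> ?k * (mu_density \<alpha> s * ?F s powr q)" using k d by (intro mult_nonneg_nonneg) auto
              ultimately show ?thesis using s1 by (simp add: min_def mult.commute)
            qed
          qed simp
          finally show ?thesis .
        qed (auto simp: mu_density_def)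
        then have "ennreal (mu_density \<beta> s * hardy_norm u (dirichlet_shift s a) powr v)
           \<le> ennreal (?B * (?k * (mu_density \<alpha> s * ?F s powr q) + C powr q * ?N powr q * mu_density \<beta> s))"
          by (rule ennreal_leI)
        then show "ennreal (mu_density \<beta> s) * ennreal (hardy_norm u (dirichlet_shift s a) powr v)
          \<le> ennreal ?B * (ennreal ?k * (ennreal (mu_density \<alpha> s) * ennreal (?F s powr q))
          + ennreal (C powr q * ?N powr q) * ennreal (mu_density \<beta> s))"
          using d k by (simp only: ennreal_mult ennreal_plus mult_nonneg_nonneg less_imp_le powr_ge_zero add_nonneg_nonneg)
      qed
      also have "\<dots> = ennreal ?B * (ennreal ?k * (\<integral>\<^sup>+\<sigma>. ennreal (mu_density \<alpha> \<sigma>) * ennreal (?F \<sigma> powr q) \<partial>lborel)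
          + ennreal (C powr q * ?N powr q) * (\<integral>\<^sup>+\<sigma>. ennreal (mu_density \<beta> \<sigma>) * 1 \<partial>lborel))"
        by (simp add: nn_integral_cmult nn_integral_add)
      also have "(\<integral>\<^sup>+\<sigma>. ennreal (mu_density \<alpha> \<sigma>) * ennreal (?F \<sigma> powr q) \<partial>lborel) = mixed_moment p q \<alpha> a"
        unfolding mixed_moment_def by (rule nn_integral_mu_measure[symmetric]) measurable
      also have "\<dots> = ennreal (?N powr q)" by (rule mixed_moment_eq[OF a pos(1,2) al])
      also have "(\<integral>\<^sup>+\<sigma>. ennreal (mu_density \<beta> \<sigma>) * 1 \<partial>lborel) = 1"
        by (subst nn_integral_mu_measure[symmetric]) (auto simp: emeasure_mu_measure_UNIV be)
      also have "ennreal ?B * (ennreal ?k * ennreal (?N powr q) + ennreal (C powr q * ?N powr q) * 1)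
          = ennreal (C powr (v - q) * (?k + C powr q) * ?N powr v)"
      proof -
        have nv: "?N powr v = ?N powr (v - q) * ?N powr q" by (simp add: powr_add[symmetric])
        have "ennreal ?B * (ennreal ?k * ennreal (?N powr q) + ennreal (C powr q * ?N powr q) * 1)
           = ennreal (?B * (?k * ?N powr q + C powr q * ?N powr q))"
          using k by (simp only: mult_1_right ennreal_mult[symmetric] ennreal_plus[symmetric] mult_nonneg_nonneg less_imp_le powr_ge_zero add_nonneg_nonneg)
        also have "?B * (?k * ?N powr q + C powr q * ?N powr q) = C powr (v - q) * (?k + C powr q) * ?N powr v"
          unfolding nv by (simp only: ring_distribs mult_ac)
        finally show ?thesis .
      qed
      finally show "mixed_moment u v \<beta> a \<le> ennreal (C powr (v - q) * (?k + C powr q) * ?N powr v)" .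
    qed
  qed
  then obtain D where D: "D > 0" "\<And>a. dirichlet_poly a \<Longrightarrow> mixed_moment u v \<beta> a \<le> ennreal (D * mixed_norm p q \<alpha> a powr v)"
    by blast
  show ?thesis
  proof (intro exI[of _ "D powr (1 / v)"] conjI allI impI)
    show "D powr (1 / v) > 0" using D by simp
    fix a :: "nat \<Rightarrow> complex" assume a: "dirichlet_poly a"
    have "D * mixed_norm p q \<alpha> a powr v = (D powr (1 / v) * mixed_norm p q \<alpha> a) powr v"
      using D(1) pos by (simp add: powr_mult powr_powr)
    then show "mixed_norm u v \<beta> a \<le> D powr (1 / v) * mixed_norm p q \<alpha> a"
      using D(2)[OF a] pos be a by (intro mixed_norm_leI) auto
  qed
qed

lemma dirichlet_poly_diff: "dirichlet_poly a \<Longrightarrow> dirichlet_poly b \<Longrightarrow> dirichlet_poly (\<lambda>n. a n - b n)"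
  unfolding dirichlet_poly_def by (auto intro: finite_subset[of _ "{n. a n \<noteq> 0} \<union> {n. b n \<noteq> 0}"])

text \<open>The same approximating polynomials serve in both spaces, since only the Cauchy condition
  refers to the norm.\<close>

lemma mixed_norm_space_mono:
  assumes pos: "0 < p" "0 < q" "0 < u" "0 < v" and al: "\<alpha> > -1" and be: "\<beta> > -1"
    and up: "u \<le> p"
    and cond: "(\<alpha> + 1) / q < (\<beta> + 1) / v \<or> (\<alpha> + 1) / q = (\<beta> + 1) / v \<and> q \<le> v"
  shows "mixed_norm_space p q \<alpha> \<subseteq> mixed_norm_space u v \<beta>"
proof -
  obtain C where C: "C > 0" "\<And>a. dirichlet_poly a \<Longrightarrow> mixed_norm u v \<beta> a \<le> C * mixed_norm p q \<alpha> a"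
    using mixed_norm_embedding[OF assms] by blast
  have "mixed_cauchy u v \<beta> P" if P: "\<And>k. dirichlet_poly (P k)" "mixed_cauchy p q \<alpha> P" for P
    unfolding mixed_cauchy_def
  proof (intro allI impI)
    fix \<epsilon> :: real assume e: "\<epsilon> > 0"
    then have "\<epsilon> / C > 0" using C by simp
    then obtain K where K: "\<And>k l. k \<ge> K \<Longrightarrow> l \<ge> K \<Longrightarrow> mixed_norm p q \<alpha> (\<lambda>n. P k n - P l n) < \<epsilon> / C"
      using P(2) unfolding mixed_cauchy_def by blast
    have "mixed_norm u v \<beta> (\<lambda>n. P k n - P l n) < \<epsilon>" if "k \<ge> K" "l \<ge> K" for k l
    proof -
      have "C * mixed_norm p q \<alpha> (\<lambda>n. P k n - P l n) < C * (\<epsilon> / C)"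
        using K[OF that] C by (intro mult_strict_left_mono) auto
      then show ?thesis using C(2)[OF dirichlet_poly_diff[OF P(1) P(1)], of k l] C(1) by simp
    qed
    then show "\<exists>K. \<forall>k\<ge>K. \<forall>l\<ge>K. mixed_norm u v \<beta> (\<lambda>n. P k n - P l n) < \<epsilon>" by blast
  qed
  then show ?thesis unfolding mixed_norm_space_def by blast
qed

section \<open>Coefficients and limits\<close>

lemma dirichlet_poly_add: "dirichlet_poly a \<Longrightarrow> dirichlet_poly b \<Longrightarrow> dirichlet_poly (\<lambda>n. a n + b n)"
  unfolding dirichlet_poly_def by (auto intro: finite_subset[of _ "{n. a n \<noteq> 0} \<union> {n. b n \<noteq> 0}"])

lemma bohr_lift_uminus: "bohr_lift (\<lambda>n. - a n) z = - bohr_lift a z"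
  by (simp add: bohr_lift_def sum_negf)

lemma hardy_norm_uminus: "hardy_norm p (\<lambda>n. - a n) = hardy_norm p a"
  by (simp add: hardy_norm_def bohr_lift_uminus)

lemma mixed_norm_uminus: "mixed_norm p q \<alpha> (\<lambda>n. - a n) = mixed_norm p q \<alpha> a"
proof -
  have "dirichlet_shift \<sigma> (\<lambda>n. - a n) = (\<lambda>n. - dirichlet_shift \<sigma> a n)" for \<sigma>
    by (simp add: dirichlet_shift_def fun_eq_iff)
  then show ?thesis by (simp add: mixed_norm_def hardy_norm_uminus)
qed

lemma powr_add_le:
  assumes "0 \<le> x" "0 \<le> (y::real)" "p > 0"
  shows "(x + y) powr p \<le> 2 powr p * (x powr p + y powr p)"
proof -
  have "(x + y) powr p \<le> (2 * max x y) powr p" using assms by (intro powr_mono2) auto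
  also have "\<dots> = 2 powr p * max x y powr p" using assms by (simp add: powr_mult)
  also have "\<dots> \<le> 2 powr p * (x powr p + y powr p)" by (intro mult_left_mono) (auto simp: max_def)
  finally show ?thesis .
qed

text \<open>One crude constant for all \<open>p\<close> and \<open>q\<close> avoids a distinction
  according to whether they lie below or above \<open>1\<close>. Only finiteness of the constant
  matters: geometric decay will later compensate for it.\<close>

lemma hardy_norm_add:
  assumes a: "dirichlet_poly a" and b: "dirichlet_poly b" and p: "p > 0" and q: "q > 0"
  shows "hardy_norm p (\<lambda>n. a n + b n) powr q
    \<le> 2 powr (q + q / p) * (hardy_norm p a powr q + hardy_norm p b powr q)"
proof -
  have "lift_moment p (\<lambda>n. a n + b n)
      \<le> (\<integral>\<^sup>+z. ennreal (2 powr p) * (ennreal (norm (bohr_lift a z) powr p) + ennreal (norm (bohr_lift b z) powr p)) \<partial>torus_haar)"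
    unfolding lift_moment_def
  proof (rule nn_integral_mono)
    fix z
    have "norm (bohr_lift (\<lambda>n. a n + b n) z) powr p \<le> (norm (bohr_lift a z) + norm (bohr_lift b z)) powr p"
      unfolding bohr_lift_add[OF a b] using p by (intro powr_mono2 norm_triangle_ineq) auto
    also have "\<dots> \<le> 2 powr p * (norm (bohr_lift a z) powr p + norm (bohr_lift b z) powr p)"
      using p by (intro powr_add_le) auto
    finally show "ennreal (norm (bohr_lift (\<lambda>n. a n + b n) z) powr p)
       \<le> ennreal (2 powr p) * (ennreal (norm (bohr_lift a z) powr p) + ennreal (norm (bohr_lift b z) powr p))"
      by (simp only: ennreal_leI ennreal_mult[symmetric] ennreal_plus[symmetric] powr_ge_zero add_nonneg_nonneg)
  qed
  also have "\<dots> = ennreal (2 powr p) * (lift_moment p a + lift_moment p b)"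
    unfolding lift_moment_def by (simp add: nn_integral_cmult nn_integral_add)
  finally have "hardy_norm p (\<lambda>n. a n + b n) powr p \<le> 2 powr p * (hardy_norm p a powr p + hardy_norm p b powr p)"
    unfolding lift_moment_eq_hardy_norm[OF p]
    by (simp only: ennreal_mult[symmetric] ennreal_plus[symmetric] powr_ge_zero add_nonneg_nonneg ennreal_le_iff mult_nonneg_nonneg)
  also have "\<dots> \<le> 2 powr p * (2 * max (hardy_norm p a) (hardy_norm p b) powr p)"
    using p by (intro mult_left_mono) (auto simp: max_def powr_le_iff_nonneg)
  finally have "(hardy_norm p (\<lambda>n. a n + b n) powr p) powr (q / p)
      \<le> (2 powr p * (2 * max (hardy_norm p a) (hardy_norm p b) powr p)) powr (q / p)"
    using p q by (intro powr_mono2) auto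
  then have "hardy_norm p (\<lambda>n. a n + b n) powr q \<le> 2 powr q * (2 powr (q / p) * max (hardy_norm p a) (hardy_norm p b) powr q)"
    using p by (simp add: powr_mult powr_powr le_max_iff_disj)
  also have "\<dots> \<le> 2 powr (q + q / p) * (hardy_norm p a powr q + hardy_norm p b powr q)"
    unfolding powr_add mult.assoc by (intro mult_left_mono) (auto simp: max_def)
  finally show ?thesis .
qed

lemma mixed_norm_add:
  assumes a: "dirichlet_poly a" and b: "dirichlet_poly b" and p: "p > 0" and q: "q > 0" and al: "\<alpha> > -1"
  shows "mixed_norm p q \<alpha> (\<lambda>n. a n + b n) powr q
    \<le> 2 powr (q + q / p) * (mixed_norm p q \<alpha> a powr q + mixed_norm p q \<alpha> b powr q)"
proof -
  let ?K = "2 powr (q + q / p) :: real"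
  have sh: "dirichlet_shift \<sigma> (\<lambda>n. a n + b n) = (\<lambda>n. dirichlet_shift \<sigma> a n + dirichlet_shift \<sigma> b n)" for \<sigma>
    by (simp add: dirichlet_shift_def ring_distribs fun_eq_iff)
  note m = hardy_norm_shift_measurable[OF a, of p] hardy_norm_shift_measurable[OF b, of p]
  have [measurable]: "(\<lambda>\<sigma>. hardy_norm p (dirichlet_shift \<sigma> a)) \<in> borel_measurable (mu_measure \<alpha>)"
      "(\<lambda>\<sigma>. hardy_norm p (dirichlet_shift \<sigma> b)) \<in> borel_measurable (mu_measure \<alpha>)"
    using m by (simp_all cong: measurable_cong_sets)
  have "mixed_moment p q \<alpha> (\<lambda>n. a n + b n) \<le> (\<integral>\<^sup>+\<sigma>. ennreal ?K *
      (ennreal (hardy_norm p (dirichlet_shift \<sigma> a) powr q) + ennreal (hardy_norm p (dirichlet_shift \<sigma> b) powr q)) \<partial>mu_measure \<alpha>)"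
    unfolding mixed_moment_def
  proof (rule nn_integral_mono)
    fix \<sigma>
    have "hardy_norm p (dirichlet_shift \<sigma> (\<lambda>n. a n + b n)) powr q
      \<le> ?K * (hardy_norm p (dirichlet_shift \<sigma> a) powr q + hardy_norm p (dirichlet_shift \<sigma> b) powr q)"
      unfolding sh using a b p q by (intro hardy_norm_add) auto
    then show "ennreal (hardy_norm p (dirichlet_shift \<sigma> (\<lambda>n. a n + b n)) powr q)
      \<le> ennreal ?K * (ennreal (hardy_norm p (dirichlet_shift \<sigma> a) powr q) + ennreal (hardy_norm p (dirichlet_shift \<sigma> b) powr q))"
      by (simp only: ennreal_leI ennreal_mult[symmetric] ennreal_plus[symmetric] powr_ge_zero add_nonneg_nonneg)
  qed
  also have "\<dots> = ennreal ?K * (mixed_moment p q \<alpha> a + mixed_moment p q \<alpha> b)"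
    unfolding mixed_moment_def by (simp add: nn_integral_cmult nn_integral_add)
  finally show ?thesis
    unfolding mixed_moment_eq[OF a p q al] mixed_moment_eq[OF b p q al] mixed_moment_eq[OF dirichlet_poly_add[OF a b] p q al]
    by (simp only: ennreal_mult[symmetric] ennreal_plus[symmetric] powr_ge_zero add_nonneg_nonneg ennreal_le_iff mult_nonneg_nonneg)
qed

lemma mixed_norm_smooth_part:
  assumes a: "dirichlet_poly a" and p: "p > 0" and q: "q > 0" and al: "\<alpha> > -1"
  shows "mixed_norm p q \<alpha> (smooth_part J a) \<le> mixed_norm p q \<alpha> a"
proof (rule mixed_norm_leI[OF dirichlet_poly_smooth_part[OF a] p q al])
  have "mixed_moment p q \<alpha> (smooth_part J a) \<le> mixed_moment p q \<alpha> a"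
    unfolding mixed_moment_def smooth_part_shift[symmetric]
    using a p q by (intro nn_integral_mono ennreal_leI powr_mono2 hardy_norm_smooth_part) auto
  then show "mixed_moment p q \<alpha> (smooth_part J a) \<le> ennreal (mixed_norm p q \<alpha> a powr q)"
    by (simp add: mixed_moment_eq[OF a p q al])
qed simp

text \<open>The polynomial coefficient bound is applied at shift \<open>1\<close>, where the mixed
  norm controls the Hardy norm. Undoing the shift multiplies by \<open>n\<close>.\<close>

lemma mixed_norm_coeff_bound:
  assumes p: "p > 0" and q: "q > 0" and al: "\<alpha> > -1"
  shows "\<exists>C>0. \<forall>a n. dirichlet_poly a \<longrightarrow> norm (a n) \<le> C * real n powr (2 + 2 / p) * mixed_norm p q \<alpha> a"
proof -
  obtain C where C: "C > 0" "\<And>a s. dirichlet_poly a \<Longrightarrow> s > 0 \<Longrightarrow>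
    hardy_norm p (dirichlet_shift s a) \<le> C * min s 1 powr (- ((\<alpha> + 1) / q)) * mixed_norm p q \<alpha> a"
    using hardy_norm_shift_le_mixed_norm[OF p q al] by blast
  show ?thesis
  proof (intro exI[of _ C] conjI allI impI)
    fix a :: "nat \<Rightarrow> complex" and n assume a: "dirichlet_poly a"
    show "norm (a n) \<le> C * real n powr (2 + 2 / p) * mixed_norm p q \<alpha> a"
    proof (cases "n = 0")
      case True
      then show ?thesis using a by (simp add: dirichlet_poly_def)
    next
      case False
      have "norm (a n) = real n * norm (dirichlet_shift 1 a n)"
        using False by (simp add: dirichlet_shift_def norm_mult norm_divide powr_minus_divide)
      also have "\<dots> \<le> real n * (real n powr (1 + 2 / p) * hardy_norm p (dirichlet_shift 1 a))"
        using a p False by (intro mult_left_mono hardy_coeff_bound_poly) auto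
      also have "\<dots> \<le> real n * (real n powr (1 + 2 / p) * (C * mixed_norm p q \<alpha> a))"
        using C(2)[OF a, of 1] by (intro mult_left_mono) auto
      also have "\<dots> = C * (real n powr 1 * real n powr (1 + 2 / p)) * mixed_norm p q \<alpha> a"
        by (simp add: mult_ac)
      also have "\<dots> = C * real n powr (2 + 2 / p) * mixed_norm p q \<alpha> a"
        unfolding powr_add[symmetric] by (simp add: add.assoc[symmetric])
      finally show ?thesis .
    qed
  qed (use C in auto)
qed

section \<open>Convergence of coefficients and of norms\<close>

lemma norm_of_nat_powr: "norm (of_nat n powr (- s)) = real n powr (- Re s)" for s :: complex
  by (simp add: norm_powr_real_powr)

lemma summable_nat_powr: "e > 1 \<Longrightarrow> summable (\<lambda>n. real n powr (- e))"
  by (simp add: summable_real_powr_iff)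

text \<open>The coefficients are recovered one after the other: multiply by \<open>n\<^sup>s\<close> and let \<open>s\<close> be large.\<close>

lemma coeff_tendsto_of_eval_tendsto:
  fixes R :: "nat \<Rightarrow> nat \<Rightarrow> complex"
  assumes D: "\<And>i n. norm (R i n) \<le> D * real n powr M" "\<And>n. norm (a n) \<le> D * real n powr M"
    and ev: "\<And>s. s > s0 \<Longrightarrow> (\<lambda>i. dirichlet_eval (R i) (of_real s)) \<longlonglongrightarrow> dirichlet_eval a (of_real s)"
  shows "(\<lambda>i. R i n) \<longlonglongrightarrow> a n"
proof (induction n rule: less_induct)
  case (less n)
  have D0: "D \<ge> 0" using D(2)[of 1] by (simp add: order_trans[OF norm_ge_zero])
  show ?case
  proof (cases "n = 0")
    case True
    have "R i 0 = 0" "a 0 = 0" for i using D(1)[of i 0] D(2)[of 0] by auto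
    then show ?thesis using True by simp
  next
    case False
    define Z where "Z = (\<Sum>m. real m powr (- 2))"
    have Zs: "summable (\<lambda>m. real m powr (- 2))" by (rule summable_nat_powr) simp
    have Z0: "Z \<ge> 0" unfolding Z_def by (rule suminf_nonneg[OF Zs]) simp
    define d where "d i m = R i m - a m" for i m
    have d: "norm (d i m) \<le> 2 * D * real m powr M" for i m
      using norm_triangle_ineq4[of "R i m" "a m"] D(1)[of i m] D(2)[of m] unfolding d_def by linarith
    \<comment> \<open>In \<open>s = M + 2 + t\<close>, the part \<open>M\<close> cancels the growth
      of the coefficients, \<open>2\<close> makes the series summable uniformly in \<open>i\<close>,
      and \<open>t\<close> is free. After multiplication by \<open>n powr s\<close> the three
      summands are the given convergence, the induction hypothesis, and a tail that becomes small
      with large \<open>t\<close>.\<close>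
    have main: "norm (d i n) \<le> real n powr s * norm (dirichlet_eval (R i) (of_real s) - dirichlet_eval a (of_real s))
          + real n powr s * (\<Sum>m<n. norm (d i m) * real m powr (- s))
          + real n powr s * (2 * D * (real (n + 1) powr (- t) * Z))"
      if s: "s = M + 2 + t" "t > 0" for i s t
    proof -
      let ?f = "\<lambda>m. d i m * of_nat m powr (- of_real s)"
      have nf: "norm (f m * of_nat m powr (- of_real s)) \<le> c * real m powr (-2)"
        if f: "norm (f m) \<le> c * real m powr M" and c: "c \<ge> 0" for f :: "nat \<Rightarrow> complex" and m c
      proof -
        have "norm (f m * of_nat m powr (- of_real s)) \<le> c * real m powr M * real m powr (- s)"
          unfolding norm_mult norm_of_nat_powr using f by (simp add: mult_right_mono)
        also have "\<dots> = c * real m powr (- 2 - t)" by (simp add: s mult.assoc powr_add[symmetric])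
        also have "\<dots> \<le> c * real m powr (- 2)"
          using s c by (cases "m = 0") (auto intro!: mult_left_mono powr_mono)
        finally show ?thesis .
      qed
      have sR: "summable (\<lambda>m. R i m * of_nat m powr (- of_real s))"
        by (rule summable_comparison_test'[OF summable_mult[OF Zs, of D]]) (rule nf[OF D(1) D0])
      have sa: "summable (\<lambda>m. a m * of_nat m powr (- of_real s))"
        by (rule summable_comparison_test'[OF summable_mult[OF Zs, of D]]) (rule nf[OF D(2) D0])
      have sf: "summable ?f" unfolding d_def left_diff_distrib by (rule summable_diff[OF sR sa])
      have "suminf ?f = dirichlet_eval (R i) (of_real s) - dirichlet_eval a (of_real s)"
        unfolding d_def left_diff_distrib dirichlet_eval_def by (rule suminf_diff[OF sR sa, symmetric])
      moreover have "suminf ?f = (\<Sum>m. ?f (m + (n + 1))) + (\<Sum>m<n. ?f m) + ?f n"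
        using suminf_split_initial_segment[OF sf, of "n + 1"] by simp
      ultimately have fn: "?f n = (dirichlet_eval (R i) (of_real s) - dirichlet_eval a (of_real s)) - (\<Sum>m<n. ?f m) - (\<Sum>m. ?f (m + (n + 1)))"
        by (simp add: algebra_simps)
      have tail: "norm (\<Sum>m. ?f (m + (n + 1))) \<le> 2 * D * (real (n + 1) powr (- t) * Z)"
      proof -
        have b: "norm (?f (m + (n + 1))) \<le> 2 * D * real (n + 1) powr (- t) * real (m + (n + 1)) powr (- 2)" for m
        proof -
          have "norm (?f (m + (n + 1))) \<le> 2 * D * real (m + (n+1)) powr M * real (m + (n+1)) powr (- s)"
            unfolding norm_mult norm_of_nat_powr using d[of i "m + (n+1)"] by (simp add: mult_right_mono)
          also have "M + - s = - t + (- 2)" using s by simp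
          then have "2 * D * real (m + (n+1)) powr M * real (m + (n+1)) powr (- s) = 2 * D * real (m + (n+1)) powr (- t + (- 2))"
            by (simp only: mult.assoc powr_add[symmetric])
          also have "\<dots> = 2 * D * (real (m + (n+1)) powr (- t) * real (m + (n+1)) powr (-2))" by (simp only: powr_add)
          also have "\<dots> \<le> 2 * D * (real (n + 1) powr (- t) * real (m + (n + 1)) powr (- 2))"
            using D0 s by (intro mult_left_mono mult_right_mono powr_mono2') auto
          finally show ?thesis by (simp only: mult.assoc)
        qed
        have Zs': "summable (\<lambda>m. real (m + (n + 1)) powr (- 2))" using summable_ignore_initial_segment[OF Zs, of "n + 1"] by simp
        have "norm (\<Sum>m. ?f (m + (n + 1))) \<le> (\<Sum>m. 2 * D * real (n + 1) powr (- t) * real (m + (n + 1)) powr (- 2))"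
          by (rule norm_suminf_le[OF b summable_mult[OF Zs']])
        also have "\<dots> = 2 * D * real (n + 1) powr (- t) * (\<Sum>m. real (m + (n + 1)) powr (- 2))"
          by (rule suminf_mult[OF Zs'])
        also have "\<dots> \<le> 2 * D * real (n + 1) powr (- t) * Z"
        proof (rule mult_left_mono)
          have "Z = (\<Sum>m. real (m + (n + 1)) powr (- 2)) + (\<Sum>m<n+1. real m powr (- 2))"
            unfolding Z_def by (rule suminf_split_initial_segment[OF Zs])
          moreover have "0 \<le> (\<Sum>m<n+1. real m powr (- 2))" by (rule sum_nonneg) simp
          ultimately show "(\<Sum>m. real (m + (n + 1)) powr (- 2)) \<le> Z" by linarith
        qed (use D0 in auto)
        finally show ?thesis by (simp only: mult.assoc)
      qed
      have "norm (?f n) \<le> norm (dirichlet_eval (R i) (of_real s) - dirichlet_eval a (of_real s)) + norm (\<Sum>m<n. ?f m) + norm (\<Sum>m. ?f (m + (n + 1)))"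
        unfolding fn by (meson norm_triangle_ineq4 order_trans add_right_mono)
      also have "norm (\<Sum>m<n. ?f m) \<le> (\<Sum>m<n. norm (d i m) * real m powr (- s))"
        by (rule order_trans[OF norm_sum]) (simp add: norm_mult norm_of_nat_powr)
      finally have "norm (?f n) \<le> norm (dirichlet_eval (R i) (of_real s) - dirichlet_eval a (of_real s))
          + (\<Sum>m<n. norm (d i m) * real m powr (- s)) + 2 * D * (real (n + 1) powr (- t) * Z)"
        using tail by linarith
      then have "real n powr s * norm (?f n) \<le> real n powr s * (norm (dirichlet_eval (R i) (of_real s) - dirichlet_eval a (of_real s))
          + (\<Sum>m<n. norm (d i m) * real m powr (- s)) + 2 * D * (real (n + 1) powr (- t) * Z))"
        by (rule mult_left_mono) simp
      moreover have "real n powr s * norm (?f n) = norm (d i n)"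
      proof -
        have "real n powr s * real n powr (- s) = 1" using False by (simp add: powr_add[symmetric])
        then show ?thesis by (simp add: norm_mult norm_of_nat_powr mult.left_commute)
      qed
      ultimately show ?thesis by (simp only: ring_distribs)
    qed
    have "(\<lambda>i. d i n) \<longlonglongrightarrow> 0"
    proof (rule LIMSEQ_I)
      fix \<epsilon> :: real assume e: "\<epsilon> > 0"
      \<comment> \<open>The tail begins at \<open>n + 1\<close>, so relative to the term
        \<open>n\<close> it decays like \<open>?q ^ k\<close> when \<open>t = real k\<close>. First
        \<open>k\<close> is fixed by the tail, and only then is \<open>i\<close> taken
        large.\<close>
      let ?q = "real n / real (n + 1)"
      have "(\<lambda>k. real n powr (M + 2) * (2 * D * Z) * ?q ^ k) \<longlonglongrightarrow> real n powr (M + 2) * (2 * D * Z) * 0"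
        by (intro tendsto_intros LIMSEQ_realpow_zero) (auto simp: divide_simps)
      then have "\<forall>\<^sub>F k in sequentially. real n powr (M + 2) * (2 * D * Z) * ?q ^ k < \<epsilon> / 2"
        using e by (intro order_tendstoD(2)[where y = "real n powr (M + 2) * (2 * D * Z) * 0"]) auto
      moreover have "\<forall>\<^sub>F k in sequentially. real k > max 0 (s0 - M - 2)"
        using filterlim_real_sequentially unfolding filterlim_at_top_dense by blast
      ultimately have "\<forall>\<^sub>F k in sequentially. real n powr (M + 2) * (2 * D * Z) * ?q ^ k < \<epsilon> / 2 \<and> real k > max 0 (s0 - M - 2)"
        by (rule eventually_conj)
      then obtain k where k: "real n powr (M + 2) * (2 * D * Z) * ?q ^ k < \<epsilon> / 2" "real k > max 0 (s0 - M - 2)"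
        unfolding eventually_sequentially by blast
      define t where "t = real k"
      define s where "s = M + 2 + t"
      have t: "t > 0" "s > s0" using k(2) by (auto simp: t_def s_def)
      have "real n powr s * (2 * D * (real (n + 1) powr (- t) * Z)) = real n powr (M + 2) * (2 * D * Z) * ?q ^ k"
        using False unfolding s_def t_def by (simp add: powr_add powr_realpow powr_minus_divide power_divide)
      with k have small: "real n powr s * (2 * D * (real (n + 1) powr (- t) * Z)) < \<epsilon> / 2" by linarith
      have "(\<lambda>i. real n powr s * norm (dirichlet_eval (R i) (of_real s) - dirichlet_eval a (of_real s))
          + real n powr s * (\<Sum>m<n. norm (d i m) * real m powr (- s))) \<longlonglongrightarrow> real n powr s * norm (0::complex) + real n powr s * (\<Sum>m<n. norm (0::complex) * real m powr (- s))"
        using ev[OF t(2)] less.IH unfolding d_def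
        by (intro tendsto_intros) (auto intro: LIM_zero)
      then have "\<forall>\<^sub>F i in sequentially. real n powr s * norm (dirichlet_eval (R i) (of_real s) - dirichlet_eval a (of_real s))
          + real n powr s * (\<Sum>m<n. norm (d i m) * real m powr (- s)) < \<epsilon> / 2"
        using e by (intro order_tendstoD(2)) auto
      then obtain N where N: "\<And>i. i \<ge> N \<Longrightarrow> real n powr s * norm (dirichlet_eval (R i) (of_real s) - dirichlet_eval a (of_real s))
          + real n powr s * (\<Sum>m<n. norm (d i m) * real m powr (- s)) < \<epsilon> / 2"
        unfolding eventually_sequentially by blast
      show "\<exists>N. \<forall>i\<ge>N. norm (d i n - 0) < \<epsilon>"
      proof (intro exI[of _ N] allI impI)
        fix i assume "i \<ge> N"
        then show "norm (d i n - 0) < \<epsilon>" using N[of i] main[OF s_def t(1), of i] small by simp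
      qed
    qed
    then show ?thesis unfolding d_def by (rule LIM_zero_cancel)
  qed
qed

text \<open>A finite Euler product: over the primes in \<open>J\<close> alone the series converges
  for every \<open>\<tau> > 0\<close>, as it is dominated by a product of geometric series.\<close>

lemma summable_smooth_powr:
  assumes J: "finite J" and t: "\<tau> > 0"
  shows "summable (\<lambda>n. if n > 0 \<and> (\<forall>j. prime_exponent n j \<noteq> 0 \<longrightarrow> j \<in> J) then real n powr (- \<tau>) else 0)"
    (is "summable ?f")
proof (rule summableI_nonneg_bounded)
  fix N
  let ?S = "{n. n < N \<and> n > 0 \<and> (\<forall>j. prime_exponent n j \<noteq> 0 \<longrightarrow> j \<in> J)}"
  let ?r = "\<lambda>j. real (nth_prime j) powr (- \<tau>)"
  let ?e = "\<lambda>n. restrict (prime_exponent n) J"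
  have r: "0 < ?r j" "?r j < 1" for j
    using nth_prime_ge_2[of j] t powr_less_one[of "real (nth_prime j)" "- \<tau>"] by auto
  \<comment> \<open>A crude bound on exponents. It places the exponent vectors of all
    \<open>n < N\<close> in a finite box, over which the sum factorises.\<close>
  have lt: "prime_exponent n j < N" if "n < N" "n > 0" for n j
  proof -
    have "nth_prime j ^ prime_exponent n j dvd n" unfolding prime_exponent_def by (rule multiplicity_dvd)
    then have "nth_prime j ^ prime_exponent n j \<le> n" using that by (intro dvd_imp_le)
    moreover have "prime_exponent n j < nth_prime j ^ prime_exponent n j"
      using nth_prime_ge_2[of j] by (intro power_gt_expt) auto
    ultimately show ?thesis using that by linarith
  qed
  have inj: "inj_on ?e ?S"
  proof (rule inj_onI)
    fix m n assume m: "m \<in> ?S" and n: "n \<in> ?S" and eq: "?e m = ?e n"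
    have pe: "prime_exponent m j = prime_exponent n j" for j
    proof (cases "j \<in> J")
      case True
      then show ?thesis using fun_cong[OF eq, of j] by simp
    next
      case False
      then have "prime_exponent m j = 0" "prime_exponent n j = 0" using m n by blast+
      then show ?thesis by simp
    qed
    have "m > 0" "n > 0" using m n by auto
    then show "m = n" using pe by (rule prime_exponent_eqI)
  qed
  have "(\<Sum>n<N. ?f n) = (\<Sum>n\<in>?S. real n powr (- \<tau>))"
    by (rule sum.mono_neutral_cong_right) auto
  also have "\<dots> = (\<Sum>n\<in>?S. \<Prod>j\<in>J. ?r j ^ ?e n j)"
  proof (rule sum.cong)
    fix n assume "n \<in> ?S"
    then show "real n powr (- \<tau>) = (\<Prod>j\<in>J. ?r j ^ ?e n j)"
      using powr_prod_nth_prime[of n J "- \<tau>"] J by auto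
  qed simp
  also have "\<dots> = (\<Sum>g\<in>?e ` ?S. \<Prod>j\<in>J. ?r j ^ g j)"
    by (subst sum.reindex[OF inj]) simp
  also have "\<dots> \<le> (\<Sum>g\<in>PiE J (\<lambda>_. {..<N}). \<Prod>j\<in>J. ?r j ^ g j)"
    using lt J by (intro sum_mono2 finite_PiE) (auto intro!: prod_nonneg)
  also have "\<dots> = (\<Prod>j\<in>J. \<Sum>k<N. ?r j ^ k)"
    using J by (intro prod_sum_PiE[symmetric]) auto
  also have "\<dots> \<le> (\<Prod>j\<in>J. 1 / (1 - ?r j))"
  proof (rule prod_mono)
    fix j
    have "(\<Sum>k<N. ?r j ^ k) = (1 - ?r j ^ N) / (1 - ?r j)" using r[of j] by (simp add: sum_gp_strict)
    also have "\<dots> \<le> 1 / (1 - ?r j)" using r[of j] by (intro divide_right_mono) auto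
    finally show "0 \<le> (\<Sum>k<N. ?r j ^ k) \<and> (\<Sum>k<N. ?r j ^ k) \<le> 1 / (1 - ?r j)"
      by (auto intro!: sum_nonneg)
  qed
  finally show "(\<Sum>n<N. ?f n) \<le> (\<Prod>j\<in>J. 1 / (1 - ?r j))" .
qed simp

text \<open>A common index set for polynomials with different supports, as Tannery's theorem
  requires.\<close>

lemma bohr_lift_suminf:
  assumes "dirichlet_poly a"
  shows "bohr_lift a z = (\<Sum>n. a n * prime_monomial n z)"
  unfolding bohr_lift_def using assms
  by (intro suminf_finite[symmetric]) (auto simp: dirichlet_poly_def)

text \<open>Over a fixed finite set of primes, bounded mixed norms give a summable majorant for the
  coefficients at each positive shift. So coefficientwise convergence becomes dominated convergence
  of the lifts, the Hardy norms converge at every \<open>\<sigma> > 0\<close>, and Fatou's lemma in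
  \<open>\<sigma>\<close> concludes.\<close>

lemma mixed_norm_fatou:
  assumes J: "finite J" and R: "\<And>i. dirichlet_poly (R i)" "\<And>i. smooth_part J (R i) = R i"
    and B: "\<And>i. mixed_norm p q \<alpha> (R i) \<le> B"
    and a: "dirichlet_poly a" and lim: "\<And>n. (\<lambda>i. R i n) \<longlonglongrightarrow> a n"
    and p: "p > 0" and q: "q > 0" and al: "\<alpha> > -1"
  shows "mixed_norm p q \<alpha> a \<le> B"
proof -
  have B0: "B \<ge> 0" using B[of 0] by (rule order_trans[rotated]) simp
  obtain C where C: "C > 0" "\<And>a s. dirichlet_poly a \<Longrightarrow> s > 0 \<Longrightarrow>
    hardy_norm p (dirichlet_shift s a) \<le> C * min s 1 powr (- ((\<alpha> + 1) / q)) * mixed_norm p q \<alpha> a"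
    using hardy_norm_shift_le_mixed_norm[OF p q al] by blast
  have conv: "(\<lambda>i. hardy_norm p (dirichlet_shift s (R i))) \<longlonglongrightarrow> hardy_norm p (dirichlet_shift s a)" if s: "s > 0" for s
  proof -
    \<comment> \<open>The budget of the shift \<open>s\<close>: one half brings the Hardy norm under
      the growth bound; of the other half, the coefficient bound with
      \<open>\<delta> = s / 4\<close> consumes half, and the remaining
      \<open>n powr (- (s / 4))\<close> is summable over the primes in \<open>J\<close>. The power
      \<open>card J\<close> bounds the price per prime divisor.\<close>
    let ?A = "coeff_const p (s / 4) ^ card J * (C * min (s / 2) 1 powr (- ((\<alpha> + 1) / q)) * B)"
    define M where "M n = ?A * (if n > 0 \<and> (\<forall>j. prime_exponent n j \<noteq> 0 \<longrightarrow> j \<in> J) then real n powr (- (s / 4)) else 0)" for n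
    have A0: "?A \<ge> 0" using C B0 coeff_const_ge_1[OF p, of "s / 4"] s by auto
    have Ms: "summable M" unfolding M_def using s by (intro summable_mult summable_smooth_powr J) auto
    have M0: "M n \<ge> 0" for n unfolding M_def by (rule mult_nonneg_nonneg[OF A0]) auto
    have bound: "norm (dirichlet_shift s (R i) n) \<le> M n" for i n
    proof (cases "R i n = 0")
      case True
      then show ?thesis using M0 by (simp add: dirichlet_shift_def)
    next
      case False
      have n: "n > 0" using dirichlet_poly_pos[OF R(1) False] .
      have sm: "\<forall>j. prime_exponent n j \<noteq> 0 \<longrightarrow> j \<in> J"
        using False fun_cong[OF R(2), of i n] unfolding smooth_part_def by metis
      have "norm (dirichlet_shift (s / 2) (R i) n)
          \<le> coeff_const p (s / 4) ^ card {j. prime_exponent n j \<noteq> 0} * real n powr (s / 4) * hardy_norm p (dirichlet_shift (s / 2) (R i))"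
        using s R p n by (intro hardy_coeff_bound) auto
      also have "\<dots> \<le> coeff_const p (s / 4) ^ card J * real n powr (s / 4) * (C * min (s / 2) 1 powr (- ((\<alpha> + 1) / q)) * B)"
      proof (intro mult_mono)
        show "coeff_const p (s / 4) ^ card {j. prime_exponent n j \<noteq> 0} \<le> coeff_const p (s / 4) ^ card J"
          using sm J s coeff_const_ge_1[OF p, of "s / 4"] by (intro power_increasing card_mono) auto
        have "hardy_norm p (dirichlet_shift (s / 2) (R i)) \<le> C * min (s / 2) 1 powr (- ((\<alpha> + 1) / q)) * mixed_norm p q \<alpha> (R i)"
          using s by (intro C R) auto
        also have "\<dots> \<le> C * min (s / 2) 1 powr (- ((\<alpha> + 1) / q)) * B"
          using C by (intro mult_left_mono B) auto
        finally show "hardy_norm p (dirichlet_shift (s / 2) (R i)) \<le> C * min (s / 2) 1 powr (- ((\<alpha> + 1) / q)) * B" .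
      qed (use s coeff_const_ge_1[OF p, of "s / 4"] in auto)
      finally have *: "norm (dirichlet_shift (s / 2) (R i) n) \<le> ?A * real n powr (s / 4)" by (simp only: mult_ac)
      have "norm (dirichlet_shift s (R i) n) = norm (dirichlet_shift (s / 2) (R i) n) * real n powr (- (s / 2))"
        by (simp add: dirichlet_shift_def norm_mult mult.assoc powr_add[symmetric])
      also have "\<dots> \<le> ?A * real n powr (s / 4) * real n powr (- (s / 2))"
        by (intro mult_right_mono *) auto
      also have "\<dots> = M n" unfolding M_def using n sm by (simp add: mult.assoc powr_add[symmetric])
      finally show ?thesis .
    qed
    have ptw: "(\<lambda>i. bohr_lift (dirichlet_shift s (R i)) z) \<longlonglongrightarrow> bohr_lift (dirichlet_shift s a) z"
      and bd: "norm (bohr_lift (dirichlet_shift s (R i)) z) \<le> suminf M" if z: "z \<in> space torus_haar" for z i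
    proof -
      have nm: "norm (dirichlet_shift s (R i) n * prime_monomial n z) \<le> M n" for i n
        using bound[of i n] by (simp add: norm_mult norm_prime_monomial[OF z])
      show "norm (bohr_lift (dirichlet_shift s (R i)) z) \<le> suminf M"
        unfolding bohr_lift_suminf[OF dirichlet_poly_shift[OF R(1)]] by (rule norm_suminf_le[OF nm Ms])
      have "(\<lambda>i. \<Sum>n. dirichlet_shift s (R i) n * prime_monomial n z) \<longlonglongrightarrow> (\<Sum>n. dirichlet_shift s a n * prime_monomial n z)"
      proof (rule tannerys_theorem[THEN conjunct2, THEN conjunct2])
        show "(\<lambda>i. dirichlet_shift s (R i) n * prime_monomial n z) \<longlonglongrightarrow> dirichlet_shift s a n * prime_monomial n z" for n
          unfolding dirichlet_shift_def by (intro tendsto_intros lim)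
      qed (use nm Ms in \<open>auto simp: case_prod_unfold\<close>)
      then show "(\<lambda>i. bohr_lift (dirichlet_shift s (R i)) z) \<longlonglongrightarrow> bohr_lift (dirichlet_shift s a) z"
        by (simp only: bohr_lift_suminf dirichlet_poly_shift R(1) a)
    qed
    interpret T: prob_space torus_haar by (rule prob_space_torus_haar)
    have "(\<lambda>i. \<integral>z. norm (bohr_lift (dirichlet_shift s (R i)) z) powr p \<partial>torus_haar)
        \<longlonglongrightarrow> (\<integral>z. norm (bohr_lift (dirichlet_shift s a) z) powr p \<partial>torus_haar)"
    proof (rule integral_dominated_convergence[where w = "\<lambda>_. suminf M powr p"])
      show "AE z in torus_haar. (\<lambda>i. norm (bohr_lift (dirichlet_shift s (R i)) z) powr p) \<longlonglongrightarrow> norm (bohr_lift (dirichlet_shift s a) z) powr p"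
        using p by (intro AE_I2 tendsto_powr' tendsto_norm ptw tendsto_const) auto
      show "AE z in torus_haar. norm (norm (bohr_lift (dirichlet_shift s (R i)) z) powr p) \<le> suminf M powr p" for i
        using p bd by (intro AE_I2) (auto intro!: powr_mono2)
    qed auto
    then show ?thesis
      unfolding hardy_norm_def using p by (intro tendsto_powr' tendsto_const) (auto intro!: integral_nonneg_AE always_eventually)
  qed
  have "mixed_moment p q \<alpha> a = (\<integral>\<^sup>+\<sigma>. liminf (\<lambda>i. ennreal (hardy_norm p (dirichlet_shift \<sigma> (R i)) powr q)) \<partial>mu_measure \<alpha>)"
    unfolding mixed_moment_def
  proof (rule nn_integral_cong_AE)
    show "AE \<sigma> in mu_measure \<alpha>. ennreal (hardy_norm p (dirichlet_shift \<sigma> a) powr q)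
        = liminf (\<lambda>i. ennreal (hardy_norm p (dirichlet_shift \<sigma> (R i)) powr q))"
      using AE_mu_measure_pos
    proof eventually_elim
      fix s :: real assume "s > 0"
      then have "(\<lambda>i. ennreal (hardy_norm p (dirichlet_shift s (R i)) powr q)) \<longlonglongrightarrow> ennreal (hardy_norm p (dirichlet_shift s a) powr q)"
        using q by (intro tendsto_ennrealI tendsto_powr' conv tendsto_const) auto
      then show "ennreal (hardy_norm p (dirichlet_shift s a) powr q) = liminf (\<lambda>i. ennreal (hardy_norm p (dirichlet_shift s (R i)) powr q))"
        by (intro lim_imp_Liminf[symmetric]) auto
    qed
  qed
  also have "\<dots> \<le> liminf (\<lambda>i. mixed_moment p q \<alpha> (R i))"
  proof -
    have [measurable]: "(\<lambda>\<sigma>. hardy_norm p (dirichlet_shift \<sigma> (R i))) \<in> borel_measurable (mu_measure \<alpha>)" for i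
      using hardy_norm_shift_measurable[OF R(1)] by (simp cong: measurable_cong_sets)
    show ?thesis unfolding mixed_moment_def by (rule nn_integral_liminf) measurable
  qed
  also have "\<dots> \<le> liminf (\<lambda>i. ennreal (B powr q))"
    using B q by (intro Liminf_mono always_eventually) (auto simp: mixed_moment_eq[OF R(1) p q al] intro!: ennreal_leI powr_mono2)
  also have "\<dots> = ennreal (B powr q)" by (simp add: Liminf_const)
  finally show ?thesis by (rule mixed_norm_leI[OF a p q al B0])
qed

section \<open>A gliding hump\<close>

lemma tendsto_if_const:
  "(f \<longlongrightarrow> l) F \<Longrightarrow> ((\<lambda>i. if c then f i else 0) \<longlongrightarrow> (if c then l else 0)) F"
  by simp

lemma dirichlet_poly_sum:
  assumes "finite A" "\<And>k. k \<in> A \<Longrightarrow> dirichlet_poly (Q k)"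
  shows "dirichlet_poly (\<lambda>n. \<Sum>k\<in>A. Q k n)"
  using assms
proof (induction A rule: finite_induct)
  case (insert x A)
  then show ?case by (simp add: dirichlet_poly_add)
qed (simp add: dirichlet_poly_def)

lemma mixed_cauchy_bounded:
  assumes P: "\<And>k. dirichlet_poly (P k)" and c: "mixed_cauchy p q \<alpha> P" and p: "p > 0" and q: "q > 0" and al: "\<alpha> > -1"
  shows "\<exists>B. \<forall>k. mixed_norm p q \<alpha> (P k) \<le> B"
proof -
  obtain K where K: "\<And>k. k \<ge> K \<Longrightarrow> mixed_norm p q \<alpha> (\<lambda>n. P k n - P K n) < 1"
    using c unfolding mixed_cauchy_def by (metis order_refl zero_less_one)
  let ?C = "2 powr (q + q / p) * (1 + mixed_norm p q \<alpha> (P K) powr q)"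
  have C0: "?C \<ge> 0" by (intro mult_nonneg_nonneg) auto
  have big: "mixed_norm p q \<alpha> (P k) \<le> ?C powr (1 / q)" if "k \<ge> K" for k
  proof -
    have "mixed_norm p q \<alpha> (\<lambda>n. (P k n - P K n) + P K n) powr q
        \<le> 2 powr (q + q / p) * (mixed_norm p q \<alpha> (\<lambda>n. P k n - P K n) powr q + mixed_norm p q \<alpha> (P K) powr q)"
      by (rule mixed_norm_add[OF dirichlet_poly_diff[OF P P] P p q al])
    also have "\<dots> \<le> ?C"
      using K[OF that] q powr_mono2[of q "mixed_norm p q \<alpha> (\<lambda>n. P k n - P K n)" 1] by (intro mult_left_mono) auto
    finally have "mixed_norm p q \<alpha> (P k) powr q \<le> ?C" by simp
    then have "mixed_norm p q \<alpha> (P k) powr q \<le> (?C powr (1 / q)) powr q" using q C0 by (simp add: powr_powr)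
    then show ?thesis using q by (subst (asm) powr_le_iff_nonneg) auto
  qed
  define B where "B = Max (insert (?C powr (1 / q)) ((\<lambda>k. mixed_norm p q \<alpha> (P k)) ` {..<K}))"
  have "mixed_norm p q \<alpha> (P k) \<le> B" for k
  proof (cases "k \<ge> K")
    case True
    have "?C powr (1 / q) \<le> B" unfolding B_def by (intro Max_ge) auto
    then show ?thesis using big[OF True] by linarith
  next
    case False
    then show ?thesis unfolding B_def by (intro Max_ge) auto
  qed
  then show ?thesis by blast
qed

text \<open>A gliding hump: the blocks \<open>Q k\<close> live on disjoint sets of primes, so that each of them is recovered from
  the sum by setting the other variables to \<open>0\<close>.\<close>

lemma gliding_hump:
  assumes pos: "0 < p" "0 < q" "0 < u" "0 < v" and al: "\<alpha> > -1" and be: "\<beta> > -1"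
    and H: "\<And>\<epsilon> j. \<epsilon> > 0 \<Longrightarrow> \<exists>Q. dirichlet_poly Q \<and> Q 1 = 0 \<and> prime_support Q \<subseteq> {j..} \<and>
      mixed_norm p q \<alpha> Q powr q \<le> \<epsilon> \<and> (\<Sum>n | Q n \<noteq> 0. norm (Q n) * real n powr (- (1 / 2))) \<le> \<epsilon> \<and>
      1 / \<epsilon> \<le> mixed_norm u v \<beta> Q"
  shows "\<not> mixed_norm_space p q \<alpha> \<subseteq> mixed_norm_space u v \<beta>"
proof -
  define K0 where "K0 = (2::real) powr (q + q / p)"
  have K0: "K0 \<ge> 1" unfolding K0_def using pos by (intro ge_one_powr_ge_zero) auto
  \<comment> \<open>With this ratio \<open>K0 * (d ^ Suc K + d ^ Suc K) = d ^ K\<close>: the decay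
    of the blocks pays for the quasi-triangle constant at every step of summing a tail.\<close>
  define d where "d = 1 / (2 * K0)"
  have d: "0 < d" "d \<le> 1 / 2" "K0 * (2 * d) = 1" using K0 by (auto simp: d_def field_simps)
  \<comment> \<open>The bound \<open>M\<close> records where the primes of a block end, so that the
    next block can start there.\<close>
  define good where "good \<epsilon> j Q M \<longleftrightarrow> dirichlet_poly Q \<and> Q 1 = 0 \<and> prime_support Q \<subseteq> {j..<M} \<and> j < M \<and>
      mixed_norm p q \<alpha> Q powr q \<le> \<epsilon> \<and> (\<Sum>n | Q n \<noteq> 0. norm (Q n) * real n powr (- (1 / 2))) \<le> \<epsilon> \<and>
      1 / \<epsilon> \<le> mixed_norm u v \<beta> Q" for \<epsilon> j Q M
  have "\<exists>Q M. good \<epsilon> j Q M" if \<epsilon>0: "\<epsilon> > 0" for \<epsilon> j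
  proof -
    obtain Q where Q: "dirichlet_poly Q" "Q 1 = 0" "prime_support Q \<subseteq> {j..}"
      "mixed_norm p q \<alpha> Q powr q \<le> \<epsilon>" "(\<Sum>n | Q n \<noteq> 0. norm (Q n) * real n powr (- (1 / 2))) \<le> \<epsilon>"
      "1 / \<epsilon> \<le> mixed_norm u v \<beta> Q"
      using H[OF \<epsilon>0, of j] by blast
    let ?M = "Suc (Max (insert j (prime_support Q)))"
    have f: "finite (insert j (prime_support Q))" using finite_prime_support[OF Q(1)] by simp
    have "prime_support Q \<subseteq> {j..<?M}"
      using Q(3) Max_ge[OF f] by (auto simp: less_Suc_eq_le)
    moreover have "j < ?M" using Max_ge[OF f, of j] by simp
    ultimately show ?thesis using Q unfolding good_def by blast
  qed
  then obtain Qf Mf where QM: "\<And>\<epsilon> j. \<epsilon> > 0 \<Longrightarrow> good \<epsilon> j (Qf \<epsilon> j) (Mf \<epsilon> j)" by metis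
  define e where "e k = d ^ Suc k" for k
  have e: "e k > 0" for k using d by (simp add: e_def)
  define J where "J = rec_nat 0 (\<lambda>k j. Mf (e k) j)"
  have JS: "J (Suc k) = Mf (e k) (J k)" for k by (simp add: J_def)
  define Q where "Q k = Qf (e k) (J k)" for k
  have good: "good (e k) (J k) (Q k) (J (Suc k))" for k unfolding Q_def JS by (rule QM[OF e])
  have Qp: "dirichlet_poly (Q k)" and Q1: "Q k 1 = 0" and Qs: "prime_support (Q k) \<subseteq> {J k..<J (Suc k)}"
    and JSuc: "J k < J (Suc k)" and Qn: "mixed_norm p q \<alpha> (Q k) powr q \<le> e k"
    and Qc: "(\<Sum>n | Q k n \<noteq> 0. norm (Q k n) * real n powr (- (1 / 2))) \<le> e k"
    and Qb: "1 / e k \<le> mixed_norm u v \<beta> (Q k)" for k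
    using good[of k] unfolding good_def by auto
  have mJ: "strict_mono J" using JSuc by (simp add: strict_mono_Suc_iff)
  have Jk: "k \<le> J k" for k by (rule strict_mono_imp_increasing[OF mJ])
  \<comment> \<open>This is where \<open>Q k 1 = 0\<close> enters: \<open>1\<close> is the only
    positive integer without prime divisors, and it could otherwise lie in several blocks.\<close>
  have exj: "\<exists>j. prime_exponent n j \<noteq> 0 \<and> j \<in> {J k..<J (Suc k)}" if "Q k n \<noteq> 0" for k n
  proof -
    have n: "n > 0" using dirichlet_poly_pos[OF Qp[of k], of n] that by simp
    have n1: "n \<noteq> 1" proof
      assume "n = 1"
      with that have "Q k 1 \<noteq> 0" by (simp only: simp_thms)
      then show False using Q1[of k] by contradiction
    qed
    have "\<exists>j. prime_exponent n j \<noteq> 0"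
    proof (rule ccontr)
      assume "\<nexists>j. prime_exponent n j \<noteq> 0"
      then have "prime_exponent n j = prime_exponent 1 j" for j by simp
      then have "n = 1" using n by (intro prime_exponent_eqI[of n 1]) simp_all
      then show False using n1 by simp
    qed
    then obtain j where j: "prime_exponent n j \<noteq> 0" by blast
    then have "j \<in> prime_support (Q k)" using prime_supportI[of "Q k" n, OF that j] by simp
    then show ?thesis using j Qs[of k] by blast
  qed
  \<comment> \<open>The \<open>k\<close>-th block begins at a prime index at least \<open>k\<close>
    and so contains no \<open>n < k\<close>. Hence the infinite sum of blocks is finite at each
    \<open>n\<close>, and the sum over \<open>k \<le> n\<close> below already is all of it.\<close>
  have Q0: "Q k n = 0" if "n < k" for k n
  proof (rule ccontr)
    assume nz: "Q k n \<noteq> 0"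
    obtain j where j: "prime_exponent n j \<noteq> 0" "j \<ge> J k" using exj[OF nz] by auto
    have "k \<le> j" using Jk[of k] j by simp
    also have "j \<le> nth_prime j" by (rule strict_mono_imp_increasing[OF strict_mono_nth_prime])
    also have "\<dots> \<le> n" using nth_prime_dvd[OF j(1)] dirichlet_poly_pos[OF Qp[of k], of n, OF nz] by (rule dvd_imp_le)
    finally show False using that by simp
  qed
  define a where "a n = (\<Sum>k\<le>n. Q k n)" for n
  have a_eq: "a n = (\<Sum>k<L. Q k n)" if "n < L" for n L
    unfolding a_def by (rule sum.mono_neutral_left) (use that Q0 in auto)
  define P where "P K n = (\<Sum>k<K. Q k n)" for K n
  have Pp: "dirichlet_poly (P K)" for K unfolding P_def[abs_def] using Qp by (intro dirichlet_poly_sum) auto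
  define T where "T K L n = (\<Sum>k\<in>{K..<L}. Q k n)" for K L n
  have Tp: "dirichlet_poly (T K L)" for K L unfolding T_def[abs_def] using Qp by (intro dirichlet_poly_sum) auto
  have PT: "P L n - P K n = T K L n" if "K \<le> L" for K L n
  proof -
    have "P L n = P K n + T K L n"
      unfolding P_def T_def lessThan_atLeast0 using that by (subst sum.atLeastLessThan_concat) auto
    then show ?thesis by simp
  qed
  \<comment> \<open>The first block is split off, not the last: the factor \<open>K0\<close> is then
    met once per level and absorbed in passing from \<open>d ^ Suc K\<close> to
    \<open>d ^ K\<close>, so the bound does not depend on \<open>m\<close>.\<close>
  have Tn: "mixed_norm p q \<alpha> (T K (K + m)) powr q \<le> d ^ K" for K m
  proof (induction m arbitrary: K)
    case 0
    have "T K K = (\<lambda>n. 0)" by (simp add: T_def fun_eq_iff)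
    then have "mixed_norm p q \<alpha> (T K (K + 0)) = 0"
      using pos by (simp add: mixed_norm_def hardy_norm_def dirichlet_shift_def bohr_lift_def)
    then show ?case using d by simp
  next
    case (Suc m)
    have "T K (K + Suc m) = (\<lambda>n. Q K n + T (Suc K) (Suc K + m) n)"
      unfolding T_def by (simp add: fun_eq_iff sum.atLeast_Suc_lessThan)
    then have "mixed_norm p q \<alpha> (T K (K + Suc m)) powr q
        \<le> K0 * (mixed_norm p q \<alpha> (Q K) powr q + mixed_norm p q \<alpha> (T (Suc K) (Suc K + m)) powr q)"
      unfolding K0_def using mixed_norm_add[OF Qp Tp pos(1,2) al] by simp
    also have "\<dots> \<le> K0 * (d ^ Suc K + d ^ Suc K)"
      using K0 Qn[of K] Suc.IH[of "Suc K"] unfolding e_def by (intro mult_left_mono add_mono) auto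
    also have "\<dots> = d ^ K" using d(3) by (simp add: mult.left_commute flip: mult.assoc)
    finally show ?case .
  qed
  have dlim: "(\<lambda>k. d ^ k) \<longlonglongrightarrow> 0" using d by (intro LIMSEQ_realpow_zero) auto
  have cauchy: "mixed_cauchy p q \<alpha> P"
    unfolding mixed_cauchy_def
  proof (intro allI impI)
    fix \<epsilon> :: real assume \<epsilon>: "\<epsilon> > 0"
    then have "\<epsilon> powr q > 0" by simp
    then have "\<forall>\<^sub>F k in sequentially. d ^ k < \<epsilon> powr q" using order_tendstoD(2)[OF dlim] by blast
    then obtain N where N: "\<And>k. k \<ge> N \<Longrightarrow> d ^ k < \<epsilon> powr q" unfolding eventually_sequentially by blast
    have T: "mixed_norm p q \<alpha> (T k l) < \<epsilon>" if "N \<le> k" "k \<le> l" for k l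
    proof -
      have "mixed_norm p q \<alpha> (T k l) powr q \<le> d ^ k" using Tn[of k "l - k"] that by simp
      also have "\<dots> < \<epsilon> powr q" by (rule N[OF that(1)])
      finally show ?thesis using pos \<epsilon> powr_le_iff_nonneg[of q \<epsilon> "mixed_norm p q \<alpha> (T k l)"] by simp
    qed
    have "mixed_norm p q \<alpha> (\<lambda>n. P k n - P l n) < \<epsilon>" if "N \<le> k" "N \<le> l" for k l
    proof (cases "l \<le> k")
      case True
      then show ?thesis using T[OF that(2) True] by (simp add: PT)
    next
      case False
      then have "(\<lambda>n. P k n - P l n) = (\<lambda>n. - T k l n)" by (simp add: fun_eq_iff PT[of k l, symmetric])
      then show ?thesis using T[OF that(1)] False by (simp add: mixed_norm_uminus)
    qed
    then show "\<exists>N. \<forall>k\<ge>N. \<forall>l\<ge>N. mixed_norm p q \<alpha> (\<lambda>n. P k n - P l n) < \<epsilon>" by blast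
  qed
  have esum: "(\<Sum>k\<in>{K..<K + m}. e k) \<le> d ^ K" for K m
  proof (induction m arbitrary: K)
    case (Suc m)
    have "(\<Sum>k\<in>{K..<K + Suc m}. e k) = e K + (\<Sum>k\<in>{Suc K..<Suc K + m}. e k)"
      by (simp add: sum.atLeast_Suc_lessThan)
    also have "\<dots> \<le> d ^ Suc K + d ^ Suc K" using Suc.IH[of "Suc K"] by (simp add: e_def)
    also have "\<dots> = (2 * d) * d ^ K" by simp
    also have "\<dots> \<le> 1 * d ^ K" using d by (intro mult_right_mono) auto
    finally show ?case by simp
  qed (use d in simp)
  define D where "D K n = a n - P K n" for K n
  have DT: "D K n = T K (K + N) n" if "n < N" for K N n
  proof -
    have "a n = P (K + N) n" unfolding P_def using that by (intro a_eq) auto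
    then show ?thesis unfolding D_def using PT[of K "K + N" n] by simp
  qed
  \<comment> \<open>Absolute convergence on the boundary line, at a geometric rate. It makes
    \<open>a\<close> converge on the half-plane and the partial sums tend to it there, uniformly in
    \<open>s\<close>.\<close>
  have Dsum: "(\<Sum>n<N. norm (D K n) * real n powr (- (1 / 2))) \<le> d ^ K" for K N
  proof -
    have "(\<Sum>n<N. norm (D K n) * real n powr (- (1 / 2)))
        \<le> (\<Sum>n<N. \<Sum>k\<in>{K..<K + N}. norm (Q k n) * real n powr (- (1 / 2)))"
      unfolding sum_distrib_right[symmetric]
      by (intro sum_mono mult_right_mono) (auto simp: DT T_def intro!: norm_sum)
    also have "\<dots> = (\<Sum>k\<in>{K..<K + N}. \<Sum>n<N. norm (Q k n) * real n powr (- (1 / 2)))"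
      by (rule sum.swap)
    also have "\<dots> \<le> (\<Sum>k\<in>{K..<K + N}. e k)"
    proof (rule sum_mono)
      fix k
      have fin: "finite {n. Q k n \<noteq> 0}" using Qp[of k] by (simp add: dirichlet_poly_def)
      have "(\<Sum>n<N. norm (Q k n) * real n powr (- (1 / 2))) = (\<Sum>n\<in>{..<N} \<inter> {n. Q k n \<noteq> 0}. norm (Q k n) * real n powr (- (1 / 2)))"
        by (rule sum.mono_neutral_right) auto
      also have "\<dots> \<le> (\<Sum>n | Q k n \<noteq> 0. norm (Q k n) * real n powr (- (1 / 2)))"
        using fin by (intro sum_mono2) auto
      finally show "(\<Sum>n<N. norm (Q k n) * real n powr (- (1 / 2))) \<le> e k" using Qc[of k] by linarith
    qed
    also have "\<dots> \<le> d ^ K" by (rule esum)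
    finally show ?thesis .
  qed
  have Dsummable: "summable (\<lambda>n. norm (D K n) * real n powr (- (1 / 2)))" for K
    by (rule summableI_nonneg_bounded[where x = "d ^ K"]) (auto intro: Dsum)
  have Dterm: "norm (D K n * of_nat n powr (- s)) \<le> norm (D K n) * real n powr (- (1 / 2))" if "Re s > 1 / 2" for K n s
    unfolding norm_mult norm_of_nat_powr using that
    by (cases "n = 0") (auto intro!: mult_left_mono powr_mono)
  have Dconv: "dirichlet_converges (D K) s" if "Re s > 1 / 2" for K s
    unfolding dirichlet_converges_def
    by (rule summable_comparison_test'[OF Dsummable]) (rule Dterm[OF that])
  have Deval: "norm (dirichlet_eval (D K) s) \<le> d ^ K" if "Re s > 1 / 2" for K s
  proof -
    have "norm (dirichlet_eval (D K) s) \<le> (\<Sum>n. norm (D K n) * real n powr (- (1 / 2)))"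
      unfolding dirichlet_eval_def by (rule norm_suminf_le[OF Dterm[OF that] Dsummable])
    also have "\<dots> \<le> d ^ K" by (rule suminf_le_const[OF Dsummable Dsum])
    finally show ?thesis .
  qed
  have aD: "a = D 0" by (simp add: D_def P_def fun_eq_iff)
  have aconv: "dirichlet_converges a s" if "Re s > 1 / 2" for s using Dconv[OF that, of 0] aD by simp
  have evalP: "(\<lambda>K. dirichlet_eval (P K) s) \<longlonglongrightarrow> dirichlet_eval a s" if s: "Re s > 1 / 2" for s
  proof -
    have "dirichlet_eval (P K) s = dirichlet_eval a s - dirichlet_eval (D K) s" for K
    proof -
      have "P K = (\<lambda>n. a n - D K n)" by (simp add: D_def fun_eq_iff)
      then show ?thesis
        using suminf_diff[of "\<lambda>n. a n * of_nat n powr (- s)" "\<lambda>n. D K n * of_nat n powr (- s)"] aconv[OF s] Dconv[OF s, of K]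
        unfolding dirichlet_converges_def dirichlet_eval_def by (simp add: left_diff_distrib)
    qed
    moreover have "(\<lambda>K. dirichlet_eval (D K) s) \<longlonglongrightarrow> 0"
      by (rule Lim_null_comparison[OF _ dlim]) (use Deval[OF s] in auto)
    then have "(\<lambda>K. dirichlet_eval a s - dirichlet_eval (D K) s) \<longlonglongrightarrow> dirichlet_eval a s - 0"
      by (intro tendsto_intros)
    ultimately show ?thesis by simp
  qed
  have a0: "a 0 = 0" using Qp[of 0] by (simp add: a_def dirichlet_poly_def)
  have amem: "a \<in> mixed_norm_space p q \<alpha>"
    unfolding mixed_norm_space_def using a0 aconv Pp cauchy evalP by blast
  have "a \<notin> mixed_norm_space u v \<beta>"
  proof
    assume "a \<in> mixed_norm_space u v \<beta>"
    then obtain R where R: "\<And>k. dirichlet_poly (R k)" "mixed_cauchy u v \<beta> R"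
      "\<And>s. Re s > 1 / 2 \<Longrightarrow> (\<lambda>k. dirichlet_eval (R k) s) \<longlonglongrightarrow> dirichlet_eval a s"
      unfolding mixed_norm_space_def by blast
    obtain B where B: "\<And>k. mixed_norm u v \<beta> (R k) \<le> B"
      using mixed_cauchy_bounded[OF R(1,2) pos(3,4) be] by blast
    obtain C where C: "C > 0" "\<And>a n. dirichlet_poly a \<Longrightarrow> norm (a n) \<le> C * real n powr (2 + 2 / u) * mixed_norm u v \<beta> a"
      using mixed_norm_coeff_bound[OF pos(3,4) be] by blast
    have coeffs: "(\<lambda>i. R i n) \<longlonglongrightarrow> a n" for n
    \<comment> \<open>One majorant must serve both sides. The \<open>R i\<close> are covered by
      their uniform norm bound, which accounts for \<open>C * B\<close>; the coefficients of
      \<open>a\<close> grow at most like \<open>n powr (1 / 2)\<close> by the weighted sum, which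
      accounts for the \<open>1\<close>.\<close>
    proof (rule coeff_tendsto_of_eval_tendsto[where D = "max (C * B) 1" and M = "2 + 2 / u" and ?s0.0 = 1])
      show "norm (R i n) \<le> max (C * B) 1 * real n powr (2 + 2 / u)" for i n
      proof -
        have "norm (R i n) \<le> C * real n powr (2 + 2 / u) * mixed_norm u v \<beta> (R i)" by (rule C(2)[OF R(1)])
        also have "\<dots> \<le> C * real n powr (2 + 2 / u) * B" using C B by (intro mult_left_mono) auto
        also have "\<dots> = (C * B) * real n powr (2 + 2 / u)" by simp
        also have "\<dots> \<le> max (C * B) 1 * real n powr (2 + 2 / u)" by (intro mult_right_mono) auto
        finally show ?thesis .
      qed
      show "norm (a n) \<le> max (C * B) 1 * real n powr (2 + 2 / u)" for n
      proof (cases "n = 0")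
        case False
        have "norm (D 0 n) * real n powr (- (1 / 2)) \<le> (\<Sum>m<Suc n. norm (D 0 m) * real m powr (- (1 / 2)))"
          by (rule member_le_sum) auto
        also have "\<dots> \<le> 1" using Dsum[of 0 "Suc n"] by simp
        finally have "norm (a n) * real n powr (- (1 / 2)) \<le> 1" using aD by simp
        then have "norm (a n) \<le> real n powr (1 / 2)" using False by (simp add: powr_minus_divide divide_simps)
        also have "\<dots> \<le> real n powr (2 + 2 / u)" using False pos by (intro powr_mono) (auto intro: order_trans[of _ 2])
        also have "\<dots> = 1 * real n powr (2 + 2 / u)" by simp
        also have "\<dots> \<le> max (C * B) 1 * real n powr (2 + 2 / u)" by (rule mult_right_mono) auto
        finally show ?thesis .
      qed (simp add: a0)
      show "(\<lambda>i. dirichlet_eval (R i) (of_real s)) \<longlonglongrightarrow> dirichlet_eval a (of_real s)" if "s > 1" for s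
        using that by (intro R(3)) auto
    qed
    \<comment> \<open>The approximants \<open>R i\<close> of the target are cut down to the primes
      of one block. Their norms stay below \<open>B\<close>, their coefficients tend to those of
      \<open>Q k\<close>, and the Fatou argument passes the bound on to \<open>Q k\<close>.\<close>
    have QB: "mixed_norm u v \<beta> (Q k) \<le> B" for k
    proof -
      let ?J = "{J k..<J (Suc k)}"
      have sm: "smooth_part ?J a n = Q k n" for n
      proof (cases "\<forall>j. prime_exponent n j \<noteq> 0 \<longrightarrow> j \<in> ?J")
        case True
        have other: "Q l n = 0" if "l \<noteq> k" for l
        proof (rule ccontr)
          assume "Q l n \<noteq> 0"
          then obtain j where j: "prime_exponent n j \<noteq> 0" "j \<in> {J l..<J (Suc l)}" using exj by blast
          have "j \<in> ?J" using True j by blast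
          then have "J l < J (Suc k)" "J k < J (Suc l)" using j by auto
          then have "l < Suc k" "k < Suc l" using strict_mono_less[OF mJ] by auto
          then show False using that by simp
        qed
        have "a n = (\<Sum>l<Suc n + k. Q l n)" by (rule a_eq) simp
        also have "\<dots> = (\<Sum>l\<in>{k}. Q l n)"
        proof (cases "k < Suc n + k")
          case True
          then show ?thesis using other by (intro sum.mono_neutral_right) auto
        qed simp
        finally show ?thesis using True by (simp add: smooth_part_def)
      next
        case False
        have "Q k n = 0"
        proof (rule ccontr)
          assume nz: "Q k n \<noteq> 0"
          have "j \<in> ?J" if "prime_exponent n j \<noteq> 0" for j
            using prime_supportI[of "Q k" n, OF nz that] Qs[of k] by blast
          then show False using False by blast
        qed
        then show ?thesis using False by (simp only: smooth_part_def if_False)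
      qed
      show ?thesis
      proof (rule mixed_norm_fatou[where J = ?J and R = "\<lambda>i. smooth_part ?J (R i)"])
        show "smooth_part ?J (smooth_part ?J (R i)) = smooth_part ?J (R i)" for i
          by (auto simp: smooth_part_def fun_eq_iff)
        show "mixed_norm u v \<beta> (smooth_part ?J (R i)) \<le> B" for i
          using mixed_norm_smooth_part[OF R(1) pos(3,4) be] B by (rule order_trans)
        show "(\<lambda>i. smooth_part ?J (R i) n) \<longlonglongrightarrow> Q k n" for n
          unfolding sm[symmetric] smooth_part_def
          by (rule tendsto_if_const[OF coeffs])
      qed (use R Qp pos be in auto)
    qed
    have "\<forall>\<^sub>F k in sequentially. d ^ k < 1 / (\<bar>B\<bar> + 1)"
      by (rule order_tendstoD(2)[OF dlim]) simp
    then obtain k where k: "d ^ k < 1 / (\<bar>B\<bar> + 1)" unfolding eventually_sequentially by blast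
    have "e k \<le> d ^ k" unfolding e_def using d by (simp add: mult_left_le_one_le)
    then have "e k < 1 / (\<bar>B\<bar> + 1)" using k by linarith
    then have "\<bar>B\<bar> + 1 < 1 / e k" using e[of k] by (simp add: field_simps)
    then show False using Qb[of k] QB[of k] by linarith
  qed
  then show ?thesis using amem by blast
qed

section \<open>Lacunary sums over primes\<close>

lemma prime_exponent_nth_prime: "prime_exponent (nth_prime i) j = (if i = j then 1 else 0)"
proof (cases "i = j")
  case True
  then show ?thesis
    using multiplicity_self[of "nth_prime j"] prime_nth_prime[of j] nth_prime_ge_2[of j]
    by (simp add: prime_exponent_def not_prime_unit)
next
  case False
  then have "nth_prime i \<noteq> nth_prime j" using inj_nth_prime by (auto dest: injD)
  then show ?thesis using False prime_nth_prime
    by (simp add: prime_exponent_def prime_multiplicity_other)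
qed

lemma le_nth_prime: "j \<le> nth_prime j"
  by (rule strict_mono_imp_increasing[OF strict_mono_nth_prime])

text \<open>A sum over an index set, in which equal values of \<open>m\<close> add up. The Bohr lift
  can be read off index by index, and the indices may be natural numbers or sets of primes.\<close>

definition monomial_sum :: "'i set \<Rightarrow> ('i \<Rightarrow> nat) \<Rightarrow> ('i \<Rightarrow> complex) \<Rightarrow> nat \<Rightarrow> complex" where
  "monomial_sum A m c n = (\<Sum>i\<in>A. if n = m i then c i else 0)"

lemma monomial_sum_nonzero: "monomial_sum A m c n \<noteq> 0 \<Longrightarrow> n \<in> m ` A"
proof (rule ccontr)
  assume "monomial_sum A m c n \<noteq> 0" "n \<notin> m ` A"
  then have "(\<Sum>i\<in>A. if n = m i then c i else 0) = 0" by (intro sum.neutral) auto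
  then show False using \<open>monomial_sum A m c n \<noteq> 0\<close> by (simp add: monomial_sum_def)
qed

lemma dirichlet_poly_monomial_sum:
  assumes "finite A" "\<And>i. m i > 0"
  shows "dirichlet_poly (monomial_sum A m c)"
proof -
  have "{n. monomial_sum A m c n \<noteq> 0} \<subseteq> m ` A" using monomial_sum_nonzero by blast
  then have "finite {n. monomial_sum A m c n \<noteq> 0}" by (rule finite_subset) (use assms in simp)
  moreover have "monomial_sum A m c 0 = 0"
    using assms monomial_sum_nonzero[of A m c 0] by (metis imageE less_irrefl)
  ultimately show ?thesis unfolding dirichlet_poly_def by simp
qed

lemma bohr_lift_monomial_sum:
  assumes A: "finite A"
  shows "bohr_lift (monomial_sum A m c) z = (\<Sum>i\<in>A. c i * prime_monomial (m i) z)"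
proof -
  have "bohr_lift (monomial_sum A m c) z = (\<Sum>n\<in>m ` A. monomial_sum A m c n * prime_monomial n z)"
    by (rule bohr_lift_eq) (use A monomial_sum_nonzero in blast)+
  also have "\<dots> = (\<Sum>n\<in>m ` A. \<Sum>i\<in>A. if n = m i then c i * prime_monomial (m i) z else 0)"
    unfolding monomial_sum_def sum_distrib_right by (intro sum.cong refl) simp
  also have "\<dots> = (\<Sum>i\<in>A. \<Sum>n\<in>m ` A. if n = m i then c i * prime_monomial (m i) z else 0)"
    by (rule sum.swap)
  also have "\<dots> = (\<Sum>i\<in>A. c i * prime_monomial (m i) z)"
    using A by (intro sum.cong refl) (subst sum.delta, auto)
  finally show ?thesis .
qed

lemma monomial_sum_coeff_sum_le:
  assumes A: "finite A"
  shows "(\<Sum>n | monomial_sum A m c n \<noteq> 0. norm (monomial_sum A m c n) * real n powr t) \<le> (\<Sum>i\<in>A. norm (c i) * real (m i) powr t)"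
proof -
  have "(\<Sum>n | monomial_sum A m c n \<noteq> 0. norm (monomial_sum A m c n) * real n powr t)
      \<le> (\<Sum>n\<in>m ` A. norm (monomial_sum A m c n) * real n powr t)"
    by (rule sum_mono2) (use A monomial_sum_nonzero in \<open>auto intro: imageI\<close>)
  also have "\<dots> \<le> (\<Sum>n\<in>m ` A. \<Sum>i\<in>A. if n = m i then norm (c i) * real (m i) powr t else 0)"
  proof (rule sum_mono)
    fix n
    have "norm (monomial_sum A m c n) * real n powr t \<le> (\<Sum>i\<in>A. norm (if n = m i then c i else 0)) * real n powr t"
      unfolding monomial_sum_def by (intro mult_right_mono norm_sum) auto
    also have "\<dots> = (\<Sum>i\<in>A. if n = m i then norm (c i) * real (m i) powr t else 0)"
      unfolding sum_distrib_right by (intro sum.cong refl) simp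
    finally show "norm (monomial_sum A m c n) * real n powr t \<le> (\<Sum>i\<in>A. if n = m i then norm (c i) * real (m i) powr t else 0)" .
  qed
  also have "\<dots> = (\<Sum>i\<in>A. \<Sum>n\<in>m ` A. if n = m i then norm (c i) * real (m i) powr t else 0)"
    by (rule sum.swap)
  also have "\<dots> = (\<Sum>i\<in>A. norm (c i) * real (m i) powr t)"
    using A by (intro sum.cong refl) (subst sum.delta, auto)
  finally show ?thesis .
qed

lemma shift_monomial_sum:
  "dirichlet_shift \<sigma> (monomial_sum A m c) = monomial_sum A m (\<lambda>i. c i * of_real (real (m i) powr (- \<sigma>)))"
  unfolding dirichlet_shift_def monomial_sum_def sum_distrib_right by (intro ext sum.cong refl) simp

lemma monomial_sum_at:
  assumes "inj m" "finite A" "i \<in> A"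
  shows "monomial_sum A m c (m i) = c i"
proof -
  have "monomial_sum A m c (m i) = (\<Sum>k\<in>A. if k = i then c k else 0)"
    unfolding monomial_sum_def using assms(1) by (intro sum.cong refl) (auto dest: injD)
  then show ?thesis using assms(2,3) by simp
qed

section \<open>Elementary bounds for Hardy norms and for sums\<close>

lemma hardy_norm_le_sup:
  assumes p: "p > 0" and A: "A \<ge> 0" and le: "\<And>z. z \<in> space torus_haar \<Longrightarrow> norm (bohr_lift a z) \<le> A"
  shows "hardy_norm p a \<le> A"
proof -
  interpret T: prob_space torus_haar by (rule prob_space_torus_haar)
  have "lift_moment p a \<le> (\<integral>\<^sup>+z. ennreal (A powr p) \<partial>torus_haar)"
    unfolding lift_moment_def using p by (intro nn_integral_mono ennreal_leI powr_mono2 le) auto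
  also have "\<dots> = ennreal (A powr p)" by (simp add: T.emeasure_space_1)
  finally have "hardy_norm p a powr p \<le> A powr p" by (simp add: lift_moment_eq_hardy_norm[OF p])
  then show ?thesis using p A by (simp add: powr_le_iff_nonneg)
qed

text \<open>Scaled to total \<open>1\<close>, all terms lie between \<open>0\<close> and
  \<open>1\<close>, where \<open>t \<le> t powr q\<close>.\<close>

lemma sum_powr_le:
  assumes q: "0 < q" "q \<le> (1::real)" and f: "\<And>i. i \<in> A \<Longrightarrow> 0 \<le> f i" and A: "finite A"
  shows "(\<Sum>i\<in>A. f i) powr q \<le> (\<Sum>i\<in>A. f i powr q)"
proof (cases "(\<Sum>i\<in>A. f i) = 0")
  case False
  let ?S = "\<Sum>i\<in>A. f i"
  have S: "?S > 0" using False f sum_nonneg[of A f] by force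
  have le: "f i / ?S \<le> (f i / ?S) powr q" if "i \<in> A" for i
  proof (cases "f i = 0")
    case nz: False
    have "f i \<le> ?S" using that A f by (intro member_le_sum) auto
    then have "(f i / ?S) powr 1 \<le> (f i / ?S) powr q"
      using S f[OF that] nz q by (intro powr_mono') auto
    then show ?thesis using S f[OF that] by simp
  qed simp
  have "1 = (\<Sum>i\<in>A. f i / ?S)" using S by (simp add: sum_divide_distrib[symmetric])
  also have "\<dots> \<le> (\<Sum>i\<in>A. (f i / ?S) powr q)" by (intro sum_mono le)
  also have "\<dots> = (\<Sum>i\<in>A. f i powr q) / ?S powr q"
    unfolding sum_divide_distrib using S f by (intro sum.cong refl) (simp add: powr_divide)
  finally show ?thesis using S by (simp add: pos_le_divide_eq)
next
  case True
  have "0 \<le> (\<Sum>i\<in>A. f i powr q)" by (intro sum_nonneg) simp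
  then show ?thesis unfolding True by simp
qed

text \<open>With \<open>h t = t / (1 + t)\<close>, the terms of a lacunary sum are dominated by the increments
  \<open>h (X\<^sub>i powr x) - h ((X\<^sub>i / 2) powr x)\<close>, which telescope.\<close>

lemma lacunary_sum_bound:
  assumes x: "x > (0::real)"
  shows "\<exists>G>0. \<forall>X K. (\<forall>i. X i > 0 \<and> 2 * X i \<le> X (Suc i)) \<longrightarrow> (\<Sum>i<K. X i powr x * exp (- X i)) \<le> G"
proof -
  \<comment> \<open>From \<open>y powr x \<le> (2 * x) powr x * exp (y / 2)\<close> one gets
    \<open>(1 + y powr x)^2 \<le> C * exp y\<close>. So \<open>exp (- y)\<close> is dominated by
    \<open>C / (1 + y powr x)^2\<close>, which is comparable to an increment of
    \<open>h\<close>.\<close>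
  define C where "C = (1 + (2 * x) powr x)\<^sup>2"
  define l where "l = 2 powr (- x)"
  have l: "0 < l" "l < 1" unfolding l_def using x by (auto simp: powr_less_one)
  define h where "h t = t / (1 + t)" for t :: real
  have hmono: "h s \<le> h t" if "0 \<le> s" "s \<le> t" for s t using that by (simp add: h_def field_simps)
  have h1: "h t \<le> 1" if "0 \<le> t" for t using that by (simp add: h_def)
  have C: "C > 0" unfolding C_def by (intro zero_less_power add_pos_nonneg) auto
  have incr: "y powr x * exp (- y) \<le> C / (1 - l) * (h (y powr x) - h ((y / 2) powr x))" if y: "y > 0" for y
  proof -
    let ?t = "y powr x"
    have t: "?t > 0" using y by simp
    have y2: "(y / 2) powr x = l * ?t" using y by (simp add: l_def powr_divide powr_minus_divide)
    have "y / (2 * x) \<le> exp (y / (2 * x))" using exp_ge_add_one_self[of "y / (2 * x)"] by linarith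
    then have "(y / (2 * x)) powr x \<le> exp (y / (2 * x)) powr x" using x y by (intro powr_mono2) auto
    also have "\<dots> = exp (y / 2)" using x by (simp add: exp_powr_real)
    finally have "?t \<le> (2 * x) powr x * exp (y / 2)" using x y by (simp add: powr_divide field_simps)
    moreover have "1 \<le> exp (y / 2)" using y by simp
    ultimately have "1 + ?t \<le> (1 + (2 * x) powr x) * exp (y / 2)" unfolding distrib_right by linarith
    then have "(1 + ?t)\<^sup>2 \<le> ((1 + (2 * x) powr x) * exp (y / 2))\<^sup>2" using t by (intro power_mono) auto
    also have "\<dots> = C * exp y" by (simp add: C_def power_mult_distrib exp_double[symmetric])
    finally have "exp (- y) * (1 + ?t)\<^sup>2 \<le> exp (- y) * (C * exp y)" by (intro mult_left_mono) auto
    also have "\<dots> = C" by (simp add: exp_minus)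
    finally have "exp (- y) * (1 + ?t)\<^sup>2 \<le> C" .
    moreover have "(1 + ?t)\<^sup>2 > 0" using t by (intro zero_less_power) linarith
    ultimately have "exp (- y) \<le> C / (1 + ?t)\<^sup>2" by (simp only: pos_le_divide_eq)
    then have "?t * exp (- y) \<le> ?t * (C / (1 + ?t)\<^sup>2)" using t by (intro mult_left_mono) auto
    also have "\<dots> \<le> ?t * (C / ((1 + ?t) * (1 + l * ?t)))"
    proof -
      have "1 + l * ?t \<le> 1 + ?t" using l t by simp
      then have "(1 + ?t) * (1 + l * ?t) \<le> (1 + ?t)\<^sup>2" unfolding power2_eq_square using t by (intro mult_left_mono) auto
      moreover have "0 < (1 + ?t) * (1 + l * ?t)"
        using t mult_pos_pos[OF l(1) t] by (intro mult_pos_pos; linarith)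
      ultimately have "C / (1 + ?t)\<^sup>2 \<le> C / ((1 + ?t) * (1 + l * ?t))" using C by (intro frac_le) linarith+
      then show ?thesis using t by (intro mult_left_mono) linarith+
    qed
    also have "\<dots> = C / (1 - l) * (h ?t - h (l * ?t))"
    proof -
      have nz: "1 + ?t \<noteq> 0" "1 + l * ?t \<noteq> 0" "1 - l \<noteq> 0" using t l mult_pos_pos[OF l(1) t] by linarith+
      have "h ?t - h (l * ?t) = ?t * (1 - l) / ((1 + ?t) * (1 + l * ?t))"
        unfolding h_def using nz by (simp add: diff_frac_eq algebra_simps)
      then show ?thesis using nz by simp
    qed
    finally show ?thesis unfolding y2 .
  qed
  show ?thesis
  proof (intro exI[of _ "C / (1 - l)"] conjI allI impI)
    show "C / (1 - l) > 0" using C l by simp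
    fix X :: "nat \<Rightarrow> real" and K assume X: "\<forall>i. X i > 0 \<and> 2 * X i \<le> X (Suc i)"
    \<comment> \<open>Lacunarity puts \<open>X K\<close> below \<open>X (Suc K) / 2\<close>, so the
      intervals whose increments are added do not overlap and the sum stays below the total
      variation of \<open>h\<close>, at most \<open>1\<close>.\<close>
    have tele: "(\<Sum>i<Suc K. h (X i powr x) - h ((X i / 2) powr x)) \<le> h (X K powr x)" for K
    proof (induction K)
      case 0
      have "0 \<le> h ((X 0 / 2) powr x)" by (simp add: h_def)
      then show ?case by simp
    next
      case (Suc K)
      have "h (X K powr x) \<le> h ((X (Suc K) / 2) powr x)"
        using X x by (intro hmono powr_mono2) (auto simp: less_imp_le field_simps)
      then show ?case using Suc.IH by simp
    qed
    have tele': "(\<Sum>i<K. h (X i powr x) - h ((X i / 2) powr x)) \<le> 1"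
    proof (cases K)
      case (Suc k)
      show ?thesis unfolding Suc using tele[of k] h1[of "X k powr x"] by simp
    qed simp
    have "(\<Sum>i<K. X i powr x * exp (- X i)) \<le> (\<Sum>i<K. C / (1 - l) * (h (X i powr x) - h ((X i / 2) powr x)))"
      using X by (intro sum_mono incr) auto
    also have "\<dots> = C / (1 - l) * (\<Sum>i<K. h (X i powr x) - h ((X i / 2) powr x))" by (rule sum_distrib_left[symmetric])
    also have "\<dots> \<le> C / (1 - l) * 1" using C l by (intro mult_left_mono tele') auto
    finally show "(\<Sum>i<K. X i powr x * exp (- X i)) \<le> C / (1 - l)" by simp
  qed
qed

text \<open>The condition is on logarithms because
  \<open>n powr (- \<sigma>) = exp (- \<sigma> * ln n)\<close>: the logarithms are the frequencies
  of the series. The lower bound \<open>1\<close> puts \<open>1 / ln p\<close> in the range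
  \<open>s \<le> 1\<close> of the interval estimate.\<close>

definition lacunary_primes :: "(nat \<Rightarrow> nat) \<Rightarrow> bool" where
  "lacunary_primes d \<longleftrightarrow> (\<forall>i. 1 \<le> ln (real (nth_prime (d i))) \<and> 2 * ln (real (nth_prime (d i))) \<le> ln (real (nth_prime (d (Suc i)))))"

lemma ex_lacunary_primes: "\<exists>d. lacunary_primes d \<and> (\<forall>i. j \<le> d i) \<and> L \<le> ln (real (nth_prime (d 0)))"
proof -
  \<comment> \<open>The next index is the square of the current prime. Since the \<open>k\<close>-th
    prime is at least \<open>k\<close>, its logarithm at least doubles.\<close>
  define d where "d = rec_nat (max j (nat \<lceil>exp (max L 1)\<rceil>)) (\<lambda>i k. (nth_prime k)\<^sup>2)"
  have d0: "d 0 = max j (nat \<lceil>exp (max L 1)\<rceil>)" and dS: "d (Suc i) = (nth_prime (d i))\<^sup>2" for i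
    by (simp_all add: d_def)
  have double: "2 * ln (real (nth_prime (d i))) \<le> ln (real (nth_prime (d (Suc i))))" for i
  proof -
    have "real ((nth_prime (d i))\<^sup>2) \<le> real (nth_prime (d (Suc i)))"
      using le_nth_prime[of "d (Suc i)"] unfolding dS by (simp only: of_nat_le_iff)
    then have "ln (real ((nth_prime (d i))\<^sup>2)) \<le> ln (real (nth_prime (d (Suc i))))"
      using nth_prime_ge_2[of "d i"] by (intro ln_mono) auto
    then show ?thesis using nth_prime_ge_2[of "d i"] by (simp add: ln_realpow)
  qed
  have first: "max L 1 \<le> ln (real (nth_prime (d 0)))"
  proof -
    have "exp (max L 1) \<le> real (d 0)" unfolding d0 by linarith
    also have "\<dots> \<le> real (nth_prime (d 0))" using le_nth_prime by simp
    finally have "ln (exp (max L 1)) \<le> ln (real (nth_prime (d 0)))" by (intro ln_mono) auto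
    then show ?thesis by simp
  qed
  have ge1: "1 \<le> ln (real (nth_prime (d i)))" for i
  proof (induction i)
    case (Suc i)
    then show ?case using double[of i] by linarith
  qed (use first in linarith)
  have "j \<le> d i" for i
  proof (induction i)
    case (Suc i)
    have "d i \<le> nth_prime (d i)" by (rule le_nth_prime)
    also have "\<dots> \<le> d (Suc i)" unfolding dS power2_eq_square using nth_prime_ge_2[of "d i"] by simp
    finally show ?case using Suc by linarith
  qed (simp add: d0)
  then show ?thesis using double ge1 first unfolding lacunary_primes_def by (intro exI[of _ d]) auto
qed

text \<open>For \<open>x = (\<alpha> + 1) / q\<close> the weights give all monomials a source norm
  of the same order \<open>\<eta>\<close>, whatever the prime: a monomial with logarithm
  \<open>l\<close> has norm of order \<open>l powr (- x)\<close>.\<close>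

definition lacunary_test :: "nat \<Rightarrow> (nat \<Rightarrow> nat) \<Rightarrow> real \<Rightarrow> real \<Rightarrow> nat \<Rightarrow> complex" where
  "lacunary_test K d x \<eta> = monomial_sum {..<K} (\<lambda>i. nth_prime (d i)) (\<lambda>i. of_real (\<eta> * ln (real (nth_prime (d i))) powr x))"

lemma dirichlet_poly_lacunary_test: "dirichlet_poly (lacunary_test K d x \<eta>)"
  unfolding lacunary_test_def using prime_gt_0_nat[OF prime_nth_prime] by (intro dirichlet_poly_monomial_sum) simp_all

lemma lacunary_primes_strict_mono:
  assumes "lacunary_primes d"
  shows "strict_mono (\<lambda>i. nth_prime (d i))"
proof (rule strict_mono_Suc_iff[THEN iffD2], intro allI)
  fix i
  have "ln (real (nth_prime (d i))) < ln (real (nth_prime (d (Suc i))))"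
    using assms unfolding lacunary_primes_def by (smt (verit))
  then show "nth_prime (d i) < nth_prime (d (Suc i))"
    using nth_prime_ge_2[of "d i"] nth_prime_ge_2[of "d (Suc i)"] by (subst (asm) ln_less_cancel_iff) auto
qed

text \<open>The monomials behave as if they had disjoint supports in \<open>\<sigma>\<close>, so the
  \<open>q\<close>-th powers of their norms add up to a multiple of \<open>K\<close>. For
  \<open>q \<le> 1\<close> this is subadditivity of the power; for \<open>q > 1\<close> lacunarity
  bounds the whole sum by a multiple of \<open>\<sigma> powr (- x)\<close>, and all but one power of
  it is estimated in this way. The Hardy norm itself is bounded by the supremum.\<close>

lemma lacunary_test_upper:
  assumes p: "p > 0" and q: "q > 0" and al: "\<alpha> > -1"
  shows "\<exists>C>0. \<forall>K d \<eta>. \<eta> > 0 \<longrightarrow> lacunary_primes d \<longrightarrow>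
    mixed_norm p q \<alpha> (lacunary_test K d ((\<alpha> + 1) / q) \<eta>) powr q \<le> C * \<eta> powr q * real K"
proof -
  let ?x = "(\<alpha> + 1) / q"
  have x: "?x > 0" using q al by simp
  obtain G where G: "G > 0" "\<And>X K. (\<And>i. X i > 0 \<and> 2 * X i \<le> X (Suc i)) \<Longrightarrow> (\<Sum>i<K. X i powr ?x * exp (- X i)) \<le> G"
    using lacunary_sum_bound[OF x] by blast
  have xq: "?x * q = \<alpha> + 1" using q by simp
  have "\<exists>C>0. \<forall>K l. (\<forall>i. 1 \<le> l i \<and> 2 * l i \<le> l (Suc i)) \<longrightarrow>
     (\<integral>\<^sup>+\<sigma>. ennreal ((\<Sum>i<K. l i powr ?x * exp (- l i * \<sigma>)) powr q) \<partial>mu_measure \<alpha>) \<le> ennreal (C * real K)"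
  proof (cases "q \<le> 1")
    case True
    show ?thesis
    proof (intro exI[of _ "(2 / q) powr (\<alpha> + 1)"] conjI allI impI)
      show "(2 / q) powr (\<alpha> + 1) > 0" using q by simp
      fix K :: nat and l :: "nat \<Rightarrow> real" assume l: "\<forall>i. 1 \<le> l i \<and> 2 * l i \<le> l (Suc i)"
      have "(\<integral>\<^sup>+\<sigma>. ennreal ((\<Sum>i<K. l i powr ?x * exp (- l i * \<sigma>)) powr q) \<partial>mu_measure \<alpha>)
         \<le> (\<integral>\<^sup>+\<sigma>. (\<Sum>i<K. ennreal (l i powr (\<alpha> + 1)) * ennreal (exp (- (q * l i) * \<sigma>))) \<partial>mu_measure \<alpha>)"
      proof (rule nn_integral_mono)
        fix s
        have "(\<Sum>i<K. l i powr ?x * exp (- l i * s)) powr q \<le> (\<Sum>i<K. (l i powr ?x * exp (- l i * s)) powr q)"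
          using q True by (intro sum_powr_le) auto
        also have "\<dots> = (\<Sum>i<K. l i powr (\<alpha> + 1) * exp (- (q * l i) * s))"
          using xq by (intro sum.cong refl) (simp add: powr_mult powr_powr exp_powr_real mult_ac)
        finally show "ennreal ((\<Sum>i<K. l i powr ?x * exp (- l i * s)) powr q)
            \<le> (\<Sum>i<K. ennreal (l i powr (\<alpha> + 1)) * ennreal (exp (- (q * l i) * s)))"
          by (simp add: ennreal_mult[symmetric] sum_ennreal ennreal_leI)
      qed
      also have "\<dots> = (\<Sum>i<K. ennreal (l i powr (\<alpha> + 1)) * (\<integral>\<^sup>+\<sigma>. ennreal (exp (- (q * l i) * \<sigma>)) \<partial>mu_measure \<alpha>))"
        by (subst nn_integral_sum) (auto simp: nn_integral_cmult)
      also have "\<dots> \<le> (\<Sum>i<K. ennreal ((2 / q) powr (\<alpha> + 1)))"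
      proof (rule sum_mono)
        fix i
        have li: "l i \<ge> 1" using l by simp
        then have qli: "q * l i > 0" using q by simp
        have "l i powr (\<alpha> + 1) * (2 / (2 + q * l i)) powr (\<alpha> + 1) = (l i * (2 / (2 + q * l i))) powr (\<alpha> + 1)"
          using li qli by (subst powr_mult) auto
        also have "\<dots> \<le> (2 / q) powr (\<alpha> + 1)"
        proof (rule powr_mono2)
          have "l i * (2 / (2 + q * l i)) = 2 / q * (q * l i / (2 + q * l i))" using q by simp
          also have "\<dots> \<le> 2 / q * 1" using qli q by (intro mult_left_mono) (auto simp: divide_le_eq)
          finally show "l i * (2 / (2 + q * l i)) \<le> 2 / q" by simp
        qed (use li qli al in auto)
        finally show "ennreal (l i powr (\<alpha> + 1)) * (\<integral>\<^sup>+\<sigma>. ennreal (exp (- (q * l i) * \<sigma>)) \<partial>mu_measure \<alpha>) \<le> ennreal ((2 / q) powr (\<alpha> + 1))"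
          using qli by (subst nn_integral_mu_exp[OF al]) (auto simp: ennreal_mult[symmetric] ennreal_leI)
      qed
      also have "\<dots> = ennreal ((2 / q) powr (\<alpha> + 1) * real K)"
        by (simp add: sum_ennreal mult.commute ennreal_mult' ennreal_of_nat_eq_real_of_nat)
      finally show "(\<integral>\<^sup>+\<sigma>. ennreal ((\<Sum>i<K. l i powr ?x * exp (- l i * \<sigma>)) powr q) \<partial>mu_measure \<alpha>)
         \<le> ennreal ((2 / q) powr (\<alpha> + 1) * real K)" .
    qed
  next
    case False
    \<comment> \<open>The power \<open>q - 1\<close> of the sum costs \<open>s powr ?c\<close>. As
      \<open>\<alpha> + ?c = ?x - 1\<close>, the remaining integral for one term is at most a
      constant times \<open>l i powr (- ?x)\<close>, which cancels against the weight.\<close>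
    let ?c = "- ?x * (q - 1)"
    have ac: "\<alpha> + ?c = ?x - 1" using xq by (simp add: right_diff_distrib)
    let ?M = "mu_const \<alpha> * Gamma ?x"
    have M: "?M > 0" using mu_const_pos[OF al] x by (simp add: Gamma_real_pos)
    show ?thesis
    proof (intro exI[of _ "G powr (q - 1) * ?M"] conjI allI impI)
      show "G powr (q - 1) * ?M > 0" using M G by simp
      fix K :: nat and l :: "nat \<Rightarrow> real" assume l: "\<forall>i. 1 \<le> l i \<and> 2 * l i \<le> l (Suc i)"
      let ?S = "\<lambda>s. \<Sum>i<K. l i powr ?x * exp (- l i * s)"
      have "(\<integral>\<^sup>+\<sigma>. ennreal (?S \<sigma> powr q) \<partial>mu_measure \<alpha>)
         \<le> (\<integral>\<^sup>+\<sigma>. ennreal (G powr (q - 1)) * (\<Sum>i<K. ennreal (l i powr ?x) * ennreal (\<sigma> powr ?c * exp (- l i * \<sigma>))) \<partial>mu_measure \<alpha>)"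
      proof (rule nn_integral_mono_AE)
        show "AE s in mu_measure \<alpha>. ennreal (?S s powr q)
           \<le> ennreal (G powr (q - 1)) * (\<Sum>i<K. ennreal (l i powr ?x) * ennreal (s powr ?c * exp (- l i * s)))"
          using AE_mu_measure_pos
        proof eventually_elim
          fix s :: real assume s: "s > 0"
          have S0: "?S s \<ge> 0" by (intro sum_nonneg) auto
          have "(\<Sum>i<K. (l i * s) powr ?x * exp (- (l i * s))) \<le> G"
          proof (rule G(2))
            fix i
            have "2 * l i * s \<le> l (Suc i) * s" using l s by (intro mult_right_mono) auto
            moreover have "l i > 0" using l by (smt (verit))
            ultimately show "0 < l i * s \<and> 2 * (l i * s) \<le> l (Suc i) * s" using s by simp
          qed
          also have "(\<Sum>i<K. (l i * s) powr ?x * exp (- (l i * s))) = s powr ?x * ?S s"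
          proof -
            have "l i \<ge> 0" for i using l by (smt (verit))
            then show ?thesis
              unfolding sum_distrib_left using s by (intro sum.cong refl) (simp add: powr_mult mult_ac)
          qed
          finally have "s powr (- ?x) * (s powr ?x * ?S s) \<le> s powr (- ?x) * G" by (intro mult_left_mono) auto
          moreover have "s powr (- ?x) * (s powr ?x * ?S s) = ?S s"
            using s by (simp add: mult.assoc[symmetric] powr_add[symmetric])
          ultimately have SG: "?S s \<le> s powr (- ?x) * G" by (simp only:)
          have "?S s powr q = ?S s powr (q - 1) * ?S s powr 1" unfolding powr_add[symmetric] by simp
          also have "\<dots> = ?S s powr (q - 1) * ?S s" using S0 by simp
          also have "\<dots> \<le> (s powr (- ?x) * G) powr (q - 1) * ?S s"
            using SG S0 False by (intro mult_right_mono powr_mono2) auto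
          also have "\<dots> = G powr (q - 1) * (s powr ?c * ?S s)"
            using s G by (simp add: powr_mult powr_powr)
          also have "\<dots> = G powr (q - 1) * (\<Sum>i<K. l i powr ?x * (s powr ?c * exp (- l i * s)))"
            unfolding sum_distrib_left by (simp only: mult_ac)
          finally show "ennreal (?S s powr q)
           \<le> ennreal (G powr (q - 1)) * (\<Sum>i<K. ennreal (l i powr ?x) * ennreal (s powr ?c * exp (- l i * s)))"
            by (simp add: ennreal_mult[symmetric] sum_ennreal ennreal_leI sum_nonneg)
        qed
      qed
      also have "\<dots> = ennreal (G powr (q - 1)) * (\<Sum>i<K. ennreal (l i powr ?x) * (\<integral>\<^sup>+\<sigma>. ennreal (\<sigma> powr ?c * exp (- l i * \<sigma>)) \<partial>mu_measure \<alpha>))"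
        by (subst nn_integral_cmult) (auto simp: nn_integral_cmult nn_integral_sum)
      also have "\<dots> \<le> ennreal (G powr (q - 1)) * (\<Sum>i<K. ennreal ?M)"
      proof (intro mult_left_mono sum_mono)
        fix i
        have li: "l i \<ge> 1" using l by simp
        have "(\<integral>\<^sup>+\<sigma>. ennreal (\<sigma> powr ?c * exp (- l i * \<sigma>)) \<partial>mu_measure \<alpha>)
            = ennreal (mu_const \<alpha> * (Gamma (\<alpha> + ?c + 1) * (2 + l i) powr (- (\<alpha> + ?c + 1))))"
          by (rule nn_integral_mu_powr_exp[OF al]) (use ac x li in linarith)+
        also have "\<dots> = ennreal (?M * (2 + l i) powr (- ?x))" unfolding ac by (simp add: mult.assoc)
        finally have I: "(\<integral>\<^sup>+\<sigma>. ennreal (\<sigma> powr ?c * exp (- l i * \<sigma>)) \<partial>mu_measure \<alpha>) = ennreal (?M * (2 + l i) powr (- ?x))" .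
        have "l i powr ?x * (2 + l i) powr (- ?x) \<le> 1"
        proof -
          have "l i powr ?x \<le> (2 + l i) powr ?x" using li x by (intro powr_mono2) auto
          then show ?thesis using li by (simp add: powr_minus_divide)
        qed
        then have "?M * (l i powr ?x * (2 + l i) powr (- ?x)) \<le> ?M * 1" using M by (intro mult_left_mono) auto
        then show "ennreal (l i powr ?x) * (\<integral>\<^sup>+\<sigma>. ennreal (\<sigma> powr ?c * exp (- l i * \<sigma>)) \<partial>mu_measure \<alpha>) \<le> ennreal ?M"
          unfolding I using M by (subst ennreal_mult[symmetric]) (auto simp: mult.left_commute[of _ ?M] intro!: ennreal_leI)
      qed auto
      also have "\<dots> = ennreal (G powr (q - 1) * ?M * real K)"
        using M by (simp add: ennreal_mult[symmetric] ennreal_of_nat_eq_real_of_nat mult_ac)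
      finally show "(\<integral>\<^sup>+\<sigma>. ennreal (?S \<sigma> powr q) \<partial>mu_measure \<alpha>) \<le> ennreal (G powr (q - 1) * ?M * real K)" .
    qed
  qed
  then obtain C where C: "C > 0" "\<And>K l. (\<And>i. 1 \<le> l i \<and> 2 * l i \<le> l (Suc i)) \<Longrightarrow>
     (\<integral>\<^sup>+\<sigma>. ennreal ((\<Sum>i<K. l i powr ?x * exp (- l i * \<sigma>)) powr q) \<partial>mu_measure \<alpha>) \<le> ennreal (C * real K)"
    by blast
  show ?thesis
  proof (intro exI[of _ C] conjI allI impI)
    show "C > 0" by (rule C)
    fix K d and \<eta> :: real assume eta: "\<eta> > 0" and d: "lacunary_primes d"
    let ?Q = "lacunary_test K d ?x \<eta>"
    define l where "l i = ln (real (nth_prime (d i)))" for i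
    have l: "1 \<le> l i \<and> 2 * l i \<le> l (Suc i)" for i using d by (simp add: lacunary_primes_def l_def)
    have pw: "real (nth_prime (d i)) powr (- s) = exp (- l i * s)" for i s
      using nth_prime_ge_2[of "d i"] by (simp add: l_def powr_def)
    let ?S = "\<lambda>s. \<Sum>i<K. l i powr ?x * exp (- l i * s)"
    have up: "hardy_norm p (dirichlet_shift s ?Q) \<le> \<eta> * ?S s" for s
    proof (rule hardy_norm_le_sup[OF p])
      show "0 \<le> \<eta> * ?S s" using eta by (intro mult_nonneg_nonneg sum_nonneg) auto
      fix z assume z: "z \<in> space torus_haar"
      have "norm (bohr_lift (dirichlet_shift s ?Q) z)
          \<le> (\<Sum>i<K. norm (of_real (\<eta> * l i powr ?x) * of_real (exp (- l i * s)) * prime_monomial (nth_prime (d i)) z))"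
        unfolding lacunary_test_def shift_monomial_sum bohr_lift_monomial_sum[OF finite_lessThan] pw l_def[symmetric] by (rule norm_sum)
      also have "\<dots> = (\<Sum>i<K. \<eta> * (l i powr ?x * exp (- l i * s)))"
        using eta by (intro sum.cong refl) (simp add: norm_mult norm_prime_monomial[OF z])
      finally show "norm (bohr_lift (dirichlet_shift s ?Q) z) \<le> \<eta> * ?S s" by (simp add: sum_distrib_left)
    qed
    have "mixed_moment p q \<alpha> ?Q \<le> (\<integral>\<^sup>+\<sigma>. ennreal (\<eta> powr q) * ennreal (?S \<sigma> powr q) \<partial>mu_measure \<alpha>)"
      unfolding mixed_moment_def
    proof (rule nn_integral_mono)
      fix s
      have "hardy_norm p (dirichlet_shift s ?Q) powr q \<le> (\<eta> * ?S s) powr q" using q up by (intro powr_mono2) auto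
      also have "\<dots> = \<eta> powr q * ?S s powr q" by (rule powr_mult)
      finally show "ennreal (hardy_norm p (dirichlet_shift s ?Q) powr q) \<le> ennreal (\<eta> powr q) * ennreal (?S s powr q)"
        by (simp add: ennreal_mult[symmetric] ennreal_leI)
    qed
    also have "\<dots> = ennreal (\<eta> powr q) * (\<integral>\<^sup>+\<sigma>. ennreal (?S \<sigma> powr q) \<partial>mu_measure \<alpha>)"
      by (rule nn_integral_cmult) (simp cong: measurable_cong_sets)
    also have "\<dots> \<le> ennreal (\<eta> powr q) * ennreal (C * real K)"
      by (intro mult_left_mono C(2) l) auto
    finally have "ennreal (mixed_norm p q \<alpha> ?Q powr q) \<le> ennreal (C * \<eta> powr q * real K)"
      using C(1) by (simp add: mixed_moment_eq[OF dirichlet_poly_lacunary_test p q al] ennreal_mult[symmetric] mult_ac)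
    then show "mixed_norm p q \<alpha> ?Q powr q \<le> C * \<eta> powr q * real K"
      using C(1) by (subst (asm) ennreal_le_iff) auto
  qed
qed


text \<open>The lacunary bound at \<open>X i = l i / 2\<close>, because
  \<open>p powr (- (1 / 2)) = exp (- (ln p / 2))\<close>. The result is independent of the number
  \<open>K\<close> of terms.\<close>

lemma lacunary_test_coeff_sum:
  assumes x: "x > 0"
  shows "\<exists>G>0. \<forall>K d \<eta>. \<eta> > 0 \<longrightarrow> lacunary_primes d \<longrightarrow>
    (\<Sum>n | lacunary_test K d x \<eta> n \<noteq> 0. norm (lacunary_test K d x \<eta> n) * real n powr (- (1 / 2))) \<le> G * \<eta>"
proof -
  obtain G where G: "G > 0" "\<And>X K. (\<And>i. X i > 0 \<and> 2 * X i \<le> X (Suc i)) \<Longrightarrow> (\<Sum>i<K. X i powr x * exp (- X i)) \<le> G"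
    using lacunary_sum_bound[OF x] by blast
  show ?thesis
  proof (intro exI[of _ "2 powr x * G"] conjI allI impI)
    show "2 powr x * G > 0" using G by simp
    fix K d and \<eta> :: real assume eta: "\<eta> > 0" and d: "lacunary_primes d"
    define l where "l i = ln (real (nth_prime (d i)))" for i
    have l: "1 \<le> l i \<and> 2 * l i \<le> l (Suc i)" for i using d by (simp add: lacunary_primes_def l_def)
    have lpos: "l i > 0" for i using l[of i] by linarith
    let ?m = "\<lambda>i. nth_prime (d i)"
    have "(\<Sum>n | lacunary_test K d x \<eta> n \<noteq> 0. norm (lacunary_test K d x \<eta> n) * real n powr (- (1 / 2)))
        \<le> (\<Sum>i<K. norm (complex_of_real (\<eta> * l i powr x)) * real (?m i) powr (- (1 / 2)))"
      unfolding lacunary_test_def l_def by (rule monomial_sum_coeff_sum_le) simp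
    also have "\<dots> = (\<Sum>i<K. \<eta> * 2 powr x * ((l i / 2) powr x * exp (- (l i / 2))))"
    proof (rule sum.cong)
      fix i assume i: "i \<in> {..<K}"
      have "norm (complex_of_real (\<eta> * l i powr x)) = \<eta> * l i powr x"
        using eta by (simp add: norm_mult)
      moreover have "real (?m i) powr (- (1 / 2)) = exp (- (l i / 2))"
        using nth_prime_ge_2[of "d i"] by (simp add: l_def powr_def)
      moreover have "l i powr x = 2 powr x * (l i / 2) powr x" using lpos[of i] by (simp add: powr_divide)
      ultimately show "norm (complex_of_real (\<eta> * l i powr x)) * real (?m i) powr (- (1 / 2)) = \<eta> * 2 powr x * ((l i / 2) powr x * exp (- (l i / 2)))"
        by (simp only: mult.assoc)
    qed simp
    also have "\<dots> = \<eta> * 2 powr x * (\<Sum>i<K. (l i / 2) powr x * exp (- (l i / 2)))" by (rule sum_distrib_left[symmetric])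
    also have "\<dots> \<le> \<eta> * 2 powr x * G"
    proof (rule mult_left_mono[OF G(2)])
      show "0 < l i / 2 \<and> 2 * (l i / 2) \<le> l (Suc i) / 2" for i using l[of i] lpos[of i] by simp
    qed (use eta in simp)
    finally show "(\<Sum>n | lacunary_test K d x \<eta> n \<noteq> 0. norm (lacunary_test K d x \<eta> n) * real n powr (- (1 / 2))) \<le> 2 powr x * G * \<eta>"
      by (simp only: mult_ac)
  qed
qed

text \<open>For \<open>s\<close> between \<open>1 / (2 * l i)\<close> and \<open>1 / l i\<close> the
  \<open>i\<close>-th monomial alone is used: its coefficient bounds the Hardy norm from below and
  its decay is at most a factor \<open>exp (- 1)\<close>. These intervals are disjoint since the
  \<open>l i\<close> at least double, so the contributions add.\<close>

lemma lacunary_test_lower: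
  assumes u: "u > 0" and v: "v > 0" and be: "\<beta> > -1"
  shows "\<exists>c>0. \<forall>K d x \<eta>. \<eta> > 0 \<longrightarrow> lacunary_primes d \<longrightarrow>
    c * \<eta> powr v * (\<Sum>i<K. ln (real (nth_prime (d i))) powr (v * (x - (\<beta> + 1) / v)))
      \<le> mixed_norm u v \<beta> (lacunary_test K d x \<eta>) powr v"
proof -
  obtain c where c: "c > 0" "\<And>s. 0 < s \<Longrightarrow> s \<le> 1 \<Longrightarrow> ennreal (c * s powr (\<beta> + 1)) \<le> emeasure (mu_measure \<beta>) {s/2<..s}"
    using mu_measure_interval[OF be] by blast
  \<comment> \<open>\<open>2 * 3 powr (1 / u)\<close> is the coefficient constant of a single prime
    at radius \<open>1/2\<close>; \<open>exp (- 1)\<close> is the least shift factor on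
    \<open>I i\<close>.\<close>
  define k where "k = 1 / (2 * 3 powr (1 / u)) * exp (- 1)"
  have k: "k > 0" by (simp add: k_def)
  show ?thesis
  proof (intro exI[of _ "k powr v * c"] conjI allI impI)
    show "k powr v * c > 0" using k c by simp
    fix K d and x \<eta> :: real assume eta: "\<eta> > 0" and d: "lacunary_primes d"
    let ?Q = "lacunary_test K d x \<eta>"
    note Qp = dirichlet_poly_lacunary_test[of K d x \<eta>]
    define l where "l i = ln (real (nth_prime (d i)))" for i
    have l: "1 \<le> l i \<and> 2 * l i \<le> l (Suc i)" for i using d by (simp add: lacunary_primes_def l_def)
    have lpos: "l i > 0" for i using l[of i] by linarith
    let ?m = "\<lambda>i. nth_prime (d i)"
    have inj: "inj ?m" by (rule strict_mono_imp_inj_on[OF lacunary_primes_strict_mono[OF d]])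
    define I where "I i = {(1 / l i) / 2<..1 / l i}" for i
    have low: "k * (\<eta> * l i powr x) \<le> hardy_norm u (dirichlet_shift s ?Q)" if i: "i < K" and s: "s \<in> I i" for i s
    proof -
      have sl: "s * l i \<le> 1" using s lpos[of i] by (simp add: I_def field_simps)
      have "real (?m i) powr (- s) = exp (- (s * l i))"
        using nth_prime_ge_2[of "d i"] by (simp add: l_def powr_def)
      then have e: "exp (- 1) \<le> real (?m i) powr (- s)" using sl by simp
      have val: "dirichlet_shift s ?Q (?m i) = of_real (\<eta> * l i powr x) * of_real (real (?m i) powr (- s))"
        unfolding lacunary_test_def shift_monomial_sum l_def using i by (subst monomial_sum_at[OF inj]) auto
      have "exp (- 1) * (\<eta> * l i powr x) \<le> real (?m i) powr (- s) * (\<eta> * l i powr x)"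
        using e eta by (intro mult_right_mono) auto
      also have "\<dots> = norm (dirichlet_shift s ?Q (?m i))" unfolding val using eta by (simp add: norm_mult)
      also have "\<dots> \<le> (\<Prod>j | prime_exponent (?m i) j \<noteq> 0. ((1 + 1/2) / (1 - 1/2)) powr (1 / u) * (1 / (1/2)) ^ prime_exponent (?m i) j)
          * hardy_norm u (dirichlet_shift s ?Q)"
        using Qp u prime_gt_0_nat[OF prime_nth_prime] by (intro hardy_coeff_bound_radius) auto
      also have "{j. prime_exponent (?m i) j \<noteq> 0} = {d i}" by (auto simp: prime_exponent_nth_prime)
      also have "(\<Prod>j\<in>{d i}. ((1 + 1/2) / (1 - 1/2)) powr (1 / u) * (1 / (1/2)) ^ prime_exponent (?m i) j) = 2 * 3 powr (1 / u)"
        by (simp add: prime_exponent_nth_prime)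
      finally show ?thesis by (simp add: k_def field_simps)
    qed
    have dec: "l i * 2 \<le> l j" if "i < j" for i j
      using that
    proof (induction j)
      case (Suc j)
      show ?case
      proof (cases "i = j")
        case True
        then show ?thesis using l[of j] by simp
      next
        case False
        then have "l i * 2 \<le> l j" using Suc by simp
        then show ?thesis using l[of j] lpos[of j] by linarith
      qed
    qed simp
    have disj: "i = j" if "s \<in> I i" "s \<in> I j" for i j s
    proof (rule ccontr)
      assume "i \<noteq> j"
      moreover have False if "i < j" "s \<in> I i" "s \<in> I j" for i j
      proof -
        have "1 / l j \<le> 1 / (l i * 2)" using dec[OF that(1)] lpos by (intro divide_left_mono) auto
        then show False using that(2,3) by (simp add: I_def)
      qed
      ultimately show False using that by (metis linorder_neqE_nat)
    qed
    let ?A = "\<lambda>i. (k * (\<eta> * l i powr x)) powr v"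
    have "(\<Sum>i<K. ennreal (?A i) * emeasure (mu_measure \<beta>) (I i))
        = (\<integral>\<^sup>+s. (\<Sum>i<K. ennreal (?A i) * indicator (I i) s) \<partial>mu_measure \<beta>)"
      by (subst nn_integral_sum) (auto simp: nn_integral_cmult_indicator I_def)
    also have "\<dots> \<le> mixed_moment u v \<beta> ?Q"
      unfolding mixed_moment_def
    proof (rule nn_integral_mono)
      fix s
      show "(\<Sum>i<K. ennreal (?A i) * indicator (I i) s) \<le> ennreal (hardy_norm u (dirichlet_shift s ?Q) powr v)"
      proof (cases "\<exists>i<K. s \<in> I i")
        case True
        then obtain i where i: "i < K" "s \<in> I i" by blast
        have "(\<Sum>j<K. ennreal (?A j) * indicator (I j) s) = (\<Sum>j\<in>{i}. ennreal (?A j) * indicator (I j) s)"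
          using i disj by (intro sum.mono_neutral_right) (auto simp: indicator_def)
        also have "\<dots> = ennreal (?A i)" using i by simp
        also have "\<dots> \<le> ennreal (hardy_norm u (dirichlet_shift s ?Q) powr v)"
          using low[OF i] v k eta by (intro ennreal_leI powr_mono2) auto
        finally show ?thesis .
      next
        case False
        then have "(\<Sum>i<K. ennreal (?A i) * indicator (I i) s) = 0" by (intro sum.neutral) (auto simp: indicator_def)
        then show ?thesis by simp
      qed
    qed
    also have "\<dots> = ennreal (mixed_norm u v \<beta> ?Q powr v)" by (rule mixed_moment_eq[OF Qp u v be])
    finally have up: "(\<Sum>i<K. ennreal (?A i) * emeasure (mu_measure \<beta>) (I i)) \<le> ennreal (mixed_norm u v \<beta> ?Q powr v)" .
    have "ennreal (k powr v * c * \<eta> powr v * (\<Sum>i<K. l i powr (v * (x - (\<beta> + 1) / v))))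
        = (\<Sum>i<K. ennreal (k powr v * c * \<eta> powr v * l i powr (v * (x - (\<beta> + 1) / v))))"
      using c by (simp add: sum_ennreal sum_distrib_left)
    also have "\<dots> \<le> (\<Sum>i<K. ennreal (?A i) * emeasure (mu_measure \<beta>) (I i))"
    proof (rule sum_mono)
      fix i
      have "v * (x - (\<beta> + 1) / v) = x * v + - (\<beta> + 1)" using v by (simp add: right_diff_distrib)
      then have "l i powr (v * (x - (\<beta> + 1) / v)) = (l i powr x) powr v * (1 / l i) powr (\<beta> + 1)"
      proof -
        have "(1 / l i) powr (\<beta> + 1) = l i powr (- (\<beta> + 1))"
          unfolding powr_minus_divide by (subst powr_divide) (use lpos[of i] in simp_all)
        then show ?thesis using \<open>v * (x - (\<beta> + 1) / v) = _\<close> by (simp only: powr_add powr_powr)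
      qed
      then have "k powr v * c * \<eta> powr v * l i powr (v * (x - (\<beta> + 1) / v)) = ?A i * (c * (1 / l i) powr (\<beta> + 1))"
        using k eta by (simp add: powr_mult)
      then have "ennreal (k powr v * c * \<eta> powr v * l i powr (v * (x - (\<beta> + 1) / v))) = ennreal (?A i) * ennreal (c * (1 / l i) powr (\<beta> + 1))"
        using c by (simp only: ennreal_mult powr_ge_zero mult_nonneg_nonneg less_imp_le)
      also have "\<dots> \<le> ennreal (?A i) * emeasure (mu_measure \<beta>) (I i)"
        unfolding I_def using l[of i] by (intro mult_left_mono c) auto
      finally show "ennreal (k powr v * c * \<eta> powr v * l i powr (v * (x - (\<beta> + 1) / v))) \<le> ennreal (?A i) * emeasure (mu_measure \<beta>) (I i)" .
    qed
    also note up
    finally show "k powr v * c * \<eta> powr v * (\<Sum>i<K. ln (real (nth_prime (d i))) powr (v * (x - (\<beta> + 1) / v))) \<le> mixed_norm u v \<beta> ?Q powr v"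
      unfolding l_def by simp
  qed
qed

section \<open>Necessity of the conditions\<close>

lemma powr_root_le:
  assumes "v > 0" "0 < \<epsilon>" "0 \<le> y" "(1 / \<epsilon>) powr v \<le> y powr v"
  shows "1 / \<epsilon> \<le> (y::real)"
  using assms by (subst (asm) powr_le_iff_nonneg) auto

lemma lacunary_test_support:
  assumes "\<And>i. j \<le> d i"
  shows "prime_support (lacunary_test K d x \<eta>) \<subseteq> {j..}" "lacunary_test K d x \<eta> 1 = 0"
proof -
  show "prime_support (lacunary_test K d x \<eta>) \<subseteq> {j..}"
  proof
    fix i assume "i \<in> prime_support (lacunary_test K d x \<eta>)"
    then obtain n where n: "lacunary_test K d x \<eta> n \<noteq> 0" "prime_exponent n i \<noteq> 0"
      unfolding prime_support_def by blast
    then obtain k where "n = nth_prime (d k)" unfolding lacunary_test_def using monomial_sum_nonzero by blast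
    then have "i = d k" using n(2) by (simp add: prime_exponent_nth_prime split: if_splits)
    then show "i \<in> {j..}" using assms by simp
  qed
  have "nth_prime (d k) \<noteq> 1" for k using nth_prime_ge_2[of "d k"] by simp
  then show "lacunary_test K d x \<eta> 1 = 0" unfolding lacunary_test_def using monomial_sum_nonzero by (metis imageE)
qed

text \<open>If the weights are strictly wrong, a single monomial at a large prime is enough. In the
  balanced case single monomials show nothing, but \<open>K\<close> of them distinguish the growth
  rates \<open>K powr (1 / q)\<close> and \<open>K powr (1 / v)\<close>.\<close>

lemma not_subset_of_weights:
  assumes pos: "0 < p" "0 < q" "0 < u" "0 < v" and al: "\<alpha> > -1" and be: "\<beta> > -1"
    and cond: "(\<beta> + 1) / v < (\<alpha> + 1) / q \<or> (\<alpha> + 1) / q = (\<beta> + 1) / v \<and> v < q"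
  shows "\<not> mixed_norm_space p q \<alpha> \<subseteq> mixed_norm_space u v \<beta>"
proof (rule gliding_hump[OF pos al be])
  fix \<epsilon> :: real and j :: nat assume \<epsilon>: "\<epsilon> > 0"
  let ?x = "(\<alpha> + 1) / q" and ?y = "(\<beta> + 1) / v"
  have x: "?x > 0" using al pos by simp
  obtain C where C: "C > 0" "\<And>K d \<eta>. \<eta> > 0 \<Longrightarrow> lacunary_primes d \<Longrightarrow>
    mixed_norm p q \<alpha> (lacunary_test K d ?x \<eta>) powr q \<le> C * \<eta> powr q * real K"
    using lacunary_test_upper[OF pos(1,2) al] by blast
  obtain G where G: "G > 0" "\<And>K d \<eta>. \<eta> > 0 \<Longrightarrow> lacunary_primes d \<Longrightarrow>
    (\<Sum>n | lacunary_test K d ?x \<eta> n \<noteq> 0. norm (lacunary_test K d ?x \<eta> n) * real n powr (- (1 / 2))) \<le> G * \<eta>"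
    using lacunary_test_coeff_sum[OF x] by blast
  obtain c where c: "c > 0" "\<And>K d x \<eta>. \<eta> > 0 \<Longrightarrow> lacunary_primes d \<Longrightarrow>
    c * \<eta> powr v * (\<Sum>i<K. ln (real (nth_prime (d i))) powr (v * (x - ?y)))
      \<le> mixed_norm u v \<beta> (lacunary_test K d x \<eta>) powr v"
    using lacunary_test_lower[OF pos(3,4) be] by blast
  have "\<exists>(K::nat) d \<eta>. \<eta> > 0 \<and> lacunary_primes d \<and> (\<forall>i. j \<le> d i) \<and> C * \<eta> powr q * real K \<le> \<epsilon> \<and> G * \<eta> \<le> \<epsilon> \<and>
      (1 / \<epsilon>) powr v \<le> c * \<eta> powr v * (\<Sum>i<K. ln (real (nth_prime (d i))) powr (v * (?x - ?y)))"
    using cond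
  proof
    assume less: "?y < ?x"
    \<comment> \<open>Half of the gap: with \<open>\<eta> = t powr (- \<delta>)\<close> the source
      norm decays like \<open>t powr (- \<delta>)\<close>, while the target norm still grows like
      \<open>t powr \<delta>\<close>.\<close>
    define \<delta> where "\<delta> = (?x - ?y) / 2"
    have \<delta>: "\<delta> > 0" using less by (simp add: \<delta>_def)
    have "((\<lambda>t::real. C * t powr (- (\<delta> * q))) \<longlongrightarrow> 0) at_top" using \<delta> pos by real_asymp
    then have 1: "\<forall>\<^sub>F t in at_top. C * t powr (- (\<delta> * q)) < \<epsilon>" using \<epsilon> by (rule order_tendstoD)
    have "((\<lambda>t::real. G * t powr (- \<delta>)) \<longlongrightarrow> 0) at_top" using \<delta> by real_asymp
    then have 2: "\<forall>\<^sub>F t in at_top. G * t powr (- \<delta>) < \<epsilon>" using \<epsilon> by (rule order_tendstoD)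
    have "filterlim (\<lambda>t::real. c * t powr (\<delta> * v)) at_top at_top" using \<delta> c(1) pos by real_asymp
    then have 3: "\<forall>\<^sub>F t in at_top. (1 / \<epsilon>) powr v < c * t powr (\<delta> * v)" by (simp add: filterlim_at_top_dense)
    have "\<forall>\<^sub>F t in at_top. C * t powr (- (\<delta> * q)) < \<epsilon> \<and> G * t powr (- \<delta>) < \<epsilon> \<and> (1 / \<epsilon>) powr v < c * t powr (\<delta> * v)"
      using 1 2 3 by eventually_elim blast
    then obtain L where L: "\<And>t. t \<ge> L \<Longrightarrow> C * t powr (- (\<delta> * q)) < \<epsilon> \<and> G * t powr (- \<delta>) < \<epsilon> \<and> (1 / \<epsilon>) powr v < c * t powr (\<delta> * v)"
      unfolding eventually_at_top_linorder by blast
    obtain d where d: "lacunary_primes d" "\<And>i. j \<le> d i" "L \<le> ln (real (nth_prime (d 0)))"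
      using ex_lacunary_primes[of j L] by blast
    define t where "t = ln (real (nth_prime (d 0)))"
    have t: "t \<ge> 1" using d(1) by (simp add: lacunary_primes_def t_def)
    have "(t powr (- \<delta>)) powr v * t powr (v * (?x - ?y)) = t powr (\<delta> * v)"
    proof -
      have "- \<delta> * v + v * (?x - ?y) = \<delta> * v" by (simp add: \<delta>_def field_simps)
      then show ?thesis unfolding powr_powr powr_add[symmetric] by (simp only:)
    qed
    then have 4: "c * (t powr (- \<delta>)) powr v * t powr (v * (?x - ?y)) = c * t powr (\<delta> * v)" by (simp only: mult.assoc)
    show ?thesis
    proof (intro exI conjI allI)
      show "t powr (- \<delta>) > 0" using t by simp
      show "lacunary_primes d" by (rule d)
      show "j \<le> d i" for i by (rule d)
      show "C * (t powr (- \<delta>)) powr q * real 1 \<le> \<epsilon>" "G * t powr (- \<delta>) \<le> \<epsilon>"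
        using L[of t] d(3) by (auto simp: t_def powr_powr less_imp_le)
      have "(\<Sum>i<1. ln (real (nth_prime (d i))) powr (v * (?x - ?y))) = t powr (v * (?x - ?y))" by (simp add: t_def)
      then show "(1 / \<epsilon>) powr v \<le> c * (t powr (- \<delta>)) powr v * (\<Sum>i<1. ln (real (nth_prime (d i))) powr (v * (?x - ?y)))"
        using L[of t] d(3) by (simp only: 4) (simp add: t_def less_imp_le)
    qed
  next
    assume eq: "?x = ?y \<and> v < q"
    \<comment> \<open>Any exponent strictly between \<open>1 / q\<close> and \<open>1 / v\<close>
      would do. With \<open>\<eta> = K powr (- s)\<close> the source bound
      \<open>K powr (1 - s * q)\<close> vanishes and the target bound
      \<open>K powr (1 - s * v)\<close> explodes.\<close>
    define s where "s = (1 / q + 1 / v) / 2"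
    have s: "s > 0" "s * q > 1" "s * v < 1" using pos eq by (auto simp: s_def field_simps)
    have "((\<lambda>t::nat. C * (real t powr (- s)) powr q * real t) \<longlonglongrightarrow> 0)" using s pos by real_asymp
    then have 1: "\<forall>\<^sub>F t in sequentially. C * (real t powr (- s)) powr q * real t < \<epsilon>" using \<epsilon> by (rule order_tendstoD)
    have "((\<lambda>t::nat. G * real t powr (- s)) \<longlonglongrightarrow> 0)" using s by real_asymp
    then have 2: "\<forall>\<^sub>F t in sequentially. G * real t powr (- s) < \<epsilon>" using \<epsilon> by (rule order_tendstoD)
    have "filterlim (\<lambda>t::nat. c * (real t powr (- s)) powr v * real t) at_top at_top" using s c(1) pos by real_asymp
    then have 3: "\<forall>\<^sub>F t in sequentially. (1 / \<epsilon>) powr v < c * (real t powr (- s)) powr v * real t" by (simp add: filterlim_at_top_dense)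
    have "\<forall>\<^sub>F t in sequentially. C * (real t powr (- s)) powr q * real t < \<epsilon> \<and> G * real t powr (- s) < \<epsilon> \<and>
        (1 / \<epsilon>) powr v < c * (real t powr (- s)) powr v * real t \<and> t > 0"
      using 1 2 3 eventually_gt_at_top[of 0] by eventually_elim blast
    then obtain K where K: "C * (real K powr (- s)) powr q * real K < \<epsilon>" "G * real K powr (- s) < \<epsilon>"
        "(1 / \<epsilon>) powr v < c * (real K powr (- s)) powr v * real K" "K > 0"
      unfolding eventually_sequentially by blast
    obtain d where d: "lacunary_primes d" "\<And>i. j \<le> d i" using ex_lacunary_primes[of j] by blast
    have "ln (real (nth_prime (d i))) powr (v * (?x - ?y)) = 1" for i
    proof -
      have "ln (real (nth_prime (d i))) \<ge> 1" using d(1) by (simp add: lacunary_primes_def)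
      moreover have "v * (?x - ?y) = 0" using eq by simp
      ultimately show ?thesis by (simp only:) simp
    qed
    then have "(\<Sum>i<K. ln (real (nth_prime (d i))) powr (v * (?x - ?y))) = real K" by simp
    with K d show ?thesis by (intro exI[of _ K] exI[of _ d] exI[of _ "real K powr (- s)"]) (simp add: less_imp_le)
  qed
  then obtain K :: nat and d \<eta> where Kd: "\<eta> > 0" "lacunary_primes d" "\<And>i. j \<le> d i" "C * \<eta> powr q * real K \<le> \<epsilon>" "G * \<eta> \<le> \<epsilon>"
      "(1 / \<epsilon>) powr v \<le> c * \<eta> powr v * (\<Sum>i<K. ln (real (nth_prime (d i))) powr (v * (?x - ?y)))"
    by blast
  let ?Q = "lacunary_test K d ?x \<eta>"
  have "1 / \<epsilon> \<le> mixed_norm u v \<beta> ?Q"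
    using Kd(6) c(2)[OF Kd(1,2), where K = K and x = ?x] by (intro powr_root_le[OF pos(4) \<epsilon>]) auto
  moreover have "mixed_norm p q \<alpha> ?Q powr q \<le> \<epsilon>" using C(2)[OF Kd(1,2), where K = K] Kd(4) by linarith
  moreover have "(\<Sum>n | ?Q n \<noteq> 0. norm (?Q n) * real n powr (- (1 / 2))) \<le> \<epsilon>" using G(2)[OF Kd(1,2), where K = K] Kd(5) by linarith
  ultimately show "\<exists>Q. dirichlet_poly Q \<and> Q 1 = 0 \<and> prime_support Q \<subseteq> {j..} \<and>
      mixed_norm p q \<alpha> Q powr q \<le> \<epsilon> \<and> (\<Sum>n | Q n \<noteq> 0. norm (Q n) * real n powr (- (1 / 2))) \<le> \<epsilon> \<and>
      1 / \<epsilon> \<le> mixed_norm u v \<beta> Q"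
    using lacunary_test_support[of j d K ?x \<eta>, OF Kd(3)] dirichlet_poly_lacunary_test by blast
qed

section \<open>An exponential bound for the primes\<close>

lemma prime_exponent_mult:
  assumes "m > 0" "n > 0"
  shows "prime_exponent (m * n) j = prime_exponent m j + prime_exponent n j"
  unfolding prime_exponent_def using assms prime_nth_prime[of j]
  by (intro prime_elem_multiplicity_mult_distrib) auto

lemma prod_nth_prime_pos: "(\<Prod>j\<in>S. nth_prime j) > 0"
  by (intro prod_pos) (simp add: prime_gt_0_nat prime_nth_prime)

lemma prime_exponent_prod_nth_prime:
  "finite S \<Longrightarrow> prime_exponent (\<Prod>j\<in>S. nth_prime j) i = (if i \<in> S then 1 else 0)"
proof (induction S rule: finite_induct)
  case (insert j S)
  then show ?case
    by (auto simp: prime_exponent_mult prod_nth_prime_pos prime_gt_0_nat prime_nth_prime prime_exponent_nth_prime)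
qed simp

text \<open>Erdos' counting argument: every \<open>n \<le> nth_prime j\<close> is a square times a product of distinct primes among the first \<open>j + 1\<close>.\<close>

lemma nth_prime_le_4_power: "nth_prime j \<le> 4 ^ Suc j"
proof -
  define x where "x = nth_prime j"
  define s where "s = Max {s. s\<^sup>2 \<le> x}"
  have fin: "finite {s. s\<^sup>2 \<le> x}"
    by (rule finite_subset[of _ "{..x}"]) (auto simp: power2_eq_square intro: order_trans[OF le_square])
  have s: "s\<^sup>2 \<le> x" 
  proof -
    have "0 \<in> {s. s\<^sup>2 \<le> x}" by simp
    then have "Max {s. s\<^sup>2 \<le> x} \<in> {s. s\<^sup>2 \<le> x}" using Max_in[OF fin] by blast
    then show ?thesis unfolding s_def by simp
  qed
  let ?sq = "\<lambda>n. \<Prod>i\<le>j. nth_prime i ^ (prime_exponent n i div 2)"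
  let ?odd = "\<lambda>n. {i\<in>{..j}. odd (prime_exponent n i)}"
  have decomp: "n = (?sq n)\<^sup>2 * (\<Prod>i\<in>?odd n. nth_prime i)" if n: "n \<in> {1..x}" for n
  proof -
    have J: "i \<in> {..j}" if "prime_exponent n i \<noteq> 0" for i
    proof -
      have "nth_prime i \<le> n" using nth_prime_dvd[OF that] n by (intro dvd_imp_le) auto
      then have "nth_prime i \<le> nth_prime j" using n by (simp add: x_def)
      then show ?thesis using strict_mono_less_eq[OF strict_mono_nth_prime] by simp
    qed
    have "n = (\<Prod>i\<le>j. nth_prime i ^ prime_exponent n i)"
      using prod_nth_prime_exponent[of n "{..j}"] J n by simp
    also have "\<dots> = (\<Prod>i\<le>j. (nth_prime i ^ (prime_exponent n i div 2))\<^sup>2 * (if odd (prime_exponent n i) then nth_prime i else 1))"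
    proof (rule prod.cong)
      fix i
      have "prime_exponent n i = prime_exponent n i div 2 * 2 + (if odd (prime_exponent n i) then 1 else 0)"
        by (cases "even (prime_exponent n i)") (auto elim!: evenE oddE)
      then have "nth_prime i ^ prime_exponent n i = nth_prime i ^ (prime_exponent n i div 2 * 2 + (if odd (prime_exponent n i) then 1 else 0))"
        by simp
      then show "nth_prime i ^ prime_exponent n i = (nth_prime i ^ (prime_exponent n i div 2))\<^sup>2 * (if odd (prime_exponent n i) then nth_prime i else 1)"
        unfolding power_add power_mult by simp
    qed simp
    also have "\<dots> = (?sq n)\<^sup>2 * (\<Prod>i\<in>?odd n. nth_prime i)"
    proof -
      have "(\<Prod>i\<le>j. if odd (prime_exponent n i) then nth_prime i else 1) = (\<Prod>i\<in>?odd n. nth_prime i)"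
        by (rule prod.inter_filter[symmetric]) simp
      then show ?thesis unfolding prod.distrib prod_power_distrib[symmetric] by (simp only:)
    qed
    finally show ?thesis .
  qed
  have inj: "inj_on (\<lambda>n. (?sq n, ?odd n)) {1..x}"
  proof (rule inj_onI)
    fix m n assume m: "m \<in> {1..x}" and n: "n \<in> {1..x}" and e: "(?sq m, ?odd m) = (?sq n, ?odd n)"
    have "?sq m = ?sq n" "?odd m = ?odd n" using e by (simp_all only: prod.inject)
    then have "(?sq m)\<^sup>2 * (\<Prod>i\<in>?odd m. nth_prime i) = (?sq n)\<^sup>2 * (\<Prod>i\<in>?odd n. nth_prime i)" by (simp only:)
    then show "m = n" using decomp[OF m] decomp[OF n] by (simp only:)
  qed
  have sub: "(\<lambda>n. (?sq n, ?odd n)) ` {1..x} \<subseteq> {1..s} \<times> Pow {..j}"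
  proof safe
    fix n assume n: "n \<in> {1..x}"
    have pos: "?sq n > 0" by (intro prod_pos) (simp add: prime_gt_0_nat prime_nth_prime)
    have "(?sq n)\<^sup>2 * 1 \<le> (?sq n)\<^sup>2 * (\<Prod>i\<in>?odd n. nth_prime i)"
      using prod_nth_prime_pos[of "?odd n"] by (intro mult_left_mono) (simp_all only: Suc_le_eq One_nat_def zero_le)
    also have "\<dots> \<le> x" using decomp[OF n] n by simp
    finally have "?sq n \<le> s" unfolding s_def by (intro Max_ge[OF fin]) simp
    then show "?sq n \<in> {1..s}" using pos by (simp only: atLeastAtMost_iff Suc_le_eq One_nat_def simp_thms)
  qed
  have "card {1..x} \<le> card ({1..s} \<times> Pow {..j})"
    by (rule card_inj_on_le[OF inj sub]) simp
  \<comment> \<open>At most \<open>s\<close> square roots and \<open>2 ^ Suc j\<close> sets of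
    primes are available for the \<open>x\<close> numbers. Squaring and \<open>s^2 \<le> x\<close>
    leave \<open>x \<le> 4 ^ Suc j\<close>.\<close>
  then have "x \<le> s * 2 ^ Suc j" by (simp add: card_cartesian_product card_Pow)
  then have "x\<^sup>2 \<le> (s * 2 ^ Suc j)\<^sup>2" by (intro power_mono) auto
  also have "\<dots> = s\<^sup>2 * (2\<^sup>2) ^ Suc j" by (metis mult.commute power_mult power_mult_distrib)
  also have "\<dots> = s\<^sup>2 * 4 ^ Suc j" by simp
  also have "\<dots> \<le> x * 4 ^ Suc j" using s by (intro mult_right_mono) auto
  finally have "x * x \<le> x * 4 ^ Suc j" by (simp add: power2_eq_square)
  moreover have "x > 0" by (simp add: x_def prime_gt_0_nat prime_nth_prime)
  ultimately show ?thesis by (simp add: x_def)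
qed

text \<open>Linear growth of the logarithms is the form in which the bound is used: a shift of order
  \<open>1 / (N + j + 1)\<close> keeps \<open>p_i powr (- \<sigma>)\<close> away from
  \<open>0\<close> for all \<open>i \<le> j + N\<close> at once.\<close>

lemma ln_nth_prime_le: "ln (real (nth_prime j)) \<le> real (Suc j) * ln 4"
proof -
  have "real (nth_prime j) \<le> real (4 ^ Suc j)" using nth_prime_le_4_power[of j] by (simp only: of_nat_le_iff)
  then have "ln (real (nth_prime j)) \<le> ln (real (4 ^ Suc j))"
    using nth_prime_ge_2[of j] by (intro ln_mono) auto
  moreover have "ln (real (4 ^ Suc j)) = real (Suc j) * ln 4" by (simp add: ln_realpow del: power_Suc)
  ultimately show ?thesis by simp
qed

section \<open>Moments of \<open>1 + r z\<close> on the circle\<close>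

definition linear_mean :: "real \<Rightarrow> real \<Rightarrow> real" where
  "linear_mean p r = integral {0..2*pi} (\<lambda>t. norm (1 + of_real r * cis t) powr p) / (2 * pi)"

lemma linear_mean_nonneg: "p > 0 \<Longrightarrow> 0 \<le> linear_mean p r"
  unfolding linear_mean_def
  by (intro divide_nonneg_pos integral_nonneg integrable_continuous_interval continuous_on_powr' continuous_intros) auto

lemma nn_integral_linear_mean:
  assumes "p > 0"
  shows "(\<integral>\<^sup>+z. ennreal (norm (1 + of_real r * z) powr p) \<partial>circle_haar) = ennreal (linear_mean p r)"
  unfolding linear_mean_def using assms
  by (intro nn_integral_circle_haar continuous_on_powr' continuous_intros) auto

text \<open>The Poisson inequality for \<open>1 + z\<close> at the centre, where the kernel is
  constantly \<open>1\<close>. It also provides a positive base point for the tangent in the strict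
  comparison that follows.\<close>

lemma linear_mean_ge_1:
  assumes p: "p > 0"
  shows "1 \<le> linear_mean p 1"
proof -
  have "ennreal (norm (poly [:1, 1:] (of_real 0 :: complex)) powr p)
      \<le> (\<integral>\<^sup>+z. ennreal (circle_kernel 0 z) * ennreal (norm (poly [:1, 1:] z) powr p) \<partial>circle_haar)"
    by (rule poly_poisson_circle[OF _ _ p]) auto
  also have "\<dots> = (\<integral>\<^sup>+z. ennreal (norm (1 + of_real 1 * z) powr p) \<partial>circle_haar)"
    by (intro nn_integral_cong) (simp add: circle_kernel_def)
  also have "\<dots> = ennreal (linear_mean p 1)" by (rule nn_integral_linear_mean[OF p])
  finally show ?thesis using linear_mean_nonneg[OF p, of 1] by simp
qed

text \<open>Jensen's inequality is strict because \<open>|1 + z|\<close> is not constant on the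
  circle: the defect \<open>g\<close> in the tangent inequality is continuous, nonnegative, and
  positive somewhere.\<close>

lemma linear_mean_strict:
  assumes p: "0 < p" and pu: "p < u"
  shows "linear_mean p 1 powr (1 / p) < linear_mean u 1 powr (1 / u)"
proof -
  let ?A = "linear_mean p 1" and ?t = "u / p"
  let ?f = "\<lambda>t. norm (1 + of_real 1 * cis t) powr p"
  have A: "?A \<ge> 1" by (rule linear_mean_ge_1[OF p])
  have t: "?t > 1" using p pu by simp
  have cf: "continuous_on {0..2*pi} ?f"
    using p by (intro continuous_on_powr' continuous_intros) auto
  define g where "g s = ?f s powr ?t - (?A powr ?t + ?t * ?A powr (?t - 1) * (?f s - ?A))" for s
  have pw: "?f s powr ?t = norm (1 + of_real 1 * cis s) powr u" for s using p by (simp add: powr_powr)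
  have cu: "continuous_on {0..2*pi} (\<lambda>s. norm (1 + of_real 1 * cis s) powr u)"
    using p pu by (intro continuous_on_powr' continuous_intros) auto
  have cg: "continuous_on {0..2*pi} g"
    unfolding g_def pw by (intro continuous_on_diff continuous_on_add continuous_on_mult continuous_on_const cf cu)
  have g0: "g s \<ge> 0" for s
    unfolding g_def using powr_tangent(1)[of "?f s" ?A ?t] A t by simp
  \<comment> \<open>At \<open>pi\<close> the factor \<open>1 + z\<close> vanishes, whereas its mean
    is at least \<open>1\<close>, so the strict tangent inequality applies there.\<close>
  have "g pi > 0"
    unfolding g_def using powr_tangent(2)[of "?f pi" ?A ?t] A t p by simp
  then have "integral {0..2*pi} g \<noteq> 0"
    using integral_eq_0_iff[OF cg] g0 by (auto intro!: bexI[of _ pi])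
  moreover have "integral {0..2*pi} g \<ge> 0"
    by (intro integral_nonneg integrable_continuous_interval cg g0)
  ultimately have pos: "integral {0..2*pi} g > 0" by simp
  have int_f: "?f integrable_on {0..2*pi}" by (rule integrable_continuous_interval[OF cf])
  have int_u: "(\<lambda>s. norm (1 + of_real 1 * cis s) powr u) integrable_on {0..2*pi}"
    by (rule integrable_continuous_interval[OF cu])
  have hf: "(?f has_integral (2 * pi * ?A)) {0..2*pi}"
    using integrable_integral[OF int_f] by (simp add: linear_mean_def)
  have hu: "((\<lambda>s. norm (1 + of_real 1 * cis s) powr u) has_integral (2 * pi * linear_mean u 1)) {0..2*pi}"
    using integrable_integral[OF int_u] by (simp add: linear_mean_def)
  have hc: "((\<lambda>s. c) has_integral (2 * pi * c)) {0..2*pi}" for c :: real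
    using has_integral_const_real[of c 0 "2 * pi"] by simp
  have "(g has_integral (2 * pi * linear_mean u 1
      - (2 * pi * ?A powr ?t + ?t * ?A powr (?t - 1) * (2 * pi * ?A - 2 * pi * ?A)))) {0..2*pi}"
    unfolding g_def pw by (intro has_integral_diff has_integral_add has_integral_mult_right hf hc hu)
  then have "integral {0..2*pi} g = 2 * pi * linear_mean u 1 - 2 * pi * ?A powr ?t"
    by (simp add: integral_unique)
  then have "2 * pi * ?A powr ?t < 2 * pi * linear_mean u 1" using pos by linarith
  then have "?A powr ?t < linear_mean u 1" by simp
  then have "(?A powr ?t) powr (1 / u) < linear_mean u 1 powr (1 / u)" using p pu by (intro powr_less_mono2) auto
  then show ?thesis using p pu by (simp add: powr_powr)
qed

lemma continuous_linear_mean: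
  assumes "u > 0"
  shows "continuous_on {0..1} (linear_mean u)"
proof -
  have "continuous_on {0..1} (\<lambda>r. integral (cbox 0 (2 * pi)) (\<lambda>t. norm (1 + complex_of_real r * cis t) powr u))"
    by (rule integral_continuous_on_param)
       (unfold split_beta, intro continuous_intros continuous_on_powr', use assms in auto)
  then show ?thesis unfolding linear_mean_def[abs_def] by (intro continuous_intros) auto
qed

text \<open>Continuity at \<open>r = 1\<close> preserves part of the strict gap on an interval of
  radii. The source side is needed at \<open>r = 1\<close> only, which bounds all shifts from above;
  the target side is needed for small shifts, where all radii exceed \<open>r0\<close>.\<close>

lemma linear_mean_gap:
  assumes p: "0 < p" and pu: "p < u"
  shows "\<exists>\<kappa> r0. 1 < \<kappa> \<and> 1/2 \<le> r0 \<and> r0 < 1 \<and>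
    (\<forall>r. r0 \<le> r \<longrightarrow> r \<le> 1 \<longrightarrow> \<kappa> * linear_mean p 1 powr (1 / p) \<le> linear_mean u r powr (1 / u))"
proof -
  let ?A = "linear_mean p 1 powr (1 / p)"
  have A: "?A \<ge> 1" using linear_mean_ge_1[OF p] p by (intro ge_one_powr_ge_zero) auto
  obtain B where B: "?A < B" "B < linear_mean u 1 powr (1 / u)" using linear_mean_strict[OF p pu] dense by blast
  have "continuous_on {0..1} (\<lambda>r. linear_mean u r powr (1 / u))"
    using p pu by (intro continuous_on_powr' continuous_linear_mean continuous_intros) (auto intro: linear_mean_nonneg)
  from continuous_on_Icc_at_leftD[OF this]
  have "((\<lambda>r. linear_mean u r powr (1 / u)) \<longlongrightarrow> linear_mean u 1 powr (1 / u)) (at_left 1)" by simp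
  then have "\<forall>\<^sub>F r in at_left 1. B < linear_mean u r powr (1 / u)" using B(2) by (rule order_tendstoD)
  then obtain b where b: "b < 1" "\<And>r. b < r \<Longrightarrow> r < 1 \<Longrightarrow> B < linear_mean u r powr (1 / u)"
    unfolding eventually_at_left_field by blast
  define r0 where "r0 = (max b (1/2) + 1) / 2"
  have r0: "1/2 \<le> r0" "r0 < 1" "b < r0" using b(1) by (auto simp: r0_def)
  have gt: "1 < B / ?A" using A B by (subst pos_less_divide_eq) linarith+
  have le: "B / ?A * ?A \<le> linear_mean u r powr (1 / u)" if "r0 \<le> r" "r \<le> 1" for r
  proof -
    have "B < linear_mean u r powr (1 / u)" using b(2)[of r] B(2) that r0 by (cases "r = 1") auto
    moreover have A0: "?A \<noteq> 0" using A by linarith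
    have "B / ?A * ?A = B" unfolding times_divide_eq_left by (rule nonzero_mult_div_cancel_right[OF A0])
    ultimately show ?thesis by linarith
  qed
  show ?thesis
    by (rule exI[of _ "B / ?A"], rule exI[of _ r0]) (intro conjI allI impI gt le r0)
qed

section \<open>Products over independent coordinates\<close>

lemma nn_integral_torus_prod:
  assumes J: "finite J" and f: "\<And>j. j \<in> J \<Longrightarrow> f j \<in> borel_measurable circle_haar"
  shows "(\<integral>\<^sup>+z. (\<Prod>j\<in>J. f j (z j)) \<partial>torus_haar) = (\<Prod>j\<in>J. \<integral>\<^sup>+w. f j w \<partial>circle_haar :: ennreal)"
  using J f
proof (induction J rule: finite_induct)
  case empty
  interpret T: prob_space torus_haar by (rule prob_space_torus_haar)
  show ?case by (simp add: T.emeasure_space_1)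
next
  case (insert j J)
  have fm: "(\<lambda>z. f i (z i)) \<in> borel_measurable torus_haar" if "i \<in> insert j J" for i
    by (rule measurable_compose[OF torus_component_measurable insert.prems[OF that]])
  let ?g = "\<lambda>z. \<Prod>i\<in>insert j J. f i (z i)"
  have gm: "?g \<in> borel_measurable torus_haar" by (intro borel_measurable_prod_ennreal fm)
  \<comment> \<open>Averaging over rotations of \<open>z j\<close> alone integrates out its factor,
    since the others do not see that coordinate; this replaces a decomposition of the product
    measure.\<close>
  have "(\<integral>\<^sup>+z. ?g z \<partial>torus_haar) = (\<integral>\<^sup>+z. (\<integral>\<^sup>+w. 1 * ?g (z(j := w * z j)) \<partial>circle_haar) \<partial>torus_haar)"
    by (subst nn_integral_torus_average[OF gm])
       (auto simp: prob_space.emeasure_space_1[OF prob_space_circle_haar])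
  also have "\<dots> = (\<integral>\<^sup>+z. (\<integral>\<^sup>+w. f j w \<partial>circle_haar) * (\<Prod>i\<in>J. f i (z i)) \<partial>torus_haar)"
  proof (rule nn_integral_cong)
    fix z assume z: "z \<in> space torus_haar"
    have e: "(\<Prod>i\<in>J. f i ((z(j := w * z j)) i)) = (\<Prod>i\<in>J. f i (z i))" for w
      using insert.hyps by (intro prod.cong) auto
    have "1 * ?g (z(j := w * z j)) = f j (z j * w) * (\<Prod>i\<in>J. f i (z i))" for w
    proof -
      have "1 * ?g (z(j := w * z j)) = f j (w * z j) * (\<Prod>i\<in>J. f i (z i))"
        unfolding prod.insert[OF insert.hyps] e by simp
      then show ?thesis by (simp only: mult.commute[of w])
    qed
    then have "(\<integral>\<^sup>+w. 1 * ?g (z(j := w * z j)) \<partial>circle_haar) = (\<integral>\<^sup>+w. f j (z j * w) * (\<Prod>i\<in>J. f i (z i)) \<partial>circle_haar)"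
      by (simp only:)
    also have "\<dots> = (\<integral>\<^sup>+w. f j (z j * w) \<partial>circle_haar) * (\<Prod>i\<in>J. f i (z i))"
    proof (rule nn_integral_multc)
      have "norm (z j) = 1" using z by (simp add: space_torus_haar)
      then show "(\<lambda>w. f j (z j * w)) \<in> borel_measurable circle_haar"
        using measurable_compose[OF mult_measurable_circle insert.prems[of j]] by simp
    qed
    also have "(\<integral>\<^sup>+w. f j (z j * w) \<partial>circle_haar) = (\<integral>\<^sup>+w. f j w \<partial>circle_haar)"
      using z insert.prems by (intro nn_integral_circle_haar_rotate) (auto simp: space_torus_haar)
    finally show "(\<integral>\<^sup>+w. 1 * ?g (z(j := w * z j)) \<partial>circle_haar) = (\<integral>\<^sup>+w. f j w \<partial>circle_haar) * (\<Prod>i\<in>J. f i (z i))" .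
  qed
  also have "\<dots> = (\<integral>\<^sup>+w. f j w \<partial>circle_haar) * (\<integral>\<^sup>+z. (\<Prod>i\<in>J. f i (z i)) \<partial>torus_haar)"
    by (intro nn_integral_cmult borel_measurable_prod_ennreal fm) auto
  finally show ?case using insert by simp
qed


text \<open>The expansion of \<open>w * p_(j+N)^(-s)\<close> times the product of
  \<open>1 + p_i^(-s)\<close> over \<open>j \<le> i < j + N\<close>. The additional prime, of index
  \<open>j + N\<close>, removes the constant term, as the gliding hump demands, and has modulus one
  on the torus.\<close>

definition product_test :: "real \<Rightarrow> nat \<Rightarrow> nat \<Rightarrow> nat \<Rightarrow> complex" where
  "product_test w j N = monomial_sum (Pow {j..<j + N}) (\<lambda>S. \<Prod>i\<in>insert (j + N) S. nth_prime i) (\<lambda>_. of_real w)"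

lemma dirichlet_poly_product_test: "dirichlet_poly (product_test w j N)"
  unfolding product_test_def by (intro dirichlet_poly_monomial_sum prod_nth_prime_pos) simp

lemma product_test_support: "prime_support (product_test w j N) \<subseteq> {j..}" "product_test w j N 1 = 0"
proof -
  have *: "\<exists>S\<in>Pow {j..<j + N}. n = (\<Prod>i\<in>insert (j + N) S. nth_prime i) \<and> finite S" if nz: "product_test w j N n \<noteq> 0" for n
    using monomial_sum_nonzero[OF nz[unfolded product_test_def]] finite_subset[of _ "{j..<j + N}"] by fastforce
  show "prime_support (product_test w j N) \<subseteq> {j..}"
  proof
    fix i assume "i \<in> prime_support (product_test w j N)"
    then obtain n where n: "product_test w j N n \<noteq> 0" "prime_exponent n i \<noteq> 0"
      unfolding prime_support_def by blast
    obtain S where S: "S \<subseteq> {j..<j + N}" "n = (\<Prod>i\<in>insert (j + N) S. nth_prime i)" "finite S" using *[OF n(1)] by auto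
    have "prime_exponent n i = (if i \<in> insert (j + N) S then 1 else 0)"
      unfolding S(2) using S(3) by (intro prime_exponent_prod_nth_prime) simp
    then have "i \<in> insert (j + N) S" using n(2) by (simp split: if_splits)
    then show "i \<in> {j..}" using S(1) by auto
  qed
  show "product_test w j N 1 = 0"
  proof (rule ccontr)
    assume nz: "product_test w j N 1 \<noteq> 0"
    obtain S where S: "1 = (\<Prod>i\<in>insert (j + N) S. nth_prime i)" "finite S" using *[OF nz] by auto
    have "prime_exponent (\<Prod>i\<in>insert (j + N) S. nth_prime i) (j + N) = 1"
      using S(2) by (subst prime_exponent_prod_nth_prime) auto
    then show False unfolding S(1)[symmetric] by simp
  qed
qed

lemma prod_insert_interval:
  "S \<subseteq> {j..<j + N} \<Longrightarrow> (\<Prod>i\<in>insert (j + N) S. f i) = f (j + N) * (\<Prod>i\<in>S. f i)"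
  for j N :: nat
  by (subst prod.insert) (auto intro: finite_subset)

lemma powr_prod_nth_prime_set:
  "real (\<Prod>i\<in>S. nth_prime i) powr t = (\<Prod>i\<in>S. real (nth_prime i) powr t)"
  by (simp add: prod_powr_distrib)

lemma bohr_lift_product_test:
  "bohr_lift (dirichlet_shift \<sigma> (product_test w j N)) z
    = of_real (w * real (nth_prime (j + N)) powr (- \<sigma>)) * z (j + N) *
      (\<Prod>i\<in>{j..<j + N}. 1 + of_real (real (nth_prime i) powr (- \<sigma>)) * z i)"
proof -
  let ?r = "\<lambda>i. real (nth_prime i) powr (- \<sigma>)" and ?J = "{j..<j + N}"
  have "bohr_lift (dirichlet_shift \<sigma> (product_test w j N)) z
      = (\<Sum>S\<in>Pow ?J. of_real w * of_real (real (\<Prod>i\<in>insert (j + N) S. nth_prime i) powr (- \<sigma>)) * prime_monomial (\<Prod>i\<in>insert (j + N) S. nth_prime i) z)"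
    unfolding product_test_def shift_monomial_sum by (rule bohr_lift_monomial_sum) simp
  also have "\<dots> = (\<Sum>S\<in>Pow ?J. of_real (w * ?r (j + N)) * z (j + N) * ((\<Prod>i\<in>S. of_real (?r i) * z i) * (\<Prod>i\<in>?J - S. 1)))"
  proof (rule sum.cong)
    fix S assume "S \<in> Pow ?J"
    then have S: "S \<subseteq> ?J" "finite S" by (auto intro: finite_subset)
    have "prime_monomial (\<Prod>i\<in>insert (j + N) S. nth_prime i) z
        = (\<Prod>k\<in>insert (j + N) S. z k ^ prime_exponent (\<Prod>i\<in>insert (j + N) S. nth_prime i) k)"
      using S(2) by (intro prime_monomial_eq) (auto simp: prime_exponent_prod_nth_prime simp del: prod.insert split: if_splits)
    also have "\<dots> = (\<Prod>k\<in>insert (j + N) S. z k)"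
      using S(2) by (intro prod.cong refl) (simp add: prime_exponent_prod_nth_prime del: prod.insert)
    also have "\<dots> = z (j + N) * (\<Prod>k\<in>S. z k)" by (rule prod_insert_interval[OF S(1)])
    finally have pm: "prime_monomial (\<Prod>i\<in>insert (j + N) S. nth_prime i) z = z (j + N) * (\<Prod>k\<in>S. z k)" .
    have "real (\<Prod>i\<in>insert (j + N) S. nth_prime i) powr (- \<sigma>) = ?r (j + N) * (\<Prod>i\<in>S. ?r i)"
      unfolding powr_prod_nth_prime_set by (rule prod_insert_interval[OF S(1)])
    then show "of_real w * of_real (real (\<Prod>i\<in>insert (j + N) S. nth_prime i) powr (- \<sigma>)) * prime_monomial (\<Prod>i\<in>insert (j + N) S. nth_prime i) z
        = of_real (w * ?r (j + N)) * z (j + N) * ((\<Prod>i\<in>S. of_real (?r i) * z i) * (\<Prod>i\<in>?J - S. 1))"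
      unfolding pm by (simp add: prod.distrib mult_ac)
  qed simp
  also have "\<dots> = of_real (w * ?r (j + N)) * z (j + N) * (\<Prod>i\<in>?J. of_real (?r i) * z i + 1)"
    unfolding sum_distrib_left[symmetric] by (subst prod_add) simp_all
  finally show ?thesis by (simp only: add.commute)
qed

lemma hardy_norm_product_test:
  assumes p: "p > 0" and w: "w > 0"
  shows "hardy_norm p (dirichlet_shift \<sigma> (product_test w j N))
    = w * real (nth_prime (j + N)) powr (- \<sigma>) * (\<Prod>i\<in>{j..<j + N}. linear_mean p (real (nth_prime i) powr (- \<sigma>)) powr (1 / p))"
proof -
  let ?r = "\<lambda>i. real (nth_prime i) powr (- \<sigma>)" and ?J = "{j..<j + N}"
  let ?c = "w * ?r (j + N)"
  let ?a = "dirichlet_shift \<sigma> (product_test w j N)"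
  have c: "?c > 0" using w nth_prime_ge_2[of "j + N"] by simp
  have m: "(\<lambda>z. ennreal (norm (1 + of_real (?r i) * z) powr p)) \<in> borel_measurable circle_haar" for i
    using p by (intro circle_borel_measurable continuous_on_compose2[OF continuous_on_ennreal[OF continuous_on_id]] continuous_on_powr' continuous_intros) auto
  have "lift_moment p ?a = (\<integral>\<^sup>+z. ennreal (?c powr p) * (\<Prod>i\<in>?J. ennreal (norm (1 + of_real (?r i) * z i) powr p)) \<partial>torus_haar)"
    unfolding lift_moment_def
  proof (rule nn_integral_cong)
    fix z assume z: "z \<in> space torus_haar"
    have "norm (bohr_lift ?a z) = ?c * (\<Prod>i\<in>?J. norm (1 + of_real (?r i) * z i))"
      unfolding bohr_lift_product_test norm_mult norm_of_real using z c less_imp_le[OF w] by (simp add: space_torus_haar prod_norm)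
    then have "norm (bohr_lift ?a z) powr p = ?c powr p * (\<Prod>i\<in>?J. norm (1 + of_real (?r i) * z i) powr p)"
      using c by (simp add: powr_mult prod_powr_distrib)
    then show "ennreal (norm (bohr_lift ?a z) powr p) = ennreal (?c powr p) * (\<Prod>i\<in>?J. ennreal (norm (1 + of_real (?r i) * z i) powr p))"
      by (simp add: ennreal_mult prod_ennreal prod_nonneg)
  qed
  also have "\<dots> = ennreal (?c powr p) * (\<integral>\<^sup>+z. (\<Prod>i\<in>?J. ennreal (norm (1 + of_real (?r i) * z i) powr p)) \<partial>torus_haar)"
    by (intro nn_integral_cmult borel_measurable_prod_ennreal measurable_compose[OF torus_component_measurable m])
  also have "(\<integral>\<^sup>+z. (\<Prod>i\<in>?J. ennreal (norm (1 + of_real (?r i) * z i) powr p)) \<partial>torus_haar)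
      = (\<Prod>i\<in>?J. \<integral>\<^sup>+z. ennreal (norm (1 + of_real (?r i) * z) powr p) \<partial>circle_haar)"
    by (rule nn_integral_torus_prod[OF _ m]) simp
  also have "\<dots> = ennreal (\<Prod>i\<in>?J. linear_mean p (?r i))"
    using p by (simp add: nn_integral_linear_mean prod_ennreal linear_mean_nonneg)
  also have "ennreal (?c powr p) * ennreal (\<Prod>i\<in>?J. linear_mean p (?r i))
      = ennreal ((?c * (\<Prod>i\<in>?J. linear_mean p (?r i) powr (1 / p))) powr p)"
  proof -
    have "(\<Prod>i\<in>?J. linear_mean p (?r i) powr (1 / p)) powr p = (\<Prod>i\<in>?J. linear_mean p (?r i))"
      using p by (simp add: prod_powr_distrib powr_powr linear_mean_nonneg)
    then show ?thesis using c by (simp add: powr_mult prod_nonneg ennreal_mult[symmetric] linear_mean_nonneg p)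
  qed
  finally have eq: "hardy_norm p ?a powr p = (?c * (\<Prod>i\<in>?J. linear_mean p (?r i) powr (1 / p))) powr p"
    unfolding lift_moment_eq_hardy_norm[OF p] by simp
  have nn: "0 \<le> ?c * (\<Prod>i\<in>?J. linear_mean p (?r i) powr (1 / p))"
    using w by (intro mult_nonneg_nonneg prod_nonneg) auto
  show ?thesis
  proof (rule antisym)
    show "hardy_norm p ?a \<le> ?c * (\<Prod>i\<in>?J. linear_mean p (?r i) powr (1 / p))"
      by (rule powr_le_iff_nonneg[OF p hardy_norm_nonneg nn, THEN iffD1]) (simp only: eq order_refl)
    show "?c * (\<Prod>i\<in>?J. linear_mean p (?r i) powr (1 / p)) \<le> hardy_norm p ?a"
      by (rule powr_le_iff_nonneg[OF p nn hardy_norm_nonneg, THEN iffD1]) (simp only: eq order_refl)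
  qed
qed

lemma dirichlet_shift_0: "dirichlet_poly a \<Longrightarrow> dirichlet_shift 0 a = a"
  by (auto simp: dirichlet_shift_def fun_eq_iff dirichlet_poly_def)

text \<open>Shifts only decrease the Hardy norm and the measure has mass \<open>1\<close>, so the
  value at \<open>\<sigma> = 0\<close>, where every factor has radius \<open>1\<close>, bounds the
  mixed norm.\<close>

lemma product_test_upper:
  assumes pos: "p > 0" "q > 0" and al: "\<alpha> > -1" and w: "w > 0"
  shows "mixed_norm p q \<alpha> (product_test w j N) \<le> w * (linear_mean p 1 powr (1 / p)) ^ N"
proof (rule mixed_norm_leI[OF dirichlet_poly_product_test pos al])
  let ?Q = "product_test w j N" and ?B = "w * (linear_mean p 1 powr (1 / p)) ^ N"
  show "0 \<le> ?B" using w by simp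
  have one: "real (nth_prime i) powr (- 0) = 1" for i using nth_prime_ge_2[of i] by simp
  have "hardy_norm p ?Q = hardy_norm p (dirichlet_shift 0 ?Q)"
    by (simp only: dirichlet_shift_0[OF dirichlet_poly_product_test])
  also have "\<dots> = ?B" unfolding hardy_norm_product_test[OF pos(1) w] one by simp
  finally have B: "hardy_norm p ?Q = ?B" .
  have "mixed_moment p q \<alpha> ?Q \<le> (\<integral>\<^sup>+\<sigma>. ennreal (?B powr q) \<partial>mu_measure \<alpha>)"
    unfolding mixed_moment_def
  proof (rule nn_integral_mono_AE)
    show "AE \<sigma> in mu_measure \<alpha>. ennreal (hardy_norm p (dirichlet_shift \<sigma> ?Q) powr q) \<le> ennreal (?B powr q)"
      using AE_mu_measure_pos unfolding B[symmetric]
      by eventually_elim (use pos in \<open>auto intro!: ennreal_leI powr_mono2 hardy_norm_shift_le dirichlet_poly_product_test\<close>)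
  qed
  also have "\<dots> = ennreal (?B powr q)" by (simp add: emeasure_mu_measure_UNIV[OF al])
  finally show "mixed_moment p q \<alpha> ?Q \<le> ennreal (?B powr q)" .
qed

text \<open>The weighted coefficient sum is again a product, now of
  \<open>1 + p_i powr (- (1 / 2))\<close>. Replacing each prime by the smallest one leaves a base
  close to \<open>1\<close> when \<open>j\<close> is large.\<close>

lemma product_test_coeff_sum:
  assumes w: "w > 0"
  shows "(\<Sum>n | product_test w j N n \<noteq> 0. norm (product_test w j N n) * real n powr (- (1 / 2)))
    \<le> w * (1 + real (nth_prime j) powr (- (1 / 2))) ^ N"
proof -
  let ?r = "\<lambda>i. real (nth_prime i) powr (- (1 / 2))" and ?J = "{j..<j + N}"
  have "(\<Sum>n | product_test w j N n \<noteq> 0. norm (product_test w j N n) * real n powr (- (1 / 2)))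
      \<le> (\<Sum>S\<in>Pow ?J. norm (complex_of_real w) * real (\<Prod>i\<in>insert (j + N) S. nth_prime i) powr (- (1 / 2)))"
    unfolding product_test_def by (rule monomial_sum_coeff_sum_le) simp
  also have "\<dots> = (\<Sum>S\<in>Pow ?J. w * ?r (j + N) * ((\<Prod>i\<in>S. ?r i) * (\<Prod>i\<in>?J - S. 1)))"
  proof (rule sum.cong)
    fix S assume "S \<in> Pow ?J"
    then have S: "S \<subseteq> ?J" by auto
    have "real (\<Prod>i\<in>insert (j + N) S. nth_prime i) powr (- (1 / 2)) = ?r (j + N) * (\<Prod>i\<in>S. ?r i)"
      unfolding powr_prod_nth_prime_set by (rule prod_insert_interval[OF S])
    then show "norm (complex_of_real w) * real (\<Prod>i\<in>insert (j + N) S. nth_prime i) powr (- (1 / 2)) = w * ?r (j + N) * ((\<Prod>i\<in>S. ?r i) * (\<Prod>i\<in>?J - S. 1))"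
      using w by (simp only: norm_of_real abs_of_pos prod.neutral_const mult_1_right mult.assoc)
  qed simp
  also have "\<dots> = w * ?r (j + N) * (\<Prod>i\<in>?J. ?r i + 1)"
    unfolding sum_distrib_left[symmetric] by (subst prod_add) simp_all
  also have "\<dots> \<le> w * 1 * (1 + ?r j) ^ N"
  proof (intro mult_mono)
    show "?r (j + N) \<le> 1" using nth_prime_ge_2[of "j + N"] powr_mono[of "- (1/2)" 0 "real (nth_prime (j + N))"] by simp
    have "(\<Prod>i\<in>?J. ?r i + 1) \<le> (\<Prod>i\<in>?J. 1 + ?r j)"
    proof (rule prod_mono)
      fix i assume "i \<in> ?J"
      then have "nth_prime j \<le> nth_prime i" using strict_mono_less_eq[OF strict_mono_nth_prime] by simp
      then have "?r i \<le> ?r j" using nth_prime_ge_2[of j] by (intro powr_mono2') auto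
      then show "0 \<le> ?r i + 1 \<and> ?r i + 1 \<le> 1 + ?r j" by simp
    qed
    then show "(\<Prod>i\<in>?J. ?r i + 1) \<le> (1 + ?r j) ^ N" by simp
  qed (use w in \<open>auto intro!: prod_nonneg\<close>)
  finally show ?thesis by simp
qed

text \<open>For shifts up to \<open>\<delta> / (N + j + 1)\<close> every radius is at least
  \<open>r0\<close>, so each of the \<open>N\<close> factors contributes at least \<open>D\<close>.
  Only the mass of one short interval is lost, a power of \<open>N\<close> against exponential
  gains.\<close>

lemma product_test_lower:
  assumes pos: "u > 0" "v > 0" and be: "\<beta> > -1" and r0: "1/2 \<le> r0" "r0 < 1" and D: "D > 0"
    and gap: "\<And>r. r0 \<le> r \<Longrightarrow> r \<le> 1 \<Longrightarrow> D \<le> linear_mean u r powr (1 / u)"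
  shows "\<exists>c \<delta>. c > 0 \<and> \<delta> > 0 \<and> (\<forall>w j N. w > 0 \<longrightarrow>
    c * (w * D ^ N) powr v * (\<delta> / (real N + (real j + 1))) powr (\<beta> + 1) \<le> mixed_norm u v \<beta> (product_test w j N) powr v)"
proof -
  obtain c where c: "c > 0" "\<And>s. 0 < s \<Longrightarrow> s \<le> 1 \<Longrightarrow> ennreal (c * s powr (\<beta> + 1)) \<le> emeasure (mu_measure \<beta>) {s/2<..s}"
    using mu_measure_interval[OF be] by blast
  \<comment> \<open>Since \<open>ln p_i \<le> (j + N + 1) * ln 4\<close>, the condition
    \<open>\<delta> * ln 4 \<le> ln (1 / r0)\<close> is what keeps the radii above
    \<open>r0\<close>. The cap \<open>1\<close> keeps the shift in the range of the interval
    estimate.\<close>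
  define \<delta> where "\<delta> = min 1 (ln (1 / r0) / ln 4)"
  have "ln (1 / r0) > 0" using r0 by (intro ln_gt_zero) auto
  then have \<delta>: "\<delta> > 0" "\<delta> \<le> 1" "\<delta> * ln 4 \<le> ln (1 / r0)"
    unfolding \<delta>_def by (auto simp: min_def field_simps)
  show ?thesis
  proof (rule exI[of _ "r0 powr v * c"], rule exI[of _ \<delta>], intro conjI allI impI)
    show "r0 powr v * c > 0" using c r0 by simp
    show "\<delta> > 0" by (rule \<delta>)
    fix w :: real and j N assume w: "w > 0"
    let ?Q = "product_test w j N" and ?J = "{j..<j + N}"
    define s where "s = \<delta> / (real N + (real j + 1))"
    have s: "0 < s" "s \<le> 1" using \<delta> by (auto simp: s_def divide_le_eq)
    have r: "r0 \<le> real (nth_prime i) powr (- t)" "real (nth_prime i) powr (- t) \<le> 1" if i: "i \<le> j + N" and t: "0 < t" "t \<le> s" for i t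
    proof -
      have "t * ln (real (nth_prime i)) \<le> s * (real (Suc (j + N)) * ln 4)"
      proof (rule mult_mono)
        have "ln (real (nth_prime i)) \<le> real (Suc i) * ln 4" by (rule ln_nth_prime_le)
        also have "\<dots> \<le> real (Suc (j + N)) * ln 4" using i by (intro mult_right_mono) auto
        finally show "ln (real (nth_prime i)) \<le> real (Suc (j + N)) * ln 4" .
      qed (use t s nth_prime_ge_2[of i] in auto)
      also have "\<dots> = \<delta> * ln 4" by (simp add: s_def field_simps)
      also have "\<dots> \<le> ln (1 / r0)" by (rule \<delta>)
      finally have "ln r0 \<le> - t * ln (real (nth_prime i))" using r0 by (simp add: ln_div)
      then have "exp (ln r0) \<le> exp (- t * ln (real (nth_prime i)))" by (simp only: exp_le_cancel_iff)
      then show "r0 \<le> real (nth_prime i) powr (- t)" using r0 nth_prime_ge_2[of i] by (simp add: powr_def)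
      show "real (nth_prime i) powr (- t) \<le> 1"
        using nth_prime_ge_2[of i] t powr_mono[of "- t" 0 "real (nth_prime i)"] by simp
    qed
    have low: "w * r0 * D ^ N \<le> hardy_norm u (dirichlet_shift t ?Q)" if t: "0 < t" "t \<le> s" for t
    proof -
      have "(\<Prod>i\<in>?J. D) \<le> (\<Prod>i\<in>?J. linear_mean u (real (nth_prime i) powr (- t)) powr (1 / u))"
        using D by (intro prod_mono conjI gap r t) auto
      then have "D ^ N \<le> (\<Prod>i\<in>?J. linear_mean u (real (nth_prime i) powr (- t)) powr (1 / u))" by simp
      moreover have "w * r0 \<le> w * real (nth_prime (j + N)) powr (- t)" using w by (intro mult_left_mono r t) auto
      ultimately show ?thesis
        unfolding hardy_norm_product_test[OF pos(1) w] using w D r0 by (intro mult_mono) auto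
    qed
    have "ennreal (r0 powr v * c * (w * D ^ N) powr v * s powr (\<beta> + 1)) = ennreal ((w * r0 * D ^ N) powr v) * ennreal (c * s powr (\<beta> + 1))"
      using c w D r0 by (subst ennreal_mult[symmetric]) (auto simp: powr_mult mult_ac)
    also have "\<dots> \<le> ennreal ((w * r0 * D ^ N) powr v) * emeasure (mu_measure \<beta>) {s/2<..s}"
      using s by (intro mult_left_mono c) auto
    also have "\<dots> = (\<integral>\<^sup>+t. ennreal ((w * r0 * D ^ N) powr v) * indicator {s/2<..s} t \<partial>mu_measure \<beta>)"
      by (subst nn_integral_cmult_indicator) auto
    also have "\<dots> \<le> mixed_moment u v \<beta> ?Q"
      unfolding mixed_moment_def
    proof (rule nn_integral_mono)
      fix t
      show "ennreal ((w * r0 * D ^ N) powr v) * indicator {s/2<..s} t \<le> ennreal (hardy_norm u (dirichlet_shift t ?Q) powr v)"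
        using low[of t] s pos w D r0 by (auto simp: indicator_def intro!: ennreal_leI powr_mono2)
    qed
    also have "\<dots> = ennreal (mixed_norm u v \<beta> ?Q powr v)"
      by (rule mixed_moment_eq[OF dirichlet_poly_product_test pos be])
    finally show "r0 powr v * c * (w * D ^ N) powr v * (\<delta> / (real N + (real j + 1))) powr (\<beta> + 1) \<le> mixed_norm u v \<beta> ?Q powr v"
      unfolding s_def by simp
  qed
qed

text \<open>With \<open>A\<close> and \<open>\<kappa> A\<close> bounding the \<open>p\<close>- and \<open>u\<close>-means of a single factor and \<open>\<lambda>\<^sup>4 = \<kappa>\<close>, the weight
  \<open>(\<lambda>\<^sup>2 A)\<^sup>-\<^sup>N\<close> makes the source norm decay and the target norm grow exponentially in the number \<open>N\<close> of factors,
  while the passage to \<open>\<sigma> > 0\<close> costs only a power of \<open>N\<close>.\<close>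

lemma not_subset_of_exponent:
  assumes pos: "0 < p" "0 < q" "0 < u" "0 < v" and al: "\<alpha> > -1" and be: "\<beta> > -1" and pu: "p < u"
  shows "\<not> mixed_norm_space p q \<alpha> \<subseteq> mixed_norm_space u v \<beta>"
proof (rule gliding_hump[OF pos al be])
  fix \<epsilon> :: real and j :: nat assume \<epsilon>: "\<epsilon> > 0"
  define A where "A = linear_mean p 1 powr (1 / p)"
  have A: "A \<ge> 1" unfolding A_def using linear_mean_ge_1[OF pos(1)] pos by (intro ge_one_powr_ge_zero) auto
  obtain \<kappa> r0 where k: "1 < \<kappa>" "1/2 \<le> r0" "r0 < 1" "\<And>r. r0 \<le> r \<Longrightarrow> r \<le> 1 \<Longrightarrow> \<kappa> * A \<le> linear_mean u r powr (1 / u)"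
    unfolding A_def using linear_mean_gap[OF pos(1) pu] by blast
  \<comment> \<open>Source and target each receive a factor \<open>l^2\<close> per prime. The fourth
    root leaves room for a third requirement: the weighted coefficient sum has base below
    \<open>l * A\<close>, so against the weight it still decays like
    \<open>1 / l ^ N\<close>.\<close>
  define l where "l = \<kappa> powr (1 / 4)"
  have l: "l > 1" "l ^ 4 = \<kappa>" using k(1) by (auto simp: l_def powr_power)
  have kA: "\<kappa> * A > 0" using k A by simp
  obtain c \<delta> where cd: "c > 0" "\<delta> > 0" "\<And>w j N. w > 0 \<Longrightarrow>
    c * (w * (\<kappa> * A) ^ N) powr v * (\<delta> / (real N + (real j + 1))) powr (\<beta> + 1) \<le> mixed_norm u v \<beta> (product_test w j N) powr v"
    using product_test_lower[OF pos(3,4) be k(2,3) kA k(4)] by blast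
  \<comment> \<open>The block is moved out to larger primes until the base of the weighted
    coefficient sum is below \<open>l\<close>. This fixes \<open>j0\<close> before \<open>N\<close>
    is chosen, so that \<open>j0\<close> is a constant in the limits that follow.\<close>
  have "((\<lambda>i::nat. 1 + real i powr (- (1 / 2))) \<longlonglongrightarrow> 1)" by real_asymp
  then have "\<forall>\<^sub>F i in sequentially. 1 + real i powr (- (1 / 2)) < l" using l(1) by (rule order_tendstoD)
  then obtain i0 where i0: "\<And>i. i \<ge> i0 \<Longrightarrow> 1 + real i powr (- (1 / 2)) < l" unfolding eventually_sequentially by blast
  define j0 where "j0 = max j (max i0 1)"
  have j0: "1 + real (nth_prime j0) powr (- (1 / 2)) < l"
    using le_nth_prime[of j0] by (intro i0) (simp add: j0_def)
  define L where "L = l\<^sup>2"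
  have L: "L > 1" unfolding L_def using l by (intro one_less_power) auto
  have 1: "\<forall>\<^sub>F N in sequentially. (1 / L ^ N) powr q < \<epsilon>"
  proof -
    have "((\<lambda>N::nat. (1 / L ^ N) powr q) \<longlonglongrightarrow> 0)" using L pos by real_asymp
    then show ?thesis using \<epsilon> by (rule order_tendstoD)
  qed
  have 2: "\<forall>\<^sub>F N in sequentially. 1 / l ^ N < \<epsilon>"
  proof -
    have "((\<lambda>N::nat. 1 / l ^ N) \<longlonglongrightarrow> 0)" using l(1) by real_asymp
    then show ?thesis using \<epsilon> by (rule order_tendstoD)
  qed
  have 3: "\<forall>\<^sub>F N in sequentially. (1 / \<epsilon>) powr v < c * (L ^ N) powr v * (\<delta> / (real N + (real j0 + 1))) powr (\<beta> + 1)"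
  proof -
    have "filterlim (\<lambda>N::nat. c * (L ^ N) powr v * (\<delta> / (real N + (real j0 + 1))) powr (\<beta> + 1)) at_top at_top"
      using L cd(1,2) pos by real_asymp
    then show ?thesis by (simp add: filterlim_at_top_dense)
  qed
  have "\<forall>\<^sub>F N in sequentially. (1 / L ^ N) powr q < \<epsilon> \<and> 1 / l ^ N < \<epsilon> \<and>
      (1 / \<epsilon>) powr v < c * (L ^ N) powr v * (\<delta> / (real N + (real j0 + 1))) powr (\<beta> + 1)"
    using 1 2 3 by eventually_elim blast
  then obtain N where N: "(1 / L ^ N) powr q < \<epsilon>" "1 / l ^ N < \<epsilon>"
      "(1 / \<epsilon>) powr v < c * (L ^ N) powr v * (\<delta> / (real N + (real j0 + 1))) powr (\<beta> + 1)"
    unfolding eventually_sequentially by blast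
  define w where "w = 1 / (L * A) ^ N"
  have w: "w > 0" unfolding w_def using L A by simp
  have wA: "w * A ^ N = 1 / L ^ N" unfolding w_def using L A by (simp add: power_mult_distrib)
  have wk: "w * (\<kappa> * A) ^ N = L ^ N"
  proof -
    have "\<kappa> = L * L" by (simp add: L_def l(2)[symmetric] power_numeral_reduce power2_eq_square)
    then show ?thesis unfolding w_def using L A by (simp add: power_mult_distrib)
  qed
  let ?Q = "product_test w j0 N"
  have "mixed_norm p q \<alpha> ?Q powr q \<le> (1 / L ^ N) powr q"
    using product_test_upper[OF pos(1,2) al w, of j0 N] pos unfolding A_def[symmetric] wA by (intro powr_mono2) auto
  then have M: "mixed_norm p q \<alpha> ?Q powr q \<le> \<epsilon>" using N(1) by linarith
  have "(\<Sum>n | ?Q n \<noteq> 0. norm (?Q n) * real n powr (- (1 / 2))) \<le> w * (1 + real (nth_prime j0) powr (- (1 / 2))) ^ N"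
    by (rule product_test_coeff_sum[OF w])
  also have "\<dots> \<le> w * (l * A) ^ N"
  proof (intro mult_left_mono power_mono)
    have "l * 1 \<le> l * A" using A l by (intro mult_left_mono) auto
    then show "1 + real (nth_prime j0) powr (- (1 / 2)) \<le> l * A" using j0 by linarith
  qed (use w in \<open>auto intro: add_nonneg_nonneg\<close>)
  also have "\<dots> = 1 / l ^ N"
    unfolding w_def L_def using l A by (simp add: power_mult_distrib power2_eq_square)
  finally have S: "(\<Sum>n | ?Q n \<noteq> 0. norm (?Q n) * real n powr (- (1 / 2))) \<le> \<epsilon>" using N(2) by linarith
  have U: "1 / \<epsilon> \<le> mixed_norm u v \<beta> ?Q"
    using N(3) cd(3)[OF w, of N j0] unfolding wk by (intro powr_root_le[OF pos(4) \<epsilon>]) auto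
  have "prime_support ?Q \<subseteq> {j..}" using product_test_support(1)[of w j0 N] by (auto simp: j0_def)
  then show "\<exists>Q. dirichlet_poly Q \<and> Q 1 = 0 \<and> prime_support Q \<subseteq> {j..} \<and>
      mixed_norm p q \<alpha> Q powr q \<le> \<epsilon> \<and> (\<Sum>n | Q n \<noteq> 0. norm (Q n) * real n powr (- (1 / 2))) \<le> \<epsilon> \<and>
      1 / \<epsilon> \<le> mixed_norm u v \<beta> Q"
    using M S U product_test_support(2)[of w j0 N] dirichlet_poly_product_test by blast
qed

theorem theorem1p6:
  fixes p q u v \<alpha> \<beta> :: real
  assumes "0 < p" "0 < q" "0 < u" "0 < v"
    and "\<alpha> > -1" "\<beta> > -1"
  shows "mixed_norm_space p q \<alpha> \<subseteq> mixed_norm_space u v \<beta> \<longleftrightarrow>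
    (p \<ge> u \<and> (\<alpha> + 1) / q < (\<beta> + 1) / v) \<or>
    (p \<ge> u \<and> (\<alpha> + 1) / q = (\<beta> + 1) / v \<and> q \<le> v)"
proof
  assume sub: "mixed_norm_space p q \<alpha> \<subseteq> mixed_norm_space u v \<beta>"
  have "u \<le> p" using not_subset_of_exponent[OF assms] sub by (meson not_le)
  moreover have "\<not> ((\<beta> + 1) / v < (\<alpha> + 1) / q \<or> (\<alpha> + 1) / q = (\<beta> + 1) / v \<and> v < q)"
    using not_subset_of_weights[OF assms] sub by blast
  ultimately show "(p \<ge> u \<and> (\<alpha> + 1) / q < (\<beta> + 1) / v) \<or>
      (p \<ge> u \<and> (\<alpha> + 1) / q = (\<beta> + 1) / v \<and> q \<le> v)" by linarith
next
  assume "(p \<ge> u \<and> (\<alpha> + 1) / q < (\<beta> + 1) / v) \<or> (p \<ge> u \<and> (\<alpha> + 1) / q = (\<beta> + 1) / v \<and> q \<le> v)"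
  then show "mixed_norm_space p q \<alpha> \<subseteq> mixed_norm_space u v \<beta>"
    using mixed_norm_space_mono[OF assms] by blast
qed

end
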